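(* Let $X$ be a random variable with values in $[0,1)$ having a density. The height $H_n$ of a scaled attachment random recursive tree with attachment $X$ satisfies \[ \lim_{n\to\infty}\frac{H_n}{\log n}=\alpha_{\max}\quad\text{with probability }1,\qquad\text{and}\qquad \lim_{n\to\infty}\frac{\mathbf{E}\{H_n\}}{\log n}=\alpha_{\max}. \]
   Context: Scaled attachment random recursive tree (SARRT) with attachment $X$: let $X_0,X_1,X_2,\dots$ be i.i.d. random variables distributed as $X\in[0,1)$. The nodes are labeled $0,1,2,\dots$ (the tree of order $n$ uses nodes $0,\dots,n$); the root is $0$ and the parent of node $i\ge1$ is the node labeled $\lfloor iX_i\rfloor$. Set $L(i,0)=i$ and $L(i,j+1)=\lfloor L(i,j)X_{L(i,j)}\rfloor$. The depth of node $i$ is $D_i=\min\{j\ge0:L(i,j)=0\}$, and the height is $H_n=\max_{1\le i\le n}D_i$. Let $\mu=\mathbf{E}\{-\log X\}\in(0,+\infty]$, with $1/\mu=0$ when $\mu=+\infty$. Let $\Lambda(\lambda)=\log\mathbf{E}\{X^\lambda\}\in(-\infty,+\infty]$ for $\lambda\in\mathbb R$, $\Lambda^*(z)=\sup_{\lambda\in\mathbb R}\{\lambda z-\Lambda(\lambda)\}$, $\Psi(c)=c\,\Lambda^*(-1/c)$ for $c>0$, and \[ \alpha_{\max}=\inf\left\{c:\ c>\tfrac1\mu\ \text{ and }\ \Psi(c)>1\right\}. \] *)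

theory Defs
  imports "HOL-Probability.Probability"
begin

text \<open>
  The sequence \<open>x\<close> is one realisation of the attachment variables. Node \<open>0\<close> is the root, and
  node \<open>i \<ge> 1\<close> is attached to \<open>parent x i\<close>. If all \<open>x i\<close> lie in \<open>[0, 1)\<close>, then
  \<open>parent x i < i\<close> for \<open>i \<ge> 1\<close>, so that every ancestral line ends in the root and the
  \<open>LEAST\<close> in \<open>depth\<close> is taken over a nonempty set.
\<close>

definition parent :: "(nat \<Rightarrow> real) \<Rightarrow> nat \<Rightarrow> nat" where
  "parent x i = nat \<lfloor>real i * x i\<rfloor>"

primrec ancestor :: "(nat \<Rightarrow> real) \<Rightarrow> nat \<Rightarrow> nat \<Rightarrow> nat" where
  "ancestor x i 0 = i"
| "ancestor x i (Suc j) = parent x (ancestor x i j)"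

definition depth :: "(nat \<Rightarrow> real) \<Rightarrow> nat \<Rightarrow> nat" where
  "depth x i = (LEAST j. ancestor x i j = 0)"

text \<open>Used for \<open>n \<ge> 1\<close> only; \<open>height x 0\<close> is the unspecified maximum of the empty set.\<close>

definition height :: "(nat \<Rightarrow> real) \<Rightarrow> nat \<Rightarrow> nat" where
  "height x n = Max (depth x ` {1..n})"

definition ext_ln :: "ennreal \<Rightarrow> ereal" where
  "ext_ln a = (if a = 0 then -\<infinity> else if a = \<infinity> then \<infinity> else ereal (ln (enn2real a)))"

text \<open>
  The following quantities are meant for a variable \<open>X\<close> on the probability space \<open>N\<close> with
  \<open>0 < X < 1\<close> almost surely (which is the case if \<open>X\<close> has values in \<open>[0, 1)\<close> and a density).
  The library conventions \<open>ln 0 = 0\<close> and \<open>0 powr t = 0\<close> are then immaterial, and the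
  nonnegative integrals below are the expectations of nonnegative variables, with value \<open>\<infinity>\<close>
  if they diverge.
\<close>

definition neg_log_mean :: "'b measure \<Rightarrow> ('b \<Rightarrow> real) \<Rightarrow> ennreal" where
  "neg_log_mean N X = (\<integral>\<^sup>+ \<omega>. ennreal (- ln (X \<omega>)) \<partial>N)"

definition Lam :: "'b measure \<Rightarrow> ('b \<Rightarrow> real) \<Rightarrow> real \<Rightarrow> ereal" where
  "Lam N X t = ext_ln (\<integral>\<^sup>+ \<omega>. ennreal (X \<omega> powr t) \<partial>N)"

definition Lam_star :: "'b measure \<Rightarrow> ('b \<Rightarrow> real) \<Rightarrow> real \<Rightarrow> ereal" where
  "Lam_star N X z = (SUP t::real. ereal (t * z) - Lam N X t)"

definition Psi :: "'b measure \<Rightarrow> ('b \<Rightarrow> real) \<Rightarrow> real \<Rightarrow> ereal" where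
  "Psi N X c = ereal c * Lam_star N X (- 1 / c)"

text \<open>
  The condition \<open>ennreal c > 1 / neg_log_mean N X\<close> forces \<open>c > 0\<close>, since \<open>ennreal c = 0\<close> for
  \<open>c \<le> 0\<close>; division in \<^typ>\<open>ennreal\<close> gives \<open>1 / \<infinity> = 0\<close>. The set is nonempty, because
  \<open>neg_log_mean N X > 0\<close> and \<open>Psi N X c \<ge> - 1 - c * Lam N X 1\<close> for \<open>c > 0\<close>, with \<open>Lam N X 1 < 0\<close>; so the
  infimum over the reals is the true one.
\<close>

definition alpha_max :: "'b measure \<Rightarrow> ('b \<Rightarrow> real) \<Rightarrow> real" where
  "alpha_max N X = Inf {c::real. ennreal c > 1 / neg_log_mean N X \<and> Psi N X c > 1}"

end

theory Submission
  imports Defs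
begin

text \<open>
  Write \<open>D\<close> for the law of \<open>X\<close> and \<open>m t = E (X powr t)\<close>.

  Upper bound: since the labels on an ancestral line decrease strictly,
  \<open>P (L (i, k) \<noteq> 0) \<le> i powr t * m t ^ k\<close> by induction on \<open>k\<close>. If \<open>c > alpha_max\<close>, some \<open>t > 0\<close> has
  \<open>1 + t + c * ln (m t) < 0\<close>, and a union bound over the nodes, Borel--Cantelli along powers of \<open>2\<close>
  and monotonicity of the height give the claim.

  Lower bound: read forwards, a node with a large label \<open>j\<close> has in the mean
  \<open>exp y * P (- ln X \<in> dy)\<close> children near \<open>j * exp y\<close>. If \<open>c < alpha_max\<close>, then some \<open>q < 1\<close> has
  \<open>m t \<ge> exp (- (t + q) / c)\<close> for all \<open>t \<ge> 0\<close>, and by Cramer's lower bound the mean number of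
  descendants in generation \<open>k\<close> at log-distance at most \<open>k / c'\<close>, where \<open>c' < c\<close>, grows
  exponentially in \<open>k\<close>. Fix such a \<open>k\<close> and cut the range of \<open>- ln X\<close> into so many types that, along
  any sequence of \<open>k\<close> types, the generations of a set \<open>A\<close> of nodes in a short log-window occupy
  disjoint label windows. Then each generation is a sum of independent indicators given the previous
  one, and Chebyshev's inequality shows that, with an exceptional probability of order \<open>1 / card A\<close>,
  all type sequences together yield so many descendants that one short window contains many more of
  them than \<open>A\<close> has nodes. Iterating, the exceptional probabilities form a geometric series.
\<close>

section \<open>Cramer's lower bound for finitely many types\<close>

text \<open>The weight \<open>exp y\<close> counts: \<open>j\<close> is chosen by the
  \<open>i\<close> with \<open>j \<le> i * X < j + 1\<close>, about \<open>1 / X\<close> of them.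
  The Laplace transform of this offspring measure at \<open>\<theta>\<close> is
  \<open>m (\<theta> - 1)\<close>, so that \<open>\<theta> = 1 + t\<close> matches the exponent
  \<open>1 + t + c * ln (m t)\<close> of the union bound; the condition \<open>c > 1 / mu\<close> in
  \<open>alpha_max\<close> forces the relevant \<open>t\<close> to be positive.

  The obstacle is dependence: no coordinate may be inspected twice. Cutting off
  \<open>- ln X < b\<close> makes each generation leave a window of log-width at most
  \<open>b\<close>, so that the next one reads fresh coordinates; cutting off
  \<open>- ln X \<ge> B\<close> leaves finitely many types with bounded weights. The cut must
  preserve growth uniformly in \<open>\<theta>\<close>. Then the block length \<open>k\<close> is
  chosen, and only then the width of the types, which must be small compared with
  \<open>b / k\<close>. Since the failure probability is of order \<open>1 / card A\<close> and the
  start may be a full window of labels near \<open>n\<close>, survival has probability tending to 1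
  with \<open>n\<close>, which gives the almost sure bound without a zero-one law.\<close>

lemma sum_lists_Suc:
  assumes "finite I"
  shows "(\<Sum>\<tau> | set \<tau> \<subseteq> I \<and> length \<tau> = Suc k. h \<tau>)
    = (\<Sum>t\<in>I. \<Sum>\<tau> | set \<tau> \<subseteq> I \<and> length \<tau> = k. h (t # \<tau>))"
proof -
  let ?L = "{\<tau>. set \<tau> \<subseteq> I \<and> length \<tau> = k}"
  have "(\<Sum>\<tau> | set \<tau> \<subseteq> I \<and> length \<tau> = Suc k. h \<tau>) = (\<Sum>(\<tau>, t)\<in>?L \<times> I. h (t # \<tau>))"
    unfolding lists_length_Suc_eq
    by (subst sum.reindex) (auto simp: inj_on_def case_prod_unfold)
  also have "\<dots> = (\<Sum>\<tau>\<in>?L. \<Sum>t\<in>I. h (t # \<tau>))"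
    by (rule sum.cartesian_product[symmetric])
  also have "\<dots> = (\<Sum>t\<in>I. \<Sum>\<tau>\<in>?L. h (t # \<tau>))"
    by (rule sum.swap)
  finally show ?thesis .
qed

text \<open>A word weighted by \<open>prod_list (map p \<tau>)\<close> is a sample of
  \<open>k\<close> independent letters: the cross terms vanish by centring, so variances add. Finite
  sums over words stand in for a product measure.\<close>

lemma lists_moments:
  fixes p g :: "'t \<Rightarrow> real"
  assumes I: "finite I" and p1: "(\<Sum>t\<in>I. p t) = 1" and g0: "(\<Sum>t\<in>I. p t * g t) = 0"
  shows "(\<Sum>\<tau> | set \<tau> \<subseteq> I \<and> length \<tau> = k. prod_list (map p \<tau>)) = 1"
    and "(\<Sum>\<tau> | set \<tau> \<subseteq> I \<and> length \<tau> = k. prod_list (map p \<tau>) * sum_list (map g \<tau>)) = 0"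
    and "(\<Sum>\<tau> | set \<tau> \<subseteq> I \<and> length \<tau> = k. prod_list (map p \<tau>) * (sum_list (map g \<tau>))\<^sup>2)
      = real k * (\<Sum>t\<in>I. p t * (g t)\<^sup>2)"
proof (induction k)
  case 0
  have [simp]: "{\<tau>. set \<tau> \<subseteq> I \<and> \<tau> = []} = {[]}"
    by auto
  case 1 show ?case by simp
  case 2 show ?case by simp
  case 3 show ?case by simp
next
  case (Suc k)
  note IH = Suc
  let ?L = "{\<tau>. set \<tau> \<subseteq> I \<and> length \<tau> = k}"
  let ?P = "\<lambda>\<tau>. prod_list (map p \<tau>)" and ?G = "\<lambda>\<tau>. sum_list (map g \<tau>)"
  case 1
  show ?case
    using IH(1) p1 by (simp add: sum_lists_Suc[OF I] flip: sum_distrib_left)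
  case 2
  have "(\<Sum>\<tau>\<in>?L. p t * ?P \<tau> * (g t + ?G \<tau>)) = p t * g t * (\<Sum>\<tau>\<in>?L. ?P \<tau>) + p t * (\<Sum>\<tau>\<in>?L. ?P \<tau> * ?G \<tau>)" for t
    by (simp add: sum_distrib_left sum.distrib algebra_simps)
  then have *: "(\<Sum>\<tau>\<in>?L. p t * ?P \<tau> * (g t + ?G \<tau>)) = p t * g t" for t
    using IH by simp
  show ?case
    using g0 by (simp add: sum_lists_Suc[OF I] *)
  case 3
  have "(\<Sum>\<tau>\<in>?L. p t * ?P \<tau> * (g t + ?G \<tau>)\<^sup>2) = p t * (g t)\<^sup>2 * (\<Sum>\<tau>\<in>?L. ?P \<tau>)
      + 2 * p t * g t * (\<Sum>\<tau>\<in>?L. ?P \<tau> * ?G \<tau>) + p t * (\<Sum>\<tau>\<in>?L. ?P \<tau> * (?G \<tau>)\<^sup>2)" for t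
    by (simp add: sum_distrib_left sum.distrib algebra_simps power2_eq_square)
  then have *: "(\<Sum>\<tau>\<in>?L. p t * ?P \<tau> * (g t + ?G \<tau>)\<^sup>2) = p t * (g t)\<^sup>2 + p t * (real k * (\<Sum>t\<in>I. p t * (g t)\<^sup>2))" for t
    using IH by simp
  show ?case
    using p1 by (simp only: sum_lists_Suc[OF I] list.map prod_list.Cons sum_list.Cons *)
      (simp add: sum.distrib distrib_right flip: sum_distrib_right)
qed

text \<open>Chebyshev's inequality for the product weights: on the complement the squared sum
  exceeds \<open>(k * \<epsilon>)\<^sup>2\<close>, while its total is at most
  \<open>k * V\<close>.\<close>

lemma lists_Chebyshev:
  fixes p g :: "'t \<Rightarrow> real"
  assumes I: "finite I" and p0: "\<And>t. t \<in> I \<Longrightarrow> 0 \<le> p t"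
    and p1: "(\<Sum>t\<in>I. p t) = 1" and g0: "(\<Sum>t\<in>I. p t * g t) = 0"
    and V: "(\<Sum>t\<in>I. p t * (g t)\<^sup>2) \<le> V" and "k > 0" "\<epsilon> > 0"
  shows "1 - V / (k * \<epsilon>\<^sup>2)
    \<le> (\<Sum>\<tau> | (set \<tau> \<subseteq> I \<and> length \<tau> = k) \<and> \<bar>sum_list (map g \<tau>)\<bar> \<le> k * \<epsilon>. prod_list (map p \<tau>))"
proof -
  let ?L = "{\<tau>. set \<tau> \<subseteq> I \<and> length \<tau> = k}"
  let ?P = "\<lambda>\<tau>. prod_list (map p \<tau>)" and ?G = "\<lambda>\<tau>. sum_list (map g \<tau>)"
  let ?A = "{\<tau> \<in> ?L. \<bar>?G \<tau>\<bar> \<le> k * \<epsilon>}"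
  have fin: "finite ?L"
    using finite_lists_length_eq[OF I] .
  have P0: "0 \<le> ?P \<tau>" if "\<tau> \<in> ?L" for \<tau>
    using that p0 by (intro prod_list_nonneg) auto
  have "(k * \<epsilon>)\<^sup>2 * (\<Sum>\<tau>\<in>?L - ?A. ?P \<tau>) \<le> (\<Sum>\<tau>\<in>?L - ?A. ?P \<tau> * (?G \<tau>)\<^sup>2)"
    unfolding sum_distrib_left
  proof (intro sum_mono)
    fix \<tau> assume \<tau>: "\<tau> \<in> ?L - ?A"
    then have "(k * \<epsilon>)\<^sup>2 \<le> (?G \<tau>)\<^sup>2"
      using \<open>\<epsilon> > 0\<close> by (intro abs_le_square_iff[THEN iffD1]) auto
    then show "(k * \<epsilon>)\<^sup>2 * ?P \<tau> \<le> ?P \<tau> * (?G \<tau>)\<^sup>2"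
      using \<tau> by (subst mult.commute, intro mult_left_mono P0) auto
  qed
  also have "\<dots> \<le> (\<Sum>\<tau>\<in>?L. ?P \<tau> * (?G \<tau>)\<^sup>2)"
    using fin P0 by (intro sum_mono2) auto
  also have "\<dots> \<le> k * V"
    unfolding lists_moments(3)[OF I p1 g0] using V by (intro mult_left_mono) auto
  finally have "(\<Sum>\<tau>\<in>?L - ?A. ?P \<tau>) \<le> k * V / (k * \<epsilon>)\<^sup>2"
    using assms by (simp add: pos_le_divide_eq mult.commute)
  also have "\<dots> = V / (k * \<epsilon>\<^sup>2)"
    using assms by (simp add: power2_eq_square)
  finally have 1: "(\<Sum>\<tau>\<in>?L - ?A. ?P \<tau>) \<le> V / (k * \<epsilon>\<^sup>2)" .
  have "?A \<subseteq> ?L" by auto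
  from sum.subset_diff[OF this fin, of ?P] have "(\<Sum>\<tau>\<in>?A. ?P \<tau>) = 1 - (\<Sum>\<tau>\<in>?L - ?A. ?P \<tau>)"
    using lists_moments(1)[OF I p1 g0, of k] by simp
  then show ?thesis using 1 by simp
qed

text \<open>The exponential tilt at the minimiser \<open>\<theta>\<close> has mean at least \<open>0\<close>, with equality unless
  \<open>\<theta> = 0\<close>; this is what makes the Chernoff bound sharp.\<close>

lemma Cramer_lower_bound:
  fixes w s :: "'t \<Rightarrow> real"
  assumes I: "finite I" and w0: "\<And>t. t \<in> I \<Longrightarrow> 0 \<le> w t"
    and s: "\<And>t. t \<in> I \<Longrightarrow> \<bar>z - s t\<bar> \<le> B"
    and \<rho>: "\<And>\<theta>. 0 \<le> \<theta> \<Longrightarrow> \<theta> \<le> \<Theta> \<Longrightarrow> \<rho> \<le> (\<Sum>t\<in>I. w t * exp (\<theta> * (z - s t)))"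
    and "\<rho> > 0" "\<Theta> \<ge> 0"
    and \<Theta>: "(\<Sum>t\<in>I. w t) < (\<Sum>t\<in>I. w t * exp (\<Theta> * (z - s t)))"
    and k: "k > 0" "\<epsilon> > 0" "B\<^sup>2 \<le> k * \<epsilon>\<^sup>2"
  shows "\<rho> ^ k * exp (- (\<Theta> * (k * \<epsilon>))) * (1 - B\<^sup>2 / (k * \<epsilon>\<^sup>2))
    \<le> (\<Sum>\<tau> | set \<tau> \<subseteq> I \<and> length \<tau> = k \<and> sum_list (map s \<tau>) \<le> k * (z + \<epsilon>). prod_list (map w \<tau>))"
proof -
  define G where "G \<theta> = (\<Sum>t\<in>I. w t * exp (\<theta> * (z - s t)))" for \<theta>
  define G' where "G' \<theta> = (\<Sum>t\<in>I. w t * (z - s t) * exp (\<theta> * (z - s t)))" for \<theta>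
  have der: "(G has_real_derivative G' \<theta>) (at \<theta>)" for \<theta>
    unfolding G_def[abs_def] G'_def
    by (auto intro!: derivative_eq_intros sum.cong simp: algebra_simps)
  have "continuous_on {0..\<Theta>} G"
    unfolding G_def by (intro continuous_intros)
  then obtain \<theta> where \<theta>: "\<theta> \<in> {0..\<Theta>}" "\<And>x. x \<in> {0..\<Theta>} \<Longrightarrow> G \<theta> \<le> G x"
    using continuous_attains_inf[of "{0..\<Theta>}" G] \<open>\<Theta> \<ge> 0\<close> by auto
  have "G 0 < G \<Theta>" using \<Theta> by (simp add: G_def)
  moreover have "G \<theta> \<le> G 0" using \<theta> \<open>\<Theta> \<ge> 0\<close> by auto
  \<comment> \<open>The right end point is not a minimiser, so there is room to the right of
    \<open>\<theta>\<close> and the one-sided derivative test applies even if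
    \<open>\<theta> = 0\<close>.\<close>
  ultimately have "\<theta> < \<Theta>" using \<theta> by (cases "\<theta> = \<Theta>") auto
  have d0: "0 \<le> G' \<theta>"
  proof (rule ccontr)
    assume "\<not> 0 \<le> G' \<theta>"
    then obtain d where d: "d > 0" "\<And>h. h > 0 \<Longrightarrow> h < d \<Longrightarrow> G (\<theta> + h) < G \<theta>"
      using DERIV_neg_dec_right[OF der[of \<theta>]] by auto
    define h where "h = min (d / 2) (\<Theta> - \<theta>)"
    have "h > 0" "h < d" "\<theta> + h \<in> {0..\<Theta>}"
      using d \<theta> \<open>\<theta> < \<Theta>\<close> by (auto simp: h_def)
    then show False using d(2)[of h] \<theta>(2)[of "\<theta> + h"] by auto
  qed
  \<comment> \<open>Complementary slackness: the minimiser is either 0 or interior with vanishing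
    derivative. The product treats both cases at once.\<close>
  have \<theta>d: "\<theta> * G' \<theta> = 0"
  proof (cases "\<theta> = 0")
    case False
    then have "\<theta> > 0" using \<theta> by auto
    have "G' \<theta> = 0"
    proof (rule DERIV_local_min[OF der])
      show "0 < min \<theta> (\<Theta> - \<theta>)" using \<open>\<theta> > 0\<close> \<open>\<theta> < \<Theta>\<close> by auto
      show "\<forall>y. \<bar>\<theta> - y\<bar> < min \<theta> (\<Theta> - \<theta>) \<longrightarrow> G \<theta> \<le> G y"
      proof (intro allI impI \<theta>(2))
        fix y assume "\<bar>\<theta> - y\<bar> < min \<theta> (\<Theta> - \<theta>)"
        then show "y \<in> {0..\<Theta>}" by (simp add: abs_less_iff)
      qed
    qed
    then show ?thesis by simp
  qed simp
  have G\<rho>: "\<rho> \<le> G \<theta>" using \<rho>[of \<theta>] \<theta> by (auto simp: G_def)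
  then have Gpos: "G \<theta> > 0" using \<open>\<rho> > 0\<close> by simp
  \<comment> \<open>\<open>p\<close> is the tilted law, \<open>d\<close> the mean of
    \<open>z - s\<close> under it and \<open>g\<close> the centred variable.\<close>
  define p where "p t = w t * exp (\<theta> * (z - s t)) / G \<theta>" for t
  define d where "d = G' \<theta> / G \<theta>"
  define g where "g t = (z - s t) - d" for t
  have p0: "0 \<le> p t" if "t \<in> I" for t
    using w0[OF that] Gpos by (simp add: p_def)
  have p1: "(\<Sum>t\<in>I. p t) = 1"
    using Gpos by (simp add: p_def G_def flip: sum_divide_distrib)
  have pm: "(\<Sum>t\<in>I. p t * (z - s t)) = d"
    by (simp add: p_def d_def G'_def mult_ac flip: sum_divide_distrib)
  have g0: "(\<Sum>t\<in>I. p t * g t) = 0"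
    using p1 pm by (simp add: g_def right_diff_distrib sum_subtractf flip: sum_distrib_right)
  have "(\<Sum>t\<in>I. p t * (g t)\<^sup>2) = (\<Sum>t\<in>I. p t * (z - s t)\<^sup>2 - 2 * d * (p t * (z - s t)) + d\<^sup>2 * p t)"
    by (simp add: g_def power2_eq_square algebra_simps)
  also have "\<dots> = (\<Sum>t\<in>I. p t * (z - s t)\<^sup>2) - d\<^sup>2"
    using p1 pm by (simp add: sum.distrib sum_subtractf power2_eq_square flip: sum_distrib_left)
  also have "\<dots> \<le> (\<Sum>t\<in>I. p t * (z - s t)\<^sup>2)"
    by simp
  also have "\<dots> \<le> (\<Sum>t\<in>I. p t * B\<^sup>2)"
  proof (intro sum_mono mult_left_mono p0)
    fix t assume "t \<in> I"
    then show "(z - s t)\<^sup>2 \<le> B\<^sup>2" using power_mono[OF s, of t 2] by simp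
  qed
  also have "\<dots> = B\<^sup>2" using p1 by (simp flip: sum_distrib_right)
  finally have V: "(\<Sum>t\<in>I. p t * (g t)\<^sup>2) \<le> B\<^sup>2" .
  let ?T = "{\<tau>. (set \<tau> \<subseteq> I \<and> length \<tau> = k) \<and> \<bar>sum_list (map g \<tau>)\<bar> \<le> k * \<epsilon>}"
  let ?T' = "{\<tau>. set \<tau> \<subseteq> I \<and> length \<tau> = k \<and> sum_list (map s \<tau>) \<le> k * (z + \<epsilon>)}"
  \<comment> \<open>The change of measure undone along a whole word: the weights \<open>w\<close>
    are recovered from the tilted law at the price of an exponential factor.\<close>
  have prod_p: "prod_list (map p \<tau>) * G \<theta> ^ length \<tau> * exp (- (\<theta> * (length \<tau> * z - sum_list (map s \<tau>))))
      = prod_list (map w \<tau>)" for \<tau>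
  proof (induction \<tau>)
    case (Cons t \<tau>)
    have "exp (- (\<theta> * (length (t # \<tau>) * z - sum_list (map s (t # \<tau>)))))
      = exp (- (\<theta> * (z - s t))) * exp (- (\<theta> * (length \<tau> * z - sum_list (map s \<tau>))))"
      by (simp add: algebra_simps flip: exp_add)
    then have "prod_list (map p (t # \<tau>)) * G \<theta> ^ length (t # \<tau>)
        * exp (- (\<theta> * (length (t # \<tau>) * z - sum_list (map s (t # \<tau>)))))
      = (p t * G \<theta> * exp (- (\<theta> * (z - s t)))) * prod_list (map w \<tau>)"
      unfolding Cons[symmetric] by (simp only: list.map prod_list.Cons list.size power_Suc power_add mult_ac) simp
    moreover have "p t * G \<theta> * exp (- (\<theta> * (z - s t))) = w t"
      using Gpos by (simp add: p_def exp_minus)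
    ultimately show ?case by simp
  qed simp
  have sum_g: "sum_list (map g \<tau>) = length \<tau> * (z - d) - sum_list (map s \<tau>)" for \<tau>
    by (induction \<tau>) (auto simp: g_def algebra_simps)
  have dd: "0 \<le> d" "\<theta> * d = 0"
    using d0 Gpos \<theta>d by (auto simp: d_def)
  have fin: "finite {\<tau>. set \<tau> \<subseteq> I \<and> length \<tau> = k}"
    using finite_lists_length_eq[OF I] .
  have T: "\<tau> \<in> ?T'" "prod_list (map p \<tau>) * (\<rho> ^ k * exp (- (\<Theta> * (k * \<epsilon>)))) \<le> prod_list (map w \<tau>)"
    if \<tau>: "\<tau> \<in> ?T" for \<tau>
  proof -
    have l: "length \<tau> = k" "set \<tau> \<subseteq> I" using \<tau> by auto
    have "0 \<le> k * d" using dd by simp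
    moreover have "length \<tau> * (z - d) = k * z - k * d" using l by (simp add: algebra_simps)
    ultimately show "\<tau> \<in> ?T'"
      using \<tau> l unfolding sum_g by (auto simp: algebra_simps)
    \<comment> \<open>Since \<open>\<theta> * d = 0\<close>, the exponent of the change of measure
      only sees the centred sum, which is at most \<open>k * \<epsilon>\<close> on the Chebyshev
      event; hence a loss bounded in terms of \<open>\<Theta>\<close> alone.\<close>
    have "\<theta> * (length \<tau> * z - sum_list (map s \<tau>)) = \<theta> * sum_list (map g \<tau>) + length \<tau> * (\<theta> * d)"
      unfolding sum_g by (simp add: algebra_simps)
    also have "\<dots> = \<theta> * sum_list (map g \<tau>)" using dd by simp
    also have "\<dots> \<le> \<Theta> * (k * \<epsilon>)"
    proof -
      have "\<theta> * sum_list (map g \<tau>) \<le> \<theta> * (k * \<epsilon>)"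
        using \<tau> \<theta> by (intro mult_left_mono) auto
      also have "\<dots> \<le> \<Theta> * (k * \<epsilon>)"
        using \<theta> k by (intro mult_right_mono) auto
      finally show ?thesis .
    qed
    finally have 1: "exp (- (\<Theta> * (k * \<epsilon>))) \<le> exp (- (\<theta> * (length \<tau> * z - sum_list (map s \<tau>))))"
      by simp
    have "prod_list (map p \<tau>) * (\<rho> ^ k * exp (- (\<Theta> * (k * \<epsilon>))))
      \<le> prod_list (map p \<tau>) * (G \<theta> ^ k * exp (- (\<theta> * (length \<tau> * z - sum_list (map s \<tau>)))))"
    proof (intro mult_left_mono)
      show "\<rho> ^ k * exp (- (\<Theta> * (k * \<epsilon>))) \<le> G \<theta> ^ k * exp (- (\<theta> * (length \<tau> * z - sum_list (map s \<tau>))))"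
        using 1 G\<rho> \<open>\<rho> > 0\<close> Gpos by (intro mult_mono power_mono) auto
      show "0 \<le> prod_list (map p \<tau>)"
        using l p0 by (intro prod_list_nonneg) auto
    qed
    also have "\<dots> = prod_list (map w \<tau>)"
      using prod_p[of \<tau>] l by (simp add: mult_ac)
    finally show "prod_list (map p \<tau>) * (\<rho> ^ k * exp (- (\<Theta> * (k * \<epsilon>)))) \<le> prod_list (map w \<tau>)" .
  qed
  have "(1 - B\<^sup>2 / (k * \<epsilon>\<^sup>2)) * (\<rho> ^ k * exp (- (\<Theta> * (k * \<epsilon>))))
      \<le> (\<Sum>\<tau>\<in>?T. prod_list (map p \<tau>)) * (\<rho> ^ k * exp (- (\<Theta> * (k * \<epsilon>))))"
    using lists_Chebyshev[OF I p0 p1 g0 V k(1,2)] \<open>\<rho> > 0\<close> by (intro mult_right_mono) auto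
  also have "\<dots> = (\<Sum>\<tau>\<in>?T. prod_list (map p \<tau>) * (\<rho> ^ k * exp (- (\<Theta> * (k * \<epsilon>)))))"
    by (rule sum_distrib_right)
  also have "\<dots> \<le> (\<Sum>\<tau>\<in>?T. prod_list (map w \<tau>))"
    using T by (intro sum_mono) auto
  also have "\<dots> \<le> (\<Sum>\<tau>\<in>?T'. prod_list (map w \<tau>))"
  proof (intro sum_mono2)
    show "finite ?T'" by (rule finite_subset[OF _ fin]) auto
    show "?T \<subseteq> ?T'" using T by blast
    show "0 \<le> prod_list (map w \<tau>)" if "\<tau> \<in> ?T' - ?T" for \<tau>
      using that w0 by (intro prod_list_nonneg) auto
  qed
  finally show ?thesis by (simp add: mult_ac)
qed

abbreviation unit_seq :: "(nat \<Rightarrow> real) \<Rightarrow> bool" where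
  "unit_seq x \<equiv> (\<forall>i. x i \<in> {0..<1})"

section \<open>Discretised coordinates and independence\<close>

text \<open>\<open>dep e J F\<close>: on sequences in \<open>[0, 1)\<close>, \<open>F\<close> is a function of the discretised coordinates
  \<open>e i (x i)\<close> with \<open>i \<in> J\<close>. With a countable discretisation and finite \<open>J\<close>, measurability and
  independence come for free.\<close>

definition dep :: "(nat \<Rightarrow> real \<Rightarrow> 'c) \<Rightarrow> nat set \<Rightarrow> ((nat \<Rightarrow> real) \<Rightarrow> 'd) \<Rightarrow> bool" where
  "dep e J F \<longleftrightarrow> (\<forall>x x'. unit_seq x \<longrightarrow> unit_seq x' \<longrightarrow> (\<forall>i\<in>J. e i (x i) = e i (x' i)) \<longrightarrow> F x = F x')"

lemma depI:
  "(\<And>x x'. unit_seq x \<Longrightarrow> unit_seq x' \<Longrightarrow> (\<And>i. i \<in> J \<Longrightarrow> e i (x i) = e i (x' i)) \<Longrightarrow> F x = F x') \<Longrightarrow> dep e J F"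
  unfolding dep_def by blast

lemma depD:
  "dep e J F \<Longrightarrow> unit_seq x \<Longrightarrow> unit_seq x' \<Longrightarrow> (\<And>i. i \<in> J \<Longrightarrow> e i (x i) = e i (x' i)) \<Longrightarrow> F x = F x'"
  unfolding dep_def by blast

lemma dep_mono: "dep e J F \<Longrightarrow> J \<subseteq> J' \<Longrightarrow> dep e J' F"
  unfolding dep_def by blast

lemma dep_comp: "dep e J F \<Longrightarrow> dep e J (\<lambda>x. g (F x))"
  unfolding dep_def by metis

lemma dep_comp2: "dep e J F \<Longrightarrow> dep e J F' \<Longrightarrow> dep e J (\<lambda>x. g (F x) (F' x))"
  unfolding dep_def by metis

locale iid_attachment = prob_space M for M :: "'a measure" +
  fixes Xs :: "nat \<Rightarrow> 'a \<Rightarrow> real" and D :: "real measure"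
  assumes indep: "indep_vars (\<lambda>_. borel) Xs UNIV"
    and distr_Xs: "\<And>i. distr M borel (Xs i) = D"
    and Xs_range: "\<And>i \<omega>. \<omega> \<in> space M \<Longrightarrow> Xs i \<omega> \<in> {0..<1}"
begin

text \<open>Events are predicates on deterministic sequences, so that the combinatorics of the tree
  can be argued pointwise. On a non-measurable set \<open>prob\<close> is 0 by convention;
  \<open>dep\<close> is what supplies measurability.\<close>

definition Pr :: "((nat \<Rightarrow> real) \<Rightarrow> bool) \<Rightarrow> real" where
  "Pr E = prob {\<omega> \<in> space M. E (\<lambda>i. Xs i \<omega>)}"

lemma Xs_measurable [measurable]: "Xs i \<in> borel_measurable M"
  using indep by (auto simp: indep_vars_def)

lemma Pr_nonneg [simp]: "0 \<le> Pr E"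
  by (simp add: Pr_def)

lemma Pr_le_1 [simp]: "Pr E \<le> 1"
  by (simp add: Pr_def)

context
  fixes e :: "nat \<Rightarrow> real \<Rightarrow> 'c::countable"
  assumes e [measurable]: "\<And>i. e i \<in> borel \<rightarrow>\<^sub>M count_space UNIV"
begin

text \<open>A finite product of countable discrete spaces is discrete, so the set of all code
  vectors of realisations of \<open>E\<close> is measurable as it stands, and \<open>dep\<close>
  says that membership in it decides \<open>E\<close>.\<close>

lemma coding:
  assumes "dep e J E" "finite J"
  obtains A where "A \<in> sets (PiM J (\<lambda>_. count_space (UNIV :: 'c set)))"
    "\<And>x. unit_seq x \<Longrightarrow> E x \<longleftrightarrow> restrict (\<lambda>i. e i (x i)) J \<in> A"
proof
  let ?A = "{restrict (\<lambda>i. e i (x i)) J |x. unit_seq x \<and> E x}"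
  show "?A \<in> sets (PiM J (\<lambda>_. count_space UNIV))"
    using assms by (subst count_space_PiM_finite) auto
  show "E x \<longleftrightarrow> restrict (\<lambda>i. e i (x i)) J \<in> ?A" if x: "unit_seq x" for x
  proof
    assume "restrict (\<lambda>i. e i (x i)) J \<in> ?A"
    then obtain x' where x': "unit_seq x'" "E x'" "restrict (\<lambda>i. e i (x i)) J = restrict (\<lambda>i. e i (x' i)) J"
      by auto
    have "e i (x i) = e i (x' i)" if "i \<in> J" for i
      using fun_cong[OF x'(3), of i] that by simp
    then show "E x" using depD[OF assms(1) x x'(1)] x'(2) by blast
  next
    assume "E x"
    then show "restrict (\<lambda>i. e i (x i)) J \<in> ?A" using x by blast
  qed
qed

lemma dep_measurable:
  assumes "dep e J E" "finite J"
  shows "{\<omega> \<in> space M. E (\<lambda>i. Xs i \<omega>)} \<in> events"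
proof -
  obtain A where A [measurable]: "A \<in> sets (PiM J (\<lambda>_. count_space (UNIV :: 'c set)))"
    and EA: "\<And>x. unit_seq x \<Longrightarrow> E x \<longleftrightarrow> restrict (\<lambda>i. e i (x i)) J \<in> A"
    using coding[OF assms] by blast
  have "{\<omega> \<in> space M. E (\<lambda>i. Xs i \<omega>)} = {\<omega> \<in> space M. restrict (\<lambda>i. e i (Xs i \<omega>)) J \<in> A}"
    using EA Xs_range by auto
  also have "\<dots> \<in> events" by measurable
  finally show ?thesis .
qed

lemma Pr_indep:
  assumes E1: "dep e Ja E1" and E2: "dep e Jb E2" and J: "finite Ja" "finite Jb" "Ja \<inter> Jb = {}"
  shows "Pr (\<lambda>x. E1 x \<and> E2 x) = Pr E1 * Pr E2"
proof -
  obtain A where A: "A \<in> sets (PiM Ja (\<lambda>_. count_space (UNIV :: 'c set)))"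
    "\<And>x. unit_seq x \<Longrightarrow> E1 x \<longleftrightarrow> restrict (\<lambda>i. e i (x i)) Ja \<in> A"
    using coding[OF E1 J(1)] by blast
  obtain B where B: "B \<in> sets (PiM Jb (\<lambda>_. count_space (UNIV :: 'c set)))"
    "\<And>x. unit_seq x \<Longrightarrow> E2 x \<longleftrightarrow> restrict (\<lambda>i. e i (x i)) Jb \<in> B"
    using coding[OF E2 J(2)] by blast
  have "indep_vars (\<lambda>_. count_space UNIV) (\<lambda>i \<omega>. e i (Xs i \<omega>)) UNIV"
    by (rule indep_vars_compose2[OF indep]) auto
  note * = indep_varD[OF indep_var_restrict[OF this J(3) subset_UNIV subset_UNIV] A(1) B(1)]
  have ok: "unit_seq (\<lambda>i. Xs i \<omega>)" if "\<omega> \<in> space M" for \<omega>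
    using Xs_range[OF that] by simp
  have "{\<omega> \<in> space M. E1 (\<lambda>i. Xs i \<omega>)} = (\<lambda>\<omega>. \<lambda>i\<in>Ja. e i (Xs i \<omega>)) -` A \<inter> space M"
    using A(2)[OF ok] by blast
  moreover have "{\<omega> \<in> space M. E2 (\<lambda>i. Xs i \<omega>)} = (\<lambda>\<omega>. \<lambda>i\<in>Jb. e i (Xs i \<omega>)) -` B \<inter> space M"
    using B(2)[OF ok] by blast
  moreover have "{\<omega> \<in> space M. E1 (\<lambda>i. Xs i \<omega>) \<and> E2 (\<lambda>i. Xs i \<omega>)}
    = (\<lambda>\<omega>. (\<lambda>i\<in>Ja. e i (Xs i \<omega>), \<lambda>i\<in>Jb. e i (Xs i \<omega>))) -` (A \<times> B) \<inter> space M"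
    using A(2)[OF ok] B(2)[OF ok] by blast
  ultimately show ?thesis
    unfolding Pr_def using * by presburger
qed

lemma Pr_mono:
  assumes "dep e J F" "finite J" "\<And>x. unit_seq x \<Longrightarrow> E x \<Longrightarrow> F x"
  shows "Pr E \<le> Pr F"
  unfolding Pr_def
proof (rule finite_measure_mono)
  show "{\<omega> \<in> space M. E (\<lambda>i. Xs i \<omega>)} \<subseteq> {\<omega> \<in> space M. F (\<lambda>i. Xs i \<omega>)}"
    using assms(3)[of "\<lambda>i. Xs i _"] Xs_range by blast
qed (rule dep_measurable[OF assms(1,2)])

lemma Pr_Un:
  assumes "dep e J F" "dep e J F'" "finite J" "\<And>x. unit_seq x \<Longrightarrow> E x \<Longrightarrow> F x \<or> F' x"
  shows "Pr E \<le> Pr F + Pr F'"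
proof -
  have "Pr E \<le> Pr (\<lambda>x. F x \<or> F' x)"
    by (rule Pr_mono[OF dep_comp2[OF assms(1,2)] assms(3)]) (rule assms(4))
  also have "\<dots> = prob ({\<omega> \<in> space M. F (\<lambda>i. Xs i \<omega>)} \<union> {\<omega> \<in> space M. F' (\<lambda>i. Xs i \<omega>)})"
    unfolding Pr_def by (intro arg_cong[where f=prob]) auto
  also have "\<dots> \<le> Pr F + Pr F'"
    unfolding Pr_def by (intro measure_Un_le dep_measurable[OF assms(1,3)] dep_measurable[OF assms(2,3)])
  finally show ?thesis .
qed

lemma Pr_UN:
  assumes "\<And>s. s \<in> S \<Longrightarrow> dep e J (F s)" "finite J" "finite S"
    "\<And>x. unit_seq x \<Longrightarrow> E x \<Longrightarrow> \<exists>s\<in>S. F s x"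
  shows "Pr E \<le> (\<Sum>s\<in>S. Pr (F s))"
proof -
  have "Pr E \<le> prob (\<Union>s\<in>S. {\<omega> \<in> space M. F s (\<lambda>i. Xs i \<omega>)})"
    unfolding Pr_def
  proof (intro finite_measure_mono subsetI)
    show "(\<Union>s\<in>S. {\<omega> \<in> space M. F s (\<lambda>i. Xs i \<omega>)}) \<in> events"
      by (intro sets.finite_UN dep_measurable[OF assms(1,2)] assms(3))
    fix \<omega> assume \<omega>: "\<omega> \<in> {\<omega> \<in> space M. E (\<lambda>i. Xs i \<omega>)}"
    then show "\<omega> \<in> (\<Union>s\<in>S. {\<omega> \<in> space M. F s (\<lambda>i. Xs i \<omega>)})"
      using assms(4)[of "\<lambda>i. Xs i \<omega>"] Xs_range by blast
  qed
  also have "\<dots> \<le> (\<Sum>s\<in>S. Pr (F s))"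
    unfolding Pr_def by (intro measure_UNION_le dep_measurable[OF assms(1,2)] assms(3))
  finally show ?thesis .
qed

lemma Pr_sum_eq_le_1:
  assumes "dep e J G" "finite J" "finite S"
  shows "(\<Sum>c\<in>S. Pr (\<lambda>x. G x = c)) \<le> 1"
proof -
  have "(\<Sum>c\<in>S. Pr (\<lambda>x. G x = c)) = prob (\<Union>c\<in>S. {\<omega> \<in> space M. G (\<lambda>i. Xs i \<omega>) = c})"
    unfolding Pr_def
  proof (rule finite_measure_finite_Union[symmetric])
    show "(\<lambda>c. {\<omega> \<in> space M. G (\<lambda>i. Xs i \<omega>) = c}) ` S \<subseteq> events"
      using dep_measurable[OF dep_comp[OF assms(1), where g = "\<lambda>d. d = _"] assms(2)]
      by (intro image_subsetI)
  qed (auto simp: disjoint_family_on_def assms(3))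
  also have "\<dots> \<le> 1" by (rule prob_le_1)
  finally show ?thesis .
qed

text \<open>Conditioning without conditional expectations: split by the value \<open>c\<close> of
  \<open>G\<close>, freeze it inside \<open>Q\<close>, and use that \<open>Q c\<close> reads
  coordinates independent of those that determine \<open>G\<close>. A bound uniform in
  \<open>c\<close> survives the summation.\<close>

lemma Pr_cond:
  assumes G: "dep e Ja G" and Q: "\<And>c. c \<in> S \<Longrightarrow> dep e Jb (Q c)"
    and J: "finite Ja" "finite Jb" "Ja \<inter> Jb = {}" and S: "finite S"
    and E: "\<And>x. unit_seq x \<Longrightarrow> E x \<Longrightarrow> G x \<in> S \<and> Q (G x) x"
    and p: "\<And>c. c \<in> S \<Longrightarrow> Pr (Q c) \<le> p" "0 \<le> p"
  shows "Pr E \<le> p"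
proof -
  have dG: "dep e Ja (\<lambda>x. G x = c)" for c
    by (rule dep_comp[OF G, where g = "\<lambda>d. d = c"])
  have "Pr E \<le> (\<Sum>c\<in>S. Pr (\<lambda>x. G x = c \<and> Q c x))"
  proof (rule Pr_UN[where J="Ja \<union> Jb" and F="\<lambda>c x. G x = c \<and> Q c x" and S=S])
    show "dep e (Ja \<union> Jb) (\<lambda>x. G x = c \<and> Q c x)" if "c \<in> S" for c
      by (rule dep_comp2[OF dep_mono[OF dG] dep_mono[OF Q[OF that]]]) auto
    show "finite (Ja \<union> Jb)" "finite S" using J S by auto
    show "\<exists>s\<in>S. G x = s \<and> Q s x" if "unit_seq x" "E x" for x
      using E[OF that] by blast
  qed
  also have "\<dots> = (\<Sum>c\<in>S. Pr (\<lambda>x. G x = c) * Pr (Q c))"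
    by (rule sum.cong[OF refl], rule Pr_indep[OF dG Q J])
  also have "\<dots> \<le> (\<Sum>c\<in>S. Pr (\<lambda>x. G x = c) * p)"
    by (rule sum_mono, rule mult_left_mono[OF p(1)]) auto
  also have "\<dots> = (\<Sum>c\<in>S. Pr (\<lambda>x. G x = c)) * p"
    by (simp add: sum_distrib_right)
  also have "\<dots> \<le> 1 * p"
    using Pr_sum_eq_le_1[OF G J(1) S] p by (intro mult_right_mono) auto
  finally show ?thesis by simp
qed

end

end

section \<open>Ancestral lines\<close>

lemma parent_less:
  assumes "unit_seq x" "i > 0"
  shows "parent x i < i"
proof -
  have "real i * x i < real i * 1"
    using assms by (intro mult_strict_left_mono) auto
  then have "\<lfloor>real i * x i\<rfloor> < int i"
    by (simp add: floor_less_iff)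
  then show ?thesis
    using assms by (simp add: parent_def nat_less_iff)
qed

lemma parent_0 [simp]: "parent x 0 = 0"
  by (simp add: parent_def)

lemma ancestor_0 [simp]: "ancestor x 0 j = 0"
  by (induction j) auto

lemma ancestor_Suc_parent: "ancestor x i (Suc j) = ancestor x (parent x i) j"
  by (induction j) auto

lemma ancestor_add: "ancestor x i (j + k) = ancestor x (ancestor x i j) k"
  by (induction k) auto

lemma ancestor_le:
  assumes "unit_seq x"
  shows "ancestor x i j \<le> i - j"
proof (induction j)
  case (Suc j)
  show ?case
  proof (cases "ancestor x i j = 0")
    case False
    then show ?thesis using parent_less[OF assms, of "ancestor x i j"] Suc by auto
  qed auto
qed auto

text \<open>The root is its own parent, so an ancestral line stays at 0 once it is there. This
  trades the \<open>LEAST\<close> for a condition on one fixed iterate.\<close>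

lemma depth_le_iff:
  assumes "unit_seq x"
  shows "depth x i \<le> k \<longleftrightarrow> ancestor x i k = 0"
proof
  have "ancestor x i i = 0" using ancestor_le[OF assms, of i i] by simp
  then have *: "ancestor x i (depth x i) = 0"
    unfolding depth_def by (rule LeastI)
  assume "depth x i \<le> k"
  then show "ancestor x i k = 0"
    using ancestor_add[of x i "depth x i" "k - depth x i"] * by simp
next
  assume "ancestor x i k = 0"
  then show "depth x i \<le> k"
    unfolding depth_def by (rule Least_le)
qed

lemma height_le_iff:
  assumes "unit_seq x" "n \<ge> 1"
  shows "height x n \<le> k \<longleftrightarrow> (\<forall>i\<in>{1..n}. ancestor x i k = 0)"
  unfolding height_def using assms by (subst Max_le_iff) (auto simp: depth_le_iff)

lemma height_le:
  assumes "unit_seq x" "n \<ge> 1"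
  shows "height x n \<le> n"
  unfolding height_le_iff[OF assms]
proof
  fix i assume "i \<in> {1..n}"
  then show "ancestor x i n = 0" using ancestor_le[OF assms(1), of i n] by simp
qed

lemma height_mono:
  assumes "unit_seq x" "1 \<le> m" "m \<le> n"
  shows "height x m \<le> height x n"
  unfolding height_le_iff[OF assms(1,2)] using height_le_iff[OF assms(1), of n "height x n"] assms by auto

text \<open>The tree reads coordinate \<open>i\<close> only through this natural number, which makes
  it a countable discretisation for \<open>dep\<close>.\<close>

definition parent_code :: "nat \<Rightarrow> real \<Rightarrow> nat" where
  "parent_code i r = nat \<lfloor>real i * r\<rfloor>"

lemma parent_code_measurable: "parent_code i \<in> borel \<rightarrow>\<^sub>M count_space UNIV"
  unfolding parent_code_def[abs_def] by measurable

lemma parent_eq_parent_code: "parent x i = parent_code i (x i)"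
  by (simp add: parent_def parent_code_def)

lemma dep_ancestor: "dep parent_code {..n} (\<lambda>x. \<lambda>i\<in>{..n}. ancestor x i k)"
proof (rule depI)
  fix x x' :: "nat \<Rightarrow> real"
  assume x: "unit_seq x" and x': "unit_seq x'" and eq: "\<And>i. i \<in> {..n} \<Longrightarrow> parent_code i (x i) = parent_code i (x' i)"
  have "ancestor x i k = ancestor x' i k" if "i \<le> n" for i
    using that
  proof (induction k)
    case (Suc k)
    have "ancestor x i k \<le> n" using ancestor_le[OF x, of i k] Suc by simp
    then show ?case using Suc eq by (simp add: parent_eq_parent_code)
  qed auto
  then show "(\<lambda>i\<in>{..n}. ancestor x i k) = (\<lambda>i\<in>{..n}. ancestor x' i k)" by auto
qed

lemma dep_height: "dep parent_code {..n} (\<lambda>x. height x n)"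
proof (cases "n \<ge> 1")
  case True
  show ?thesis
  proof (rule depI)
    fix x x' :: "nat \<Rightarrow> real"
    assume x: "unit_seq x" and x': "unit_seq x'" and eq: "\<And>i. i \<in> {..n} \<Longrightarrow> parent_code i (x i) = parent_code i (x' i)"
    have "ancestor x i k = ancestor x' i k" if "i \<le> n" for i k
      using fun_cong[OF depD[OF dep_ancestor[of n k] x x' eq], of i] that by simp
    then have "height x n \<le> k \<longleftrightarrow> height x' n \<le> k" for k
      unfolding height_le_iff[OF x True] height_le_iff[OF x' True] by simp
    then show "height x n = height x' n" by (meson order_antisym order_refl)
  qed
qed (auto simp: dep_def height_def)

section \<open>First-moment bound for the height\<close>

context iid_attachment
begin

lemma D_sets [measurable_cong]: "sets D = sets borel"
  using distr_Xs[of 0] by auto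

lemma D_prob: "prob_space D"
  using distr_Xs[of 0] by (metis Xs_measurable prob_space_distr)

lemma D_range: "AE r in D. r \<in> {0..<1}"
proof -
  have "AE r in distr M borel (Xs 0). r \<in> {0..<1}"
    using Xs_range by (subst AE_distr_iff) (auto intro!: AE_I2)
  then show ?thesis by (simp only: distr_Xs)
qed

lemma Pr_coord:
  assumes "{r. E r} \<in> sets borel"
  shows "Pr (\<lambda>x. E (x i)) = measure D {r. E r}"
proof -
  have "measure (distr M borel (Xs i)) {r. E r} = Pr (\<lambda>x. E (x i))"
    unfolding Pr_def using assms
    by (subst measure_distr) (auto intro!: arg_cong[where f=prob])
  then show ?thesis unfolding distr_Xs by simp
qed

lemma powr_integrable: "l \<ge> 0 \<Longrightarrow> integrable D (\<lambda>r. r powr l)"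
proof -
  assume "l \<ge> 0"
  interpret D: prob_space D by (rule D_prob)
  show ?thesis
  proof (rule D.integrable_const_bound[where B=1])
    show "AE r in D. norm (r powr l) \<le> 1"
      using D_range by eventually_elim (use \<open>l \<ge> 0\<close> in \<open>auto intro: powr_le1\<close>)
  qed measurable
qed

text \<open>\<open>parent_code i r \<le> i * r\<close>, and \<open>powr l\<close> is increasing:
  rounding down only helps, so one step multiplies the \<open>l\<close>-th power of the label in the
  mean by at most the \<open>l\<close>-th moment of the attachment.\<close>

lemma sum_parent_powr:
  assumes "l > 0"
  shows "(\<Sum>j\<in>{1..<i}. Pr (\<lambda>x. parent x i = j) * real j powr l) \<le> real i powr l * (LINT r|D. r powr l)"
proof -
  interpret D: prob_space D by (rule D_prob)
  have [measurable]: "parent_code i \<in> borel \<rightarrow>\<^sub>M count_space UNIV" by (rule parent_code_measurable)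
  have meas: "{r. parent_code i r = j} \<in> sets borel" for j
    using measurable_sets[OF parent_code_measurable, of "{j}" i] by (auto simp: vimage_def)
  have "(\<Sum>j\<in>{1..<i}. Pr (\<lambda>x. parent x i = j) * real j powr l)
      = (\<Sum>j\<in>{1..<i}. LINT r|D. indicator {r. parent_code i r = j} r * real j powr l)"
  proof (intro sum.cong refl)
    fix j
    have "Pr (\<lambda>x. parent x i = j) = measure D {r. parent_code i r = j}"
      unfolding parent_eq_parent_code by (rule Pr_coord[OF meas])
    then show "Pr (\<lambda>x. parent x i = j) * real j powr l = (LINT r|D. indicator {r. parent_code i r = j} r * real j powr l)"
      using meas[of j] D_sets sets_eq_imp_space_eq[OF D_sets] by simp
  qed
  also have "\<dots> = (LINT r|D. (\<Sum>j\<in>{1..<i}. indicator {r. parent_code i r = j} r * real j powr l))"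
    using meas D_sets by (intro Bochner_Integration.integral_sum[symmetric] integrable_mult_left)
       (auto intro!: integrable_real_indicator simp: D.emeasure_eq_measure)
  also have "\<dots> \<le> (LINT r|D. (real i * r) powr l)"
  proof (rule integral_mono_AE)
    show "integrable D (\<lambda>r. \<Sum>j\<in>{1..<i}. indicator {r. parent_code i r = j} r * real j powr l)"
      using meas D_sets by (intro Bochner_Integration.integrable_sum integrable_mult_left)
       (auto intro!: integrable_real_indicator simp: D.emeasure_eq_measure)
    have "integrable D (\<lambda>r. real i powr l * r powr l)"
      using powr_integrable[of l] assms by auto
    then show "integrable D (\<lambda>r. (real i * r) powr l)"
    proof (rule integrable_cong_AE_imp)
      show "AE r in D. real i powr l * r powr l = (real i * r) powr l"
        using D_range by eventually_elim (auto simp: powr_mult)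
    qed measurable
    show "AE r in D. (\<Sum>j\<in>{1..<i}. indicator {r. parent_code i r = j} r * real j powr l) \<le> (real i * r) powr l"
      using D_range
    proof eventually_elim
      case (elim r)
      have "(\<Sum>j\<in>{1..<i}. indicator {r. parent_code i r = j} r * real j powr l)
        = (\<Sum>j\<in>{1..<i}. if parent_code i r = j then real j powr l else 0)"
        by (intro sum.cong) (auto simp: indicator_def)
      also have "\<dots> \<le> real (parent_code i r) powr l"
        by simp
      also have "\<dots> \<le> (real i * r) powr l"
        using elim assms by (intro powr_mono2) (auto simp: parent_code_def)
      finally show ?case .
    qed
  qed
  also have "\<dots> = (LINT r|D. real i powr l * r powr l)"
    using D_range by (intro integral_cong_AE) (auto simp: powr_mult elim!: eventually_mono)
  finally show ?thesis by simp
qed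

lemma Pr_ancestor:
  assumes "l > 0"
  shows "Pr (\<lambda>x. ancestor x i k \<noteq> 0) \<le> real i powr l * (LINT r|D. r powr l) ^ k"
proof (induction k arbitrary: i)
  case 0
  then show ?case
  proof (cases "i = 0")
    case True
    then show ?thesis by (simp add: Pr_def)
  next
    case False
    then show ?thesis using assms by (simp add: ge_one_powr_ge_zero order_trans[OF Pr_le_1])
  qed
next
  case (Suc k)
  let ?m = "LINT r|D. r powr l"
  have m: "0 \<le> ?m" by (intro Bochner_Integration.integral_nonneg) auto
  have d1: "dep parent_code {i} (\<lambda>x. parent x i = j)" for j
    by (rule depI) (auto simp: parent_eq_parent_code)
  have d2: "dep parent_code {..j} (\<lambda>x. ancestor x j k \<noteq> 0)" for j
    using dep_comp[OF dep_ancestor[of j k], where g = "\<lambda>f. f j \<noteq> 0"] by simp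
  show ?case
  proof (cases "i = 0")
    case False
    have "Pr (\<lambda>x. ancestor x i (Suc k) \<noteq> 0) \<le> (\<Sum>j\<in>{1..<i}. Pr (\<lambda>x. parent x i = j \<and> ancestor x j k \<noteq> 0))"
    proof (rule Pr_UN[OF parent_code_measurable, where F="\<lambda>j x. parent x i = j \<and> ancestor x j k \<noteq> 0" and J="{..i}"])
      show "dep parent_code {..i} (\<lambda>x. parent x i = j \<and> ancestor x j k \<noteq> 0)" if "j \<in> {1..<i}" for j
        by (rule dep_comp2[OF dep_mono[OF d1] dep_mono[OF d2]]) (use that in auto)
      show "\<exists>j\<in>{1..<i}. parent x i = j \<and> ancestor x j k \<noteq> 0" if "unit_seq x" "ancestor x i (Suc k) \<noteq> 0" for x
      proof (rule bexI[of _ "parent x i"])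
        show "parent x i \<in> {1..<i}"
          using that False parent_less[OF that(1), of i] unfolding ancestor_Suc_parent
          by (cases "parent x i = 0") auto
      qed (use that in \<open>auto simp: ancestor_Suc_parent simp del: ancestor.simps\<close>)
    qed auto
    \<comment> \<open>The choice of parent reads coordinate \<open>i\<close> alone, and the line
      from \<open>j < i\<close> reads coordinates up to \<open>j\<close> only.\<close>
    also have "\<dots> = (\<Sum>j\<in>{1..<i}. Pr (\<lambda>x. parent x i = j) * Pr (\<lambda>x. ancestor x j k \<noteq> 0))"
      by (rule sum.cong[OF refl], rule Pr_indep[OF parent_code_measurable d1 d2]) auto
    also have "\<dots> \<le> (\<Sum>j\<in>{1..<i}. Pr (\<lambda>x. parent x i = j) * (real j powr l * ?m ^ k))"
      by (intro sum_mono mult_left_mono Suc) auto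
    also have "\<dots> = (\<Sum>j\<in>{1..<i}. Pr (\<lambda>x. parent x i = j) * real j powr l) * ?m ^ k"
      by (simp only: sum_distrib_right mult.assoc)
    also have "\<dots> \<le> (real i powr l * ?m) * ?m ^ k"
      using m by (intro mult_right_mono sum_parent_powr assms) auto
    finally show ?thesis by (simp add: mult_ac)
  qed (simp add: Pr_def)
qed

lemma Pr_height:
  assumes "l > 0" "n \<ge> 1"
  shows "Pr (\<lambda>x. height x n > k) \<le> real n powr (1 + l) * (LINT r|D. r powr l) ^ k"
proof -
  let ?m = "LINT r|D. r powr l"
  have m: "0 \<le> ?m" by (intro Bochner_Integration.integral_nonneg) auto
  have "Pr (\<lambda>x. height x n > k) \<le> (\<Sum>i\<in>{1..n}. Pr (\<lambda>x. ancestor x i k \<noteq> 0))"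
  proof (rule Pr_UN[OF parent_code_measurable, where F="\<lambda>i x. ancestor x i k \<noteq> 0" and J="{..n}"])
    show "dep parent_code {..n} (\<lambda>x. ancestor x i k \<noteq> 0)" if "i \<in> {1..n}" for i
      using dep_comp[OF dep_ancestor[of n k], where g = "\<lambda>f. f i \<noteq> 0"] that by simp
    show "\<exists>i\<in>{1..n}. ancestor x i k \<noteq> 0" if "unit_seq x" "k < height x n" for x
      using that height_le_iff[OF that(1) assms(2), of k] by auto
  qed auto
  also have "\<dots> \<le> (\<Sum>i\<in>{1..n}. real n powr l * ?m ^ k)"
  proof (intro sum_mono)
    fix i assume "i \<in> {1..n}"
    then show "Pr (\<lambda>x. ancestor x i k \<noteq> 0) \<le> real n powr l * ?m ^ k"
      using m assms by (intro order_trans[OF Pr_ancestor[OF assms(1)]] mult_right_mono powr_mono2) auto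
  qed
  also have "\<dots> = real n powr (1 + l) * ?m ^ k"
    using assms by (simp add: powr_add)
  finally show ?thesis .
qed

end

section \<open>The mean number of children of a late node\<close>

text \<open>The sawtooth function. The number of integers in \<open>[u, v)\<close> differs from
  \<open>v - u\<close> by a difference of two of its values.\<close>

definition ceil_gap :: "real \<Rightarrow> real" where
  "ceil_gap u = of_int \<lceil>u\<rceil> - u"

lemma ceil_gap_bounds: "0 \<le> ceil_gap u" "ceil_gap u < 1"
  unfolding ceil_gap_def by linarith+

lemma ceil_gap_measurable [measurable]: "ceil_gap \<in> borel_measurable borel"
  unfolding ceil_gap_def[abs_def] by measurable

text \<open>The centred sawtooth has the bounded primitive \<open>h / 2\<close> with
  \<open>h u = frac u * (1 - frac u)\<close>, continuous also at the integers; speeding the argument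
  up by \<open>c\<close> divides the primitive by \<open>c\<close>.\<close>

lemma ceil_gap_integral:
  assumes ab: "a \<le> b" and c: "c > 0"
  shows "\<exists>I. ((\<lambda>u. ceil_gap (c * u) - 1 / 2) has_integral I) {a..b} \<and> \<bar>I\<bar> \<le> 1 / c"
proof -
  define h where "h u = frac u * (1 - frac u)" for u :: real
  \<comment> \<open>A formula valid on both sides of the integer \<open>n\<close>, from which
    continuity can be read off at integers too.\<close>
  have h_local: "h v = \<bar>v - of_int n\<bar> * (1 - \<bar>v - of_int n\<bar>)" if "\<bar>v - of_int n\<bar> < 1" for v and n :: int
  proof (cases "v \<ge> of_int n")
    case True
    then have "\<lfloor>v\<rfloor> = n" using that by linarith
    then show ?thesis using True by (simp add: h_def frac_def)
  next
    case False
    then have n: "n = \<lfloor>v\<rfloor> + 1" using that by linarith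
    then show ?thesis using False by (simp add: h_def frac_def algebra_simps)
  qed
  have near: "eventually (\<lambda>v. \<bar>v - of_int n\<bar> < 1) (nhds u)" if "\<bar>u - of_int n\<bar> < 1" for u :: real and n :: int
  proof (rule eventually_nhds_in_open[of "ball (of_int n) 1", THEN eventually_mono])
    show "u \<in> ball (of_int n) 1" using that by (simp add: dist_real_def abs_minus_commute)
  qed (auto simp: dist_real_def abs_minus_commute)
  have h_cont: "isCont h u" for u
  proof -
    have u: "\<bar>u - of_int \<lfloor>u\<rfloor>\<bar> < 1" by linarith
    have "isCont (\<lambda>v. \<bar>v - of_int \<lfloor>u\<rfloor>\<bar> * (1 - \<bar>v - of_int \<lfloor>u\<rfloor>\<bar>)) u"
      by (intro continuous_intros)
    moreover have e: "eventually (\<lambda>v. h v = \<bar>v - of_int \<lfloor>u\<rfloor>\<bar> * (1 - \<bar>v - of_int \<lfloor>u\<rfloor>\<bar>)) (nhds u)"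
      using near[OF u] by eventually_elim (rule h_local)
    ultimately show ?thesis using isCont_cong[OF e] by blast
  qed
  have h_deriv: "(h has_real_derivative (1 - 2 * frac u)) (at u)" if "u \<notin> \<int>" for u
  proof -
    let ?n = "\<lfloor>u\<rfloor>"
    have ne: "u \<noteq> of_int ?n" using that by (metis Ints_of_int)
    have "((\<lambda>v. (v - of_int ?n) * (1 - (v - of_int ?n))) has_real_derivative (1 - 2 * frac u)) (at u)"
      by (auto intro!: derivative_eq_intros simp: frac_def algebra_simps)
    moreover have "eventually (\<lambda>v. v \<in> {of_int ?n<..<of_int ?n + 1}) (nhds u)"
    proof (rule eventually_nhds_in_open)
      have "of_int ?n \<le> u" "u < of_int ?n + 1" by linarith+
      then show "u \<in> {of_int ?n<..<of_int ?n + 1}" using ne by (auto simp del: of_int_floor_le)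
    qed simp
    then have e: "eventually (\<lambda>v. (v - of_int ?n) * (1 - (v - of_int ?n)) = h v) (nhds u)"
      by eventually_elim (subst h_local[of _ ?n], auto)
    ultimately show ?thesis using DERIV_cong_ev[OF refl e refl] by blast
  qed
  define S where "S = {u \<in> {a..b}. c * u \<in> \<int>}"
  have "finite S"
  proof (rule finite_subset)
    show "S \<subseteq> (\<lambda>n. of_int n / c) ` {\<lfloor>c * a\<rfloor>..\<lceil>c * b\<rceil>}"
    proof
      fix u assume u: "u \<in> S"
      then obtain n where n: "c * u = of_int n" by (auto simp: S_def Ints_def)
      have "c * a \<le> of_int n" "of_int n \<le> c * b"
        using u c unfolding n[symmetric] by (auto simp: S_def)
      then have "n \<in> {\<lfloor>c * a\<rfloor>..\<lceil>c * b\<rceil>}" by (auto simp: floor_le_iff le_ceiling_iff)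
      moreover have "u = of_int n / c" using n c by (simp add: field_simps)
      ultimately show "u \<in> (\<lambda>n. of_int n / c) ` {\<lfloor>c * a\<rfloor>..\<lceil>c * b\<rceil>}" by blast
    qed
  qed simp
  have "((\<lambda>u. ceil_gap (c * u) - 1 / 2) has_integral (h (c * b) / (2 * c) - h (c * a) / (2 * c))) {a..b}"
  proof (rule fundamental_theorem_of_calculus_interior_strong[OF \<open>finite S\<close> ab])
    show "continuous_on {a..b} (\<lambda>u. h (c * u) / (2 * c))"
    proof (intro continuous_intros)
      show "continuous_on {a..b} (\<lambda>x. h (c * x))"
        by (intro continuous_at_imp_continuous_on ballI isCont_o2[of _ "\<lambda>x. c * x" h] h_cont continuous_intros)
    qed (use c in auto)
    fix u assume u: "u \<in> {a<..<b} - S"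
    then have ni: "c * u \<notin> \<int>" by (auto simp: S_def)
    have "((\<lambda>u. h (c * u)) has_real_derivative (1 - 2 * frac (c * u)) * c) (at u)"
      by (rule DERIV_chain2[where f=h and g="\<lambda>u. c * u", OF h_deriv[OF ni]]) (auto intro!: derivative_eq_intros)
    then have "((\<lambda>u. h (c * u) / (2 * c)) has_real_derivative (1 - 2 * frac (c * u)) * c / (2 * c)) (at u)"
      by (rule DERIV_cdivide)
    moreover have "(1 - 2 * frac (c * u)) * c / (2 * c) = ceil_gap (c * u) - 1 / 2"
    proof -
      have "c * u \<noteq> of_int \<lfloor>c * u\<rfloor>" using ni by (metis Ints_of_int)
      then have "\<lceil>c * u\<rceil> = \<lfloor>c * u\<rfloor> + 1" by linarith
      then show ?thesis using c by (simp add: ceil_gap_def frac_def field_simps)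
    qed
    ultimately show "((\<lambda>u. h (c * u) / (2 * c)) has_vector_derivative ceil_gap (c * u) - 1 / 2) (at u)"
      by (simp add: has_real_derivative_iff_has_vector_derivative)
  qed
  moreover have "\<bar>h (c * b) / (2 * c) - h (c * a) / (2 * c)\<bar> \<le> 1 / c"
  proof -
    have "0 \<le> h u \<and> h u \<le> 1" for u
    proof -
      have "0 \<le> frac u" "0 \<le> 1 - frac u" "frac u \<le> 1" "1 - frac u \<le> 1"
        using frac_lt_1[of u] frac_ge_0[of u] by auto
      then show ?thesis
        using mult_mono[of "frac u" 1 "1 - frac u" 1] unfolding h_def by auto
    qed
    from this[of "c * a"] this[of "c * b"] have "\<bar>h (c * b) - h (c * a)\<bar> \<le> 1" by linarith
    then have "\<bar>h (c * b) - h (c * a)\<bar> / (2 * c) \<le> 1 / (2 * c)"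
      using c by (intro divide_right_mono) auto
    also have "\<dots> \<le> 1 / c" using c by (simp add: field_simps)
    finally show ?thesis using c by (simp add: abs_divide flip: diff_divide_distrib)
  qed
  ultimately show ?thesis by blast
qed

text \<open>A Riemann-Lebesgue argument. The sets \<open>A\<close> over which the integrals of
  \<open>\<kappa> j\<close> tend to 0 are closed under complements and disjoint countable unions, so
  intervals yield all Borel sets; linearity and the bound on \<open>\<kappa>\<close> then carry the
  limit to simple functions and to their limits in mean.\<close>

lemma weak_null_upgrade:
  fixes \<kappa> :: "nat \<Rightarrow> real \<Rightarrow> real"
  assumes "finite_measure \<nu>" and sets [measurable_cong]: "sets \<nu> = sets borel"
    and [measurable]: "\<And>j. \<kappa> j \<in> borel_measurable borel"
    and bd: "\<And>j u. \<bar>\<kappa> j u\<bar> \<le> 1"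
    and int0: "\<And>a b. a \<le> b \<Longrightarrow> (\<lambda>j. LINT u|\<nu>. indicator {a..b} u * \<kappa> j u) \<longlonglongrightarrow> 0"
    and univ0: "(\<lambda>j. LINT u|\<nu>. \<kappa> j u) \<longlonglongrightarrow> 0"
    and g: "integrable \<nu> g"
  shows "(\<lambda>j. LINT u|\<nu>. g u * \<kappa> j u) \<longlonglongrightarrow> 0"
proof -
  interpret finite_measure \<nu> by fact
  have int_\<kappa>: "integrable \<nu> (\<lambda>u. f u * \<kappa> j u)" if "integrable \<nu> f" for f j
  proof (rule Bochner_Integration.integrable_bound[OF that])
    show "AE u in \<nu>. norm (f u * \<kappa> j u) \<le> norm (f u)"
      using bd[of j] by (intro AE_I2) (auto simp: abs_mult intro: mult_left_le)
  qed (use that in measurable)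
  have int_ind: "integrable \<nu> (indicator A :: real \<Rightarrow> real)" if "A \<in> sets borel" for A
    using that sets by (intro integrable_real_indicator) (auto simp: emeasure_eq_measure)
  have int_1: "integrable \<nu> (\<kappa> j)" for j
    using int_\<kappa>[of "\<lambda>_. 1" j] by simp
  have ind0: "(\<lambda>j. LINT u|\<nu>. indicator A u * \<kappa> j u) \<longlonglongrightarrow> 0" if "A \<in> sets borel" for A
    using that
  proof (induction rule: borel_set_induct)
    case (compl A)
    have "(LINT u|\<nu>. indicator (- A) u * \<kappa> j u) = (LINT u|\<nu>. \<kappa> j u) - (LINT u|\<nu>. indicator A u * \<kappa> j u)" for j
    proof -
      have "(LINT u|\<nu>. indicator (- A) u * \<kappa> j u) = (LINT u|\<nu>. \<kappa> j u - indicator A u * \<kappa> j u)"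
        by (intro Bochner_Integration.integral_cong) (auto simp: indicator_def)
      also have "\<dots> = (LINT u|\<nu>. \<kappa> j u) - (LINT u|\<nu>. indicator A u * \<kappa> j u)"
        using compl by (intro Bochner_Integration.integral_diff int_1 int_\<kappa> int_ind)
      finally show ?thesis .
    qed
    then show ?case using tendsto_diff[OF univ0 compl(2)] by simp
  next
    case (union f)
    have fm: "f i \<in> sets \<nu>" for i using union sets by auto
    have summ: "summable (\<lambda>i. measure \<nu> (f i))"
      using finite_measure_UNION[of f] fm union(1) by (auto simp: sums_iff)
    have bound: "norm (LINT u|\<nu>. indicator (f i) u * \<kappa> j u) \<le> measure \<nu> (f i)"
      and bound': "(LINT u|\<nu>. norm (indicator (f i) u * \<kappa> j u)) \<le> measure \<nu> (f i)" for i j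
    proof -
      have "(LINT u|\<nu>. norm (indicator (f i) u * \<kappa> j u)) \<le> (LINT u|\<nu>. indicator (f i) u)"
      proof (rule integral_mono)
        show "integrable \<nu> (\<lambda>u. norm (indicator (f i) u * \<kappa> j u))"
          by (intro integrable_norm int_\<kappa> int_ind union)
        show "integrable \<nu> (indicator (f i) :: real \<Rightarrow> real)" by (intro int_ind union)
        show "norm (indicator (f i) u * \<kappa> j u) \<le> indicator (f i) u" for u
          using bd[of j u] by (auto simp: indicator_def)
      qed
      also have "\<dots> = measure \<nu> (f i)"
        using fm[of i] sets_eq_imp_space_eq[OF sets] by simp
      finally show 1: "(LINT u|\<nu>. norm (indicator (f i) u * \<kappa> j u)) \<le> measure \<nu> (f i)" .
      show "norm (LINT u|\<nu>. indicator (f i) u * \<kappa> j u) \<le> measure \<nu> (f i)"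
        by (rule order_trans[OF integral_norm_bound 1])
    qed
    have "(LINT u|\<nu>. indicator (\<Union>i. f i) u * \<kappa> j u) = (\<Sum>i. LINT u|\<nu>. indicator (f i) u * \<kappa> j u)" for j
    proof -
      have *: "(\<lambda>i. indicator (f i) u * \<kappa> j u) sums (indicator (\<Union>i. f i) u * \<kappa> j u)" for u
        by (intro sums_mult2 indicator_sums) (use union(1) in \<open>auto simp: disjoint_family_on_def\<close>)
      have "(LINT u|\<nu>. indicator (\<Union>i. f i) u * \<kappa> j u) = (LINT u|\<nu>. (\<Sum>i. indicator (f i) u * \<kappa> j u))"
        using * by (simp add: sums_iff)
      also have "\<dots> = (\<Sum>i. LINT u|\<nu>. indicator (f i) u * \<kappa> j u)"
      proof (rule integral_suminf)
        show "integrable \<nu> (\<lambda>u. indicator (f i) u * \<kappa> j u)" for i by (intro int_\<kappa> int_ind union)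
        show "AE u in \<nu>. summable (\<lambda>i. norm (indicator (f i) u * \<kappa> j u))"
        proof (rule AE_I2)
          fix u
          have "(\<lambda>i. indicator (f i) u * \<bar>\<kappa> j u\<bar>) sums (indicator (\<Union>i. f i) u * \<bar>\<kappa> j u\<bar>)"
            by (intro sums_mult2 indicator_sums) (use union(1) in \<open>auto simp: disjoint_family_on_def\<close>)
          then show "summable (\<lambda>i. norm (indicator (f i) u * \<kappa> j u))"
            by (simp add: sums_iff abs_mult)
        qed
        show "summable (\<lambda>i. LINT u|\<nu>. norm (indicator (f i) u * \<kappa> j u))"
          using bound' by (intro summable_comparison_test'[OF summ]) auto
      qed
      finally show ?thesis .
    qed
    \<comment> \<open>Tannery's theorem exchanges the limit in \<open>j\<close> with the sum over
      the disjoint pieces; the dominating series is that of their measures.\<close>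
    moreover have "(\<lambda>j. \<Sum>i. LINT u|\<nu>. indicator (f i) u * \<kappa> j u) \<longlonglongrightarrow> (\<Sum>i. 0)"
      using tannerys_theorem[where a = "\<lambda>i j. LINT u|\<nu>. indicator (f i) u * \<kappa> j u" and b = "\<lambda>_. 0"
          and F = sequentially and M = "\<lambda>i. measure \<nu> (f i)"]
        union(3) summ bound by (simp add: case_prod_unfold)
    ultimately show ?case by simp
  qed (use int0 in auto)
  show ?thesis
    using g
  proof (induction rule: integrable_induct)
    case (base A c)
    have "(\<lambda>j. c * (LINT u|\<nu>. indicator A u * \<kappa> j u)) \<longlonglongrightarrow> c * 0"
      using base sets by (intro tendsto_mult tendsto_const ind0) auto
    then show ?case by (simp add: mult_ac)
  next
    case (add f g)
    have "(LINT u|\<nu>. (f u + g u) * \<kappa> j u) = (LINT u|\<nu>. f u * \<kappa> j u) + (LINT u|\<nu>. g u * \<kappa> j u)" for j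
      unfolding distrib_right by (intro Bochner_Integration.integral_add int_\<kappa> add)
    then show ?case using tendsto_add[OF add(3,4)] by simp
  next
    case (lim f s)
    \<comment> \<open>The approximants are bounded by \<open>2 * norm (f u)\<close>, whence the
      majorant with factor 3.\<close>
    have *: "(\<lambda>i. LINT u|\<nu>. norm (s i u - f u)) \<longlonglongrightarrow> (LINT u|\<nu>. 0)"
    proof (rule integral_dominated_convergence[where w="\<lambda>u. 3 * norm (f u)"])
      show "integrable \<nu> (\<lambda>u. 3 * norm (f u))" using lim by auto
      show "AE u in \<nu>. (\<lambda>i. norm (s i u - f u)) \<longlonglongrightarrow> 0"
        using lim by (intro AE_I2 tendsto_norm_zero) (simp add: LIM_zero)
      show "AE u in \<nu>. norm (norm (s i u - f u)) \<le> 3 * norm (f u)" for i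
      proof (rule AE_I2)
        fix u assume "u \<in> space \<nu>"
        then show "norm (norm (s i u - f u)) \<le> 3 * norm (f u)"
          using lim(3)[of u i] by simp
      qed
    qed (use lim in measurable)
    show ?case
    proof (rule LIMSEQ_I)
      fix r :: real assume "r > 0"
      then obtain i where i: "(LINT u|\<nu>. norm (s i u - f u)) < r / 2"
        using LIMSEQ_D[OF *, of "r / 2"] by fastforce
      obtain J where J: "\<And>j. j \<ge> J \<Longrightarrow> \<bar>LINT u|\<nu>. s i u * \<kappa> j u\<bar> < r / 2"
        using LIMSEQ_D[OF lim(5)[of i], of "r / 2"] \<open>r > 0\<close> by auto
      have "\<bar>LINT u|\<nu>. f u * \<kappa> j u\<bar> < r" if "j \<ge> J" for j
      proof -
        have "(LINT u|\<nu>. s i u * \<kappa> j u) - (LINT u|\<nu>. f u * \<kappa> j u) = (LINT u|\<nu>. (s i u - f u) * \<kappa> j u)"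
          unfolding left_diff_distrib
          by (intro Bochner_Integration.integral_diff[symmetric] int_\<kappa> lim)
        also have "norm \<dots> \<le> (LINT u|\<nu>. norm ((s i u - f u) * \<kappa> j u))"
          by (rule integral_norm_bound)
        also have "\<dots> \<le> (LINT u|\<nu>. norm (s i u - f u))"
        proof (rule integral_mono)
          have "integrable \<nu> (\<lambda>u. s i u - f u)" using lim by auto
          then show "integrable \<nu> (\<lambda>u. norm ((s i u - f u) * \<kappa> j u))" "integrable \<nu> (\<lambda>u. norm (s i u - f u))"
            using int_\<kappa> by auto
          show "norm ((s i u - f u) * \<kappa> j u) \<le> norm (s i u - f u)" for u
            using bd[of j u] by (simp add: abs_mult mult_left_le)
        qed
        finally show ?thesis using i J[OF that] by simp
      qed
      then show "\<exists>J. \<forall>j\<ge>J. norm ((LINT u|\<nu>. f u * \<kappa> j u) - 0) < r" by auto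
    qed
  qed
qed


lemma children_eq:
  assumes "x > 0" "j \<ge> 1"
  shows "{i. nat \<lfloor>real i * x\<rfloor> = j} = {nat \<lceil>real j / x\<rceil>..<nat \<lceil>(real j + 1) / x\<rceil>}"
proof -
  have "nat \<lfloor>real i * x\<rfloor> = j \<longleftrightarrow> i \<in> {nat \<lceil>real j / x\<rceil>..<nat \<lceil>(real j + 1) / x\<rceil>}" for i
  proof -
    have "nat \<lfloor>real i * x\<rfloor> = j \<longleftrightarrow> \<lfloor>real i * x\<rfloor> = int j"
      using assms by auto
    also have "\<dots> \<longleftrightarrow> real j \<le> real i * x \<and> real i * x < real j + 1"
      by (simp add: floor_eq_iff)
    also have "\<dots> \<longleftrightarrow> real j / x \<le> real i \<and> real i < (real j + 1) / x"
      using assms by (simp add: field_simps)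
    also have "\<dots> \<longleftrightarrow> \<lceil>real j / x\<rceil> \<le> int i \<and> int i < \<lceil>(real j + 1) / x\<rceil>"
      using ceiling_le_iff[of "real j / x" "int i"] less_ceiling_iff[of "int i" "(real j + 1) / x"] by simp
    also have "\<dots> \<longleftrightarrow> i \<in> {nat \<lceil>real j / x\<rceil>..<nat \<lceil>(real j + 1) / x\<rceil>}"
      by (simp only: atLeastLessThan_iff nat_le_iff zless_nat_eq_int_zless)
    finally show ?thesis .
  qed
  then show ?thesis by blast
qed

text \<open>The two halves cancel; they are inserted to present the count as \<open>1 / x\<close>
  plus two centred sawtooth terms, which average out for large \<open>j\<close>.\<close>

lemma card_children:
  assumes "x > 0" "j \<ge> 1"
  shows "real (card {i. nat \<lfloor>real i * x\<rfloor> = j})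
    = 1 / x + (ceil_gap ((real j + 1) * (1 / x)) - 1 / 2) - (ceil_gap (real j * (1 / x)) - 1 / 2)"
proof -
  have "0 \<le> real j / x" "real j / x \<le> (real j + 1) / x"
    using assms by (auto intro: divide_right_mono)
  then have "0 \<le> \<lceil>real j / x\<rceil>" "\<lceil>real j / x\<rceil> \<le> \<lceil>(real j + 1) / x\<rceil>"
    by (auto intro: ceiling_mono)
  then have "int (nat \<lceil>(real j + 1) / x\<rceil> - nat \<lceil>real j / x\<rceil>) = \<lceil>(real j + 1) / x\<rceil> - \<lceil>real j / x\<rceil>"
    by linarith
  then have "of_int (int (nat \<lceil>(real j + 1) / x\<rceil> - nat \<lceil>real j / x\<rceil>)) = (of_int (\<lceil>(real j + 1) / x\<rceil> - \<lceil>real j / x\<rceil>) :: real)"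
    by (rule arg_cong)
  then have "real (card {i. nat \<lfloor>real i * x\<rfloor> = j}) = of_int \<lceil>(real j + 1) / x\<rceil> - of_int \<lceil>real j / x\<rceil>"
    unfolding children_eq[OF assms] by simp
  then show ?thesis by (simp add: ceil_gap_def add_divide_distrib)
qed

text \<open>This is where the density is essential: the fractional parts of \<open>j / X\<close>
  equidistribute as \<open>j\<close> grows, so a node with a large label \<open>j\<close> has on average
  \<open>E (1 / X)\<close> children.\<close>

lemma children_count_limit:
  assumes D: "finite_measure D" and D_sets [measurable_cong]: "sets D = sets borel"
    and ac: "absolutely_continuous lborel D"
    and J [measurable]: "J \<in> sets borel" and J_pos: "J \<subseteq> {\<epsilon>..}" "\<epsilon> > 0"
  shows "(\<lambda>j. LINT x|D. indicator J x * real (card {i. nat \<lfloor>real i * x\<rfloor> = j}))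
    \<longlonglongrightarrow> (LINT x|D. indicator J x * (1 / x))"
proof -
  interpret D: finite_measure D by fact
  \<comment> \<open>In the variable \<open>u = 1 / x\<close> the oscillation is
    \<open>\<kappa> j u\<close>, a sawtooth of frequency \<open>j\<close>; for
    \<open>x \<in> J\<close> this variable lies in \<open>{0..R}\<close>, on which
    \<open>\<nu>\<close> is Lebesgue measure.\<close>
  define R where "R = 1 / \<epsilon>"
  define \<nu> where "\<nu> = density lborel (\<lambda>u. ennreal (indicator {0..R} u))"
  define \<kappa> where "\<kappa> j u = ceil_gap (real j * u) - 1 / 2" for j u
  have \<nu>_sets [measurable_cong]: "sets \<nu> = sets borel" by (simp add: \<nu>_def)
  have [measurable]: "\<kappa> j \<in> borel_measurable borel" for j
    unfolding \<kappa>_def[abs_def] by measurable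
  have \<kappa>_bd: "\<bar>\<kappa> j u\<bar> \<le> 1" for j u
    using ceil_gap_bounds[of "real j * u"] unfolding \<kappa>_def by linarith
  have \<nu>: "finite_measure \<nu>"
    using J_pos by (intro finite_measureI) (simp add: \<nu>_def emeasure_density ennreal_indicator R_def)
  interpret \<nu>: finite_measure \<nu> by fact
  have \<nu>_int: "(LINT u|\<nu>. indicator A u * \<kappa> j u) = (LINT u|lborel. indicator (A \<inter> {0..R}) u * \<kappa> j u)"
    if [measurable]: "A \<in> sets borel" for A j
  proof -
    have "(LINT u|\<nu>. indicator A u * \<kappa> j u) = (LINT u|lborel. indicator {0..R} u *\<^sub>R (indicator A u * \<kappa> j u))"
      unfolding \<nu>_def by (rule integral_density) auto
    also have "\<dots> = (LINT u|lborel. indicator (A \<inter> {0..R}) u * \<kappa> j u)"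
      by (rule Bochner_Integration.integral_cong[OF refl]) (auto simp: indicator_def)
    finally show ?thesis .
  qed
  have small: "\<bar>LINT u|lborel. indicator {a..b} u * \<kappa> j u\<bar> \<le> 1 / real j" if "j > 0" for a b j
  proof (cases "a \<le> b")
    case True
    obtain I where I: "((\<lambda>u. ceil_gap (real j * u) - 1 / 2) has_integral I) {a..b}" "\<bar>I\<bar> \<le> 1 / real j"
      using ceil_gap_integral[OF True, of "real j"] \<open>j > 0\<close> by auto
    have "integrable lborel (\<lambda>u. indicator {a..b} u * \<kappa> j u)"
    proof (rule Bochner_Integration.integrable_bound)
      show "integrable lborel (indicator {a..b} :: real \<Rightarrow> real)"
        by (rule integrable_real_indicator) (auto simp: emeasure_lborel_Icc_eq)
      show "AE u in lborel. norm (indicator {a..b} u * \<kappa> j u) \<le> norm (indicator {a..b} u :: real)"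
        using \<kappa>_bd[of j] by (intro AE_I2) (auto simp: indicator_def)
    qed measurable
    then have "((\<lambda>u. indicator {a..b} u * \<kappa> j u) has_integral (LINT u|lborel. indicator {a..b} u * \<kappa> j u)) UNIV"
      by (rule has_integral_integral_lborel)
    then have "((\<lambda>u. if u \<in> {a..b} then \<kappa> j u else 0) has_integral (LINT u|lborel. indicator {a..b} u * \<kappa> j u)) UNIV"
      by (rule has_integral_eq[rotated]) (auto simp: indicator_def)
    then have "(\<kappa> j has_integral (LINT u|lborel. indicator {a..b} u * \<kappa> j u)) {a..b}"
      by (simp only: has_integral_restrict_UNIV)
    moreover have "(\<kappa> j has_integral I) {a..b}" using I(1) by (simp only: \<kappa>_def[abs_def])
    ultimately have "(LINT u|lborel. indicator {a..b} u * \<kappa> j u) = I"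
      by (rule has_integral_unique)
    then show ?thesis using I(2) by simp
  qed (use that in simp)
  have lim0: "(\<lambda>j. LINT u|\<nu>. indicator {a..b} u * \<kappa> j u) \<longlonglongrightarrow> 0" for a b
  proof (rule Lim_null_comparison)
    have *: "{a..b} \<inter> {0..R} = {max a 0..min b R}" by auto
    show "eventually (\<lambda>j. norm (LINT u|\<nu>. indicator {a..b} u * \<kappa> j u) \<le> 1 / real j) sequentially"
      using eventually_gt_at_top[of 0] by eventually_elim (simp add: \<nu>_int * small)
  qed (rule lim_1_over_n)
  have lim_univ: "(\<lambda>j. LINT u|\<nu>. \<kappa> j u) \<longlonglongrightarrow> 0"
  proof -
    have "(LINT u|\<nu>. \<kappa> j u) = (LINT u|\<nu>. indicator {0..R} u * \<kappa> j u)" for j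
      using \<nu>_int[of UNIV j] \<nu>_int[of "{0..R}" j] by simp
    then show ?thesis using lim0[of 0 R] by simp
  qed
  \<comment> \<open>The image of \<open>D\<close>, restricted to \<open>J\<close>, under
    inversion.\<close>
  define Q where "Q = distr (density D (\<lambda>x. ennreal (indicator J x))) borel (\<lambda>x. 1 / x)"
  have Q_int: "(LINT u|Q. h u) = (LINT x|D. indicator J x * h (1 / x))" if [measurable]: "h \<in> borel_measurable borel" for h :: "real \<Rightarrow> real"
  proof -
    have "(LINT u|Q. h u) = (LINT x|density D (\<lambda>x. ennreal (indicator J x)). h (1 / x))"
      unfolding Q_def by (rule integral_distr) measurable
    also have "\<dots> = (LINT x|D. indicator J x *\<^sub>R h (1 / x))"
      by (rule integral_density) auto
    finally show ?thesis by simp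
  qed
  have Q_em: "emeasure Q Z = emeasure D (J \<inter> {x. 1 / x \<in> Z})" if [measurable]: "Z \<in> sets borel" for Z
  proof -
    have sp: "space D = UNIV" using sets_eq_imp_space_eq[OF D_sets] by simp
    have "(\<lambda>x::real. 1 / x) \<in> borel \<rightarrow>\<^sub>M borel" by measurable
    from measurable_sets[OF this that]
    have inv: "{x. 1 / x \<in> Z} \<in> sets D" "(\<lambda>x. 1 / x) -` Z \<in> sets D"
      by (simp_all add: vimage_def D_sets)
    have "emeasure Q Z = (\<integral>\<^sup>+x. ennreal (indicator J x) * indicator ((\<lambda>x. 1 / x) -` Z) x \<partial>D)"
      unfolding Q_def by (simp add: emeasure_distr sp emeasure_density inv)
    also have "\<dots> = (\<integral>\<^sup>+x. indicator (J \<inter> {x. 1 / x \<in> Z}) x \<partial>D)"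
      by (intro nn_integral_cong) (auto simp: indicator_def)
    also have "\<dots> = emeasure D (J \<inter> {x. 1 / x \<in> Z})"
      by (rule nn_integral_indicator) (use inv J D_sets in auto)
    finally show ?thesis .
  qed
  have Q_sets [measurable_cong]: "sets Q = sets borel" by (simp add: Q_def)
  have Qf: "finite_measure Q"
    by (rule finite_measureI) (simp add: Q_em sets_eq_imp_space_eq[OF Q_sets] D.emeasure_eq_measure)
  \<comment> \<open>Inversion is differentiable away from 0 and so maps Lebesgue null sets to null
    sets. Here the density of the attachment enters, through \<open>ac\<close>.\<close>
  have Q_ac: "absolutely_continuous \<nu> Q"
    unfolding absolutely_continuous_def
  proof
    fix Z assume Z: "Z \<in> null_sets \<nu>"
    then have [measurable]: "Z \<in> sets borel" using \<nu>_sets by auto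
    have "emeasure \<nu> Z = (\<integral>\<^sup>+u. ennreal (indicator {0..R} u) * indicator Z u \<partial>lborel)"
      unfolding \<nu>_def by (rule emeasure_density) auto
    also have "\<dots> = (\<integral>\<^sup>+u. indicator (Z \<inter> {0..R}) u \<partial>lborel)"
      by (rule nn_integral_cong) (auto simp: indicator_def)
    also have "\<dots> = emeasure lborel (Z \<inter> {0..R})"
      by (rule nn_integral_indicator) simp
    finally have "Z \<inter> {0..R} \<in> null_sets lborel"
      using null_setsD1[OF Z] by (intro null_setsI) simp_all
    then have "negligible (Z \<inter> {0..R})"
      unfolding negligible_iff_null_sets by (rule null_sets_completionI)
    then have "negligible (Z \<inter> {0<..R})"
      by (rule negligible_subset) auto
    then have "negligible ((\<lambda>x. 1 / x) ` (Z \<inter> {0<..R}))"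
    proof (rule negligible_differentiable_image_negligible[OF order_refl])
      show "(\<lambda>x. 1 / x) differentiable_on Z \<inter> {0<..R}"
        unfolding differentiable_on_def by (auto intro!: derivative_intros)
    qed
    moreover have "J \<inter> {x. 1 / x \<in> Z} \<subseteq> (\<lambda>x. 1 / x) ` (Z \<inter> {0<..R})"
    proof
      fix x assume x: "x \<in> J \<inter> {x. 1 / x \<in> Z}"
      then have "x \<ge> \<epsilon>" using J_pos by auto
      then have "1 / x \<in> Z \<inter> {0<..R}"
        using x J_pos by (auto simp: R_def intro!: divide_left_mono)
      moreover have "x = 1 / (1 / x)" by simp
      ultimately show "x \<in> (\<lambda>x. 1 / x) ` (Z \<inter> {0<..R})" by blast
    qed
    ultimately have "negligible (J \<inter> {x. 1 / x \<in> Z})" by (rule negligible_subset)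
    then have "J \<inter> {x. 1 / x \<in> Z} \<in> null_sets lborel"
      by (subst null_sets_completion_iff[symmetric]) (simp_all add: negligible_iff_null_sets)
    then have "emeasure D (J \<inter> {x. 1 / x \<in> Z}) = 0"
      using ac by (auto simp: absolutely_continuous_def)
    then show "Z \<in> null_sets Q" by (auto intro!: null_setsI simp: Q_em Q_sets)
  qed
  have QN: "sets Q = sets \<nu>" by (simp only: Q_sets \<nu>_sets)
  have "\<exists>g. g \<in> borel_measurable \<nu> \<and> (AE u in \<nu>. RN_deriv \<nu> Q u = ennreal (g u)) \<and> (\<forall>u. 0 \<le> g u)"
  proof (rule \<nu>.real_RN_deriv[OF Qf Q_ac QN])
    fix g :: "real \<Rightarrow> real"
    assume "g \<in> borel_measurable \<nu>" "AE u in \<nu>. RN_deriv \<nu> Q u = ennreal (g u)" "\<And>u. 0 \<le> g u"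
    then show ?thesis by (intro exI[of _ g] conjI allI)
  qed
  then obtain g where g [measurable]: "g \<in> borel_measurable \<nu>"
    and RN: "AE u in \<nu>. RN_deriv \<nu> Q u = ennreal (g u)" and g0: "\<And>u. 0 \<le> g u"
    by (elim exE conjE) simp
  have Qg: "Q = density \<nu> (\<lambda>u. ennreal (g u))"
  proof -
    have "Q = density \<nu> (RN_deriv \<nu> Q)"
      by (rule \<nu>.density_RN_deriv[OF Q_ac QN, symmetric])
    also have "\<dots> = density \<nu> (\<lambda>u. ennreal (g u))"
      by (rule density_cong[OF borel_measurable_RN_deriv _ RN]) measurable
    finally show ?thesis .
  qed
  have g_int: "integrable \<nu> g"
  proof (rule integrableI_nonneg)
    have "(\<integral>\<^sup>+u. ennreal (g u) \<partial>\<nu>) = emeasure Q (space Q)"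
      unfolding Qg by (simp add: emeasure_density cong: nn_integral_cong_simp)
    then show "(\<integral>\<^sup>+u. ennreal (g u) \<partial>\<nu>) < \<infinity>"
      using finite_measure.emeasure_finite[OF Qf] by (simp add: less_top)
  qed (use g0 in auto)
  \<comment> \<open>\<open>g\<close> is the integrable Radon-Nikodym density of \<open>Q\<close>;
    integrated against ever faster centred oscillation it gives 0 in the limit.\<close>
  have "(\<lambda>j. LINT u|\<nu>. g u * \<kappa> j u) \<longlonglongrightarrow> 0"
    by (rule weak_null_upgrade[OF \<nu> \<nu>_sets _ \<kappa>_bd lim0 lim_univ g_int]) measurable
  moreover have "(LINT u|\<nu>. g u * \<kappa> j u) = (LINT x|D. indicator J x * \<kappa> j (1 / x))" for j
  proof -
    have "(LINT u|\<nu>. g u * \<kappa> j u) = (LINT u|Q. \<kappa> j u)"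
      unfolding Qg using g0 by (subst integral_density) auto
    then show ?thesis by (simp add: Q_int)
  qed
  ultimately have lim: "(\<lambda>j. LINT x|D. indicator J x * \<kappa> j (1 / x)) \<longlonglongrightarrow> 0" by simp
  have bi: "integrable D (\<lambda>x. indicator J x * \<kappa> j (1 / x))" for j
  proof (rule D.integrable_const_bound[where B=1])
    show "AE x in D. norm (indicator J x * \<kappa> j (1 / x)) \<le> 1"
      using \<kappa>_bd[of j] by (intro AE_I2) (auto simp: indicator_def)
  qed measurable
  have bi': "integrable D (\<lambda>x. indicator J x * (1 / x))"
  proof (rule D.integrable_const_bound[where B=R])
    show "AE x in D. norm (indicator J x * (1 / x)) \<le> R"
    proof (rule AE_I2)
      fix x
      show "norm (indicator J x * (1 / x)) \<le> R"
      proof (cases "x \<in> J")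
        case True
        then have "x \<ge> \<epsilon>" using J_pos by auto
        then show ?thesis using True J_pos by (simp add: R_def field_simps)
      qed (use J_pos in \<open>simp add: R_def\<close>)
    qed
  qed measurable
  have "(LINT x|D. indicator J x * real (card {i. nat \<lfloor>real i * x\<rfloor> = j}))
    = (LINT x|D. indicator J x * (1 / x)) + (LINT x|D. indicator J x * \<kappa> (Suc j) (1 / x))
      - (LINT x|D. indicator J x * \<kappa> j (1 / x))" if "j \<ge> 1" for j
  proof -
    have "(LINT x|D. indicator J x * real (card {i. nat \<lfloor>real i * x\<rfloor> = j}))
      = (LINT x|D. (indicator J x * (1 / x) + indicator J x * \<kappa> (Suc j) (1 / x)) - indicator J x * \<kappa> j (1 / x))"
    proof (rule Bochner_Integration.integral_cong[OF refl])
      fix x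
      show "indicator J x * real (card {i. nat \<lfloor>real i * x\<rfloor> = j})
        = (indicator J x * (1 / x) + indicator J x * \<kappa> (Suc j) (1 / x)) - indicator J x * \<kappa> j (1 / x)"
      proof (cases "x \<in> J")
        case True
        then have "x > 0" using J_pos by force
        then show ?thesis
          using True card_children[OF _ that, of x] by (simp add: \<kappa>_def add.commute)
      qed simp
    qed
    also have "\<dots> = (LINT x|D. indicator J x * (1 / x)) + (LINT x|D. indicator J x * \<kappa> (Suc j) (1 / x))
      - (LINT x|D. indicator J x * \<kappa> j (1 / x))"
      by (subst Bochner_Integration.integral_diff[OF Bochner_Integration.integrable_add[OF bi' bi] bi],
          subst Bochner_Integration.integral_add[OF bi' bi]) (rule refl)
    finally show ?thesis .
  qed
  note cnt = this
  have ev: "eventually (\<lambda>j. (LINT x|D. indicator J x * (1 / x)) + (LINT x|D. indicator J x * \<kappa> (Suc j) (1 / x))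
      - (LINT x|D. indicator J x * \<kappa> j (1 / x))
      = (LINT x|D. indicator J x * real (card {i. nat \<lfloor>real i * x\<rfloor> = j}))) sequentially"
    using eventually_ge_at_top[of 1] by eventually_elim (rule cnt[symmetric])
  have "(\<lambda>j. (LINT x|D. indicator J x * (1 / x)) + (LINT x|D. indicator J x * \<kappa> (Suc j) (1 / x))
      - (LINT x|D. indicator J x * \<kappa> j (1 / x))) \<longlonglongrightarrow> (LINT x|D. indicator J x * (1 / x)) + 0 - 0"
    by (rule tendsto_diff[OF tendsto_add[OF tendsto_const LIMSEQ_Suc[OF lim]] lim])
  from Lim_transform_eventually[OF this ev] show ?thesis by simp
qed

section \<open>One generation\<close>

text \<open>Chebyshev's inequality: by pairwise independence the covariances off the diagonal
  vanish, and the variance of the count is at most its mean.\<close>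

lemma (in prob_space) count_lower_tail:
  assumes R: "finite R" and B: "\<And>i. i \<in> R \<Longrightarrow> B i \<in> events"
    and ind: "\<And>i j. i \<in> R \<Longrightarrow> j \<in> R \<Longrightarrow> i \<noteq> j \<Longrightarrow> prob (B i \<inter> B j) = prob (B i) * prob (B j)"
    and d: "d > 0" and le: "y + d \<le> (\<Sum>i\<in>R. prob (B i))"
  shows "prob {\<omega> \<in> space M. real (card {i\<in>R. \<omega> \<in> B i}) < y} \<le> (\<Sum>i\<in>R. prob (B i)) / d\<^sup>2"
proof -
  define p where "p i = prob (B i)" for i
  define Z where "Z \<omega> = (\<Sum>i\<in>R. indicator (B i) \<omega> - p i)" for \<omega>
  have ib: "integrable M (indicator A :: 'a \<Rightarrow> real)" if "A \<in> events" for A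
    using that by (intro integrable_real_indicator) (auto simp: emeasure_eq_measure)
  have prod_int: "integrable M (\<lambda>\<omega>. (indicator (B i) \<omega> - p i) * (indicator (B j) \<omega> - p j))"
    and prod_exp: "expectation (\<lambda>\<omega>. (indicator (B i) \<omega> - p i) * (indicator (B j) \<omega> - p j))
      = prob (B i \<inter> B j) - p i * p j" if "i \<in> R" "j \<in> R" for i j
  proof -
    have eq: "(\<lambda>\<omega>. (indicator (B i) \<omega> - p i) * (indicator (B j) \<omega> - p j))
      = (\<lambda>\<omega>. indicator (B i \<inter> B j) \<omega> - p j * indicator (B i) \<omega> - p i * indicator (B j) \<omega> + p i * p j)"
      by (auto simp: fun_eq_iff indicator_def algebra_simps)
    have m: "B i \<in> events" "B j \<in> events" "B i \<inter> B j \<in> events" using B that by auto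
    show "integrable M (\<lambda>\<omega>. (indicator (B i) \<omega> - p i) * (indicator (B j) \<omega> - p j))"
      unfolding eq by (intro Bochner_Integration.integrable_add Bochner_Integration.integrable_diff
          integrable_mult_right ib m integrable_const)
    have "expectation (\<lambda>\<omega>. (indicator (B i) \<omega> - p i) * (indicator (B j) \<omega> - p j))
      = prob (B i \<inter> B j) - p j * prob (B i) - p i * prob (B j) + p i * p j"
      unfolding eq using m by (simp add: ib emeasure_eq_measure prob_space)
    then show "expectation (\<lambda>\<omega>. (indicator (B i) \<omega> - p i) * (indicator (B j) \<omega> - p j))
      = prob (B i \<inter> B j) - p i * p j"
      by (simp add: p_def)
  qed
  have Z2: "(\<lambda>\<omega>. (Z \<omega>)\<^sup>2) = (\<lambda>\<omega>. \<Sum>i\<in>R. \<Sum>j\<in>R. (indicator (B i) \<omega> - p i) * (indicator (B j) \<omega> - p j))"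
    by (simp add: Z_def power2_eq_square sum_product)
  have int_Z2: "integrable M (\<lambda>\<omega>. (Z \<omega>)\<^sup>2)"
    unfolding Z2 by (intro Bochner_Integration.integrable_sum prod_int)
  have Z_meas [measurable]: "Z \<in> borel_measurable M"
    unfolding Z_def[abs_def] using B by (intro borel_measurable_sum borel_measurable_diff) auto
  have "expectation (\<lambda>\<omega>. (Z \<omega>)\<^sup>2) = (\<Sum>i\<in>R. \<Sum>j\<in>R. prob (B i \<inter> B j) - p i * p j)"
    unfolding Z2 using prod_int prod_exp
    by (simp add: Bochner_Integration.integral_sum Bochner_Integration.integrable_sum)
  also have "\<dots> = (\<Sum>i\<in>R. \<Sum>j\<in>R. if i = j then p i - p i * p i else 0)"
    by (intro sum.cong refl) (auto simp: p_def ind)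
  also have "\<dots> = (\<Sum>i\<in>R. p i - p i * p i)"
    using R by (simp add: sum.delta)
  also have "\<dots> \<le> (\<Sum>i\<in>R. p i)"
    by (intro sum_mono) (auto simp: p_def)
  finally have E: "expectation (\<lambda>\<omega>. (Z \<omega>)\<^sup>2) \<le> (\<Sum>i\<in>R. p i)" .
  have "prob {\<omega> \<in> space M. real (card {i\<in>R. \<omega> \<in> B i}) < y} \<le> prob {\<omega> \<in> space M. d \<le> \<bar>Z \<omega>\<bar>}"
  proof (rule finite_measure_mono)
    show "{\<omega> \<in> space M. real (card {i\<in>R. \<omega> \<in> B i}) < y} \<subseteq> {\<omega> \<in> space M. d \<le> \<bar>Z \<omega>\<bar>}"
    proof safe
      fix \<omega> assume "\<omega> \<in> space M" and c: "real (card {i\<in>R. \<omega> \<in> B i}) < y"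
      have "Z \<omega> = (\<Sum>i\<in>R. indicator (B i) \<omega>) - (\<Sum>i\<in>R. p i)"
        by (simp add: Z_def sum_subtractf)
      also have "(\<Sum>i\<in>R. indicator (B i) \<omega>) = real (card {i\<in>R. \<omega> \<in> B i})"
        using R by (simp add: indicator_def sum.If_cases Int_def)
      finally show "d \<le> \<bar>Z \<omega>\<bar>" using c le by (simp add: p_def)
    qed
  qed measurable
  also have "\<dots> \<le> expectation (\<lambda>\<omega>. (Z \<omega>)\<^sup>2) / d\<^sup>2"
    using second_moment_method[OF Z_meas int_Z2 d] by simp
  also have "\<dots> \<le> (\<Sum>i\<in>R. prob (B i)) / d\<^sup>2"
    using E d by (intro divide_right_mono) (auto simp: p_def)
  finally show ?thesis .
qed

definition kids :: "(real \<Rightarrow> nat) \<Rightarrow> nat \<Rightarrow> nat set \<Rightarrow> (nat \<Rightarrow> real) \<Rightarrow> nat set" where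
  "kids ty t A x = {i. parent x i \<in> A \<and> ty (x i) = t}"

text \<open>A type \<open>t \<in> I\<close> stands for the range \<open>s t \<le> - ln X < s t + \<eta>\<close>; values of \<open>ty\<close> outside \<open>I\<close> mark
  the attachments that are thrown away.\<close>

locale typed_attachment = iid_attachment +
  fixes ty :: "real \<Rightarrow> nat" and I :: "nat set" and s :: "nat \<Rightarrow> real" and \<eta> b :: real
  assumes ac: "absolutely_continuous lborel D"
    and ty_measurable [measurable]: "ty \<in> borel \<rightarrow>\<^sub>M count_space UNIV"
    and I: "finite I" and \<eta>: "\<eta> > 0" and b: "b > 0" "\<And>t. t \<in> I \<Longrightarrow> b \<le> s t"
    and ty: "\<And>r. ty r \<in> I \<Longrightarrow> exp (- (s (ty r) + \<eta>)) < r \<and> r \<le> exp (- s (ty r))"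
begin

text \<open>As \<open>1 / r = exp (- ln r)\<close>, this is the mass that the mean offspring measure
  gives to type \<open>t\<close>: the limiting mean number of children of type \<open>t\<close> of a
  node with a large label.\<close>

definition w :: "nat \<Rightarrow> real" where
  "w t = (LINT r|D. indicator {r. ty r = t} r * (1 / r))"

definition code :: "nat \<Rightarrow> real \<Rightarrow> nat \<times> nat" where
  "code i r = (parent_code i r, ty r)"

lemma code_measurable: "code i \<in> borel \<rightarrow>\<^sub>M count_space UNIV"
proof -
  have [measurable]: "parent_code i \<in> borel \<rightarrow>\<^sub>M count_space UNIV"
    by (rule parent_code_measurable)
  show ?thesis unfolding code_def[abs_def] by measurable
qed

lemma ty_sets: "{r. ty r = t} \<in> sets borel"
  using measurable_sets[OF ty_measurable, of "{t}"] by (simp add: vimage_def)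

lemma parent_code_sets: "{r. parent_code i r = j} \<in> sets borel"
  using measurable_sets[OF parent_code_measurable, of "{j}" i] by (simp add: vimage_def)

text \<open>A child of \<open>j\<close> with attachment \<open>r\<close> lies between
  \<open>j / r\<close> and \<open>(j + 1) / r\<close>, and the type bounds \<open>r\<close> from
  both sides; the \<open>+ 1\<close> is the rounding in \<open>parent\<close>.\<close>

lemma child_bounds:
  assumes t: "ty r \<in> I" and j: "parent_code i r = j" "j > 0"
  shows "real j * exp (s (ty r)) \<le> real i" "real i < (real j + 1) * exp (s (ty r) + \<eta>)"
proof -
  note r = ty[OF t]
  have "0 < r" using r order_less_trans[OF exp_gt_zero] by blast
  have "\<lfloor>real i * r\<rfloor> = int j" using j by (auto simp: parent_code_def)
  then have ir: "real j \<le> real i * r" "real i * r < real j + 1"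
    by (auto simp: floor_eq_iff)
  have "real i * r \<le> real i * exp (- s (ty r))"
    using r by (intro mult_left_mono) auto
  with ir have "real j \<le> real i * exp (- s (ty r))" by linarith
  then show "real j * exp (s (ty r)) \<le> real i" by (simp add: exp_minus field_simps)
  have "i > 0" using ir j by (cases i) auto
  then have "real i * exp (- (s (ty r) + \<eta>)) < real i * r"
    using r by (intro mult_strict_left_mono) auto
  with ir have "real i * exp (- (s (ty r) + \<eta>)) < real j + 1" by linarith
  from mult_strict_right_mono[OF this exp_gt_zero[of "s (ty r) + \<eta>"]]
  show "real i < (real j + 1) * exp (s (ty r) + \<eta>)"
    by (simp only: mult.assoc flip: exp_add) simp
qed

definition mean_kids :: "nat \<Rightarrow> nat \<Rightarrow> real" where
  "mean_kids t j = (LINT r|D. indicator {r. ty r = t} r * real (card {i. nat \<lfloor>real i * r\<rfloor> = j}))"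

lemma mean_kids_limit: "t \<in> I \<Longrightarrow> mean_kids t \<longlonglongrightarrow> w t"
  unfolding mean_kids_def[abs_def] w_def
proof (rule children_count_limit[OF _ _ ac ty_sets])
  show "finite_measure D" using D_prob by (rule prob_space.finite_measure)
  show "sets D = sets borel" by (rule D_sets)
  assume "t \<in> I"
  then show "{r. ty r = t} \<subseteq> {exp (- (s t + \<eta>))..}" using ty by fastforce
qed simp

text \<open>Exchanging sum and integral turns the chances of the different nodes \<open>i\<close> to
  choose \<open>j\<close>, all with the same law, into the expected number of \<open>i\<close> that
  a single attachment would send to \<open>j\<close>. Beyond \<open>n\<close> there are no children,
  so nothing is cut off.\<close>

lemma Pr_kid_sum:
  assumes t: "t \<in> I" and A: "finite A" "0 \<notin> A" and n: "\<And>j. j \<in> A \<Longrightarrow> (real j + 1) * exp (s t + \<eta>) \<le> real n"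
  shows "(\<Sum>i\<le>n. Pr (\<lambda>x. i \<in> kids ty t A x)) = (\<Sum>j\<in>A. mean_kids t j)"
proof -
  interpret D: prob_space D by (rule D_prob)
  have sp: "space D = UNIV" using sets_eq_imp_space_eq[OF D_sets] by simp
  let ?E = "\<lambda>i j. {r. parent_code i r = j} \<inter> {r. ty r = t}"
  have Em: "?E i j \<in> sets D" for i j
    unfolding D_sets by (intro sets.Int parent_code_sets ty_sets)
  have ie: "integrable D (indicator (?E i j) :: real \<Rightarrow> real)" for i j
    using Em by (intro integrable_real_indicator) (auto simp: D.emeasure_eq_measure)
  have "Pr (\<lambda>x. i \<in> kids ty t A x) = (\<Sum>j\<in>A. measure D (?E i j))" for i
  proof -
    have "Pr (\<lambda>x. i \<in> kids ty t A x) = Pr (\<lambda>x. (parent_code i (x i) \<in> A \<and> ty (x i) = t))"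
      by (simp add: kids_def parent_eq_parent_code)
    also have "\<dots> = measure D {r. parent_code i r \<in> A \<and> ty r = t}"
    proof (rule Pr_coord)
      have "(\<Union>j\<in>A. ?E i j) \<in> sets borel"
        using A(1) Em[unfolded D_sets] by (rule sets.finite_UN)
      also have "(\<Union>j\<in>A. ?E i j) = {r. parent_code i r \<in> A \<and> ty r = t}" by auto
      finally show "{r. parent_code i r \<in> A \<and> ty r = t} \<in> sets borel" .
    qed
    also have "{r. parent_code i r \<in> A \<and> ty r = t} = (\<Union>j\<in>A. ?E i j)" by auto
    also have "measure D \<dots> = (\<Sum>j\<in>A. measure D (?E i j))"
      using A Em by (intro D.finite_measure_finite_Union) (auto simp: disjoint_family_on_def)
    finally show ?thesis .
  qed
  then have "(\<Sum>i\<le>n. Pr (\<lambda>x. i \<in> kids ty t A x)) = (\<Sum>i\<le>n. \<Sum>j\<in>A. measure D (?E i j))"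
    by simp
  also have "\<dots> = (\<Sum>j\<in>A. \<Sum>i\<le>n. measure D (?E i j))"
    by (rule sum.swap)
  also have "\<dots> = (\<Sum>j\<in>A. mean_kids t j)"
  proof (rule sum.cong[OF refl])
    fix j assume j: "j \<in> A"
    have "(\<Sum>i\<le>n. measure D (?E i j)) = (\<Sum>i\<le>n. LINT r|D. indicator (?E i j) r)"
      by (simp add: sp)
    also have "\<dots> = (LINT r|D. (\<Sum>i\<le>n. indicator (?E i j) r))"
      by (rule Bochner_Integration.integral_sum[symmetric]) (rule ie)
    also have "\<dots> = mean_kids t j"
      unfolding mean_kids_def
    proof (rule Bochner_Integration.integral_cong[OF refl])
      fix r
      show "(\<Sum>i\<le>n. indicator (?E i j) r) = indicator {r. ty r = t} r * real (card {i. nat \<lfloor>real i * r\<rfloor> = j})"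
      proof (cases "ty r = t")
        case True
        have sub: "i \<le> n" if "parent_code i r = j" for i
          using child_bounds(2)[of r i j] n[OF j] that True t j A by (cases "j = 0") auto
        have "(\<Sum>i\<le>n. indicator (?E i j) r) = (\<Sum>i\<le>n. if parent_code i r = j then 1 else 0 :: real)"
          using True by (intro sum.cong) (auto simp: indicator_def)
        also have "\<dots> = real (card ({..n} \<inter> {i. parent_code i r = j}))"
          by (simp add: sum.If_cases)
        also have "{..n} \<inter> {i. parent_code i r = j} = {i. nat \<lfloor>real i * r\<rfloor> = j}"
          using sub by (auto simp: parent_code_def)
        finally show ?thesis using True by simp
      qed (simp add: indicator_def)
    qed
    finally show "(\<Sum>i\<le>n. measure D (?E i j)) = mean_kids t j" .
  qed
  finally show ?thesis .
qed

lemma dep_kid: "dep code {i} (\<lambda>x. i \<in> kids ty t A x)"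
  by (rule depI) (auto simp: kids_def parent_eq_parent_code code_def)

text \<open>Given \<open>A\<close>, the later nodes choose \<open>A\<close> as parents independently, so the
  number of children of type \<open>t\<close> has variance at most its mean.\<close>

lemma Pr_few_kids:
  assumes \<beta>: "0 < \<beta>" "\<beta> < 1" and t: "t \<in> I" and wt: "w t > 0"
  shows "\<exists>a0. \<forall>A. finite A \<longrightarrow> A \<noteq> {} \<longrightarrow> 0 \<notin> A \<longrightarrow> (\<forall>j\<in>A. a0 \<le> j) \<longrightarrow>
    Pr (\<lambda>x. real (card (kids ty t A x)) < \<beta> * w t * card A) \<le> 8 / ((1 - \<beta>)\<^sup>2 * w t) / card A"
proof -
  \<comment> \<open>\<open>(1 + \<beta>) / 2\<close> lies midway between \<open>\<beta>\<close> and
    1: half of the slack pays for the limit in \<open>j\<close>, the other half is the deviation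
    \<open>d\<close> in Chebyshev's inequality.\<close>
  have "eventually (\<lambda>j. (1 + \<beta>) / 2 * w t < mean_kids t j) sequentially"
  proof (rule order_tendstoD[OF mean_kids_limit[OF t]])
    have "(1 + \<beta>) / 2 * w t < 1 * w t" using \<beta> wt by (intro mult_strict_right_mono) auto
    then show "(1 + \<beta>) / 2 * w t < w t" by simp
  qed
  moreover have "eventually (\<lambda>j. mean_kids t j < 2 * w t) sequentially"
    by (rule order_tendstoD[OF mean_kids_limit[OF t]]) (use wt in auto)
  ultimately have "eventually (\<lambda>j. (1 + \<beta>) / 2 * w t < mean_kids t j \<and> mean_kids t j < 2 * w t) sequentially"
    by (rule eventually_conj)
  then obtain a0 where a0: "\<And>j. j \<ge> a0 \<Longrightarrow> (1 + \<beta>) / 2 * w t < mean_kids t j \<and> mean_kids t j < 2 * w t"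
    unfolding eventually_sequentially by blast
  show ?thesis
  proof (intro exI[of _ a0] allI impI)
    fix A :: "nat set" assume A: "finite A" "A \<noteq> {}" "0 \<notin> A" "\<forall>j\<in>A. a0 \<le> j"
    then have cA: "real (card A) > 0" by (simp add: card_gt_0_iff)
    \<comment> \<open>No child of \<open>A\<close> of type \<open>t\<close> has a label above
      \<open>n\<close>, so finitely many coordinates decide the event.\<close>
    define n where "n = nat \<lceil>(real (Max A) + 1) * exp (s t + \<eta>)\<rceil>"
    have n: "(real j + 1) * exp (s t + \<eta>) \<le> real n" if "j \<in> A" for j
    proof -
      have "(real j + 1) * exp (s t + \<eta>) \<le> (real (Max A) + 1) * exp (s t + \<eta>)"
        using that A by (intro mult_right_mono) auto
      then show ?thesis unfolding n_def by linarith
    qed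
    define S where "S = (\<Sum>i\<le>n. Pr (\<lambda>x. i \<in> kids ty t A x))"
    have S: "S = (\<Sum>j\<in>A. mean_kids t j)"
      unfolding S_def by (rule Pr_kid_sum[OF t A(1,3) n])
    have "(\<Sum>j\<in>A. (1 + \<beta>) / 2 * w t) \<le> S"
      unfolding S using A a0 by (intro sum_mono) (auto intro: less_imp_le)
    then have S1: "(1 + \<beta>) / 2 * w t * card A \<le> S" by (simp add: mult_ac)
    have "S \<le> (\<Sum>j\<in>A. 2 * w t)"
      unfolding S using A a0 by (intro sum_mono) (auto intro: less_imp_le)
    then have S2: "S \<le> 2 * w t * card A" by (simp add: mult_ac)
    have in_n: "i \<le> n" if "i \<in> kids ty t A x" for i x
      using child_bounds(2)[of "x i" i "parent x i"] that n[of "parent x i"] t A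
      by (cases "parent x i = 0") (auto simp: kids_def parent_eq_parent_code)
    define d where "d = (1 - \<beta>) / 2 * w t * card A"
    have d: "d > 0" using \<beta> wt cA by (simp add: d_def)
    have "Pr (\<lambda>x. real (card (kids ty t A x)) < \<beta> * w t * card A)
      = prob {\<omega> \<in> space M. real (card {i\<in>{..n}. \<omega> \<in> {\<omega> \<in> space M. i \<in> kids ty t A (\<lambda>i. Xs i \<omega>)}}) < \<beta> * w t * card A}"
    proof -
      have "kids ty t A x = {i\<in>{..n}. i \<in> kids ty t A x}" for x using in_n by auto
      then show ?thesis unfolding Pr_def by (intro arg_cong[where f=prob]) auto
    qed
    also have "\<dots> \<le> (\<Sum>i\<le>n. prob {\<omega> \<in> space M. i \<in> kids ty t A (\<lambda>i. Xs i \<omega>)}) / d\<^sup>2"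
    proof (rule count_lower_tail)
      show "{\<omega> \<in> space M. i \<in> kids ty t A (\<lambda>i. Xs i \<omega>)} \<in> events" for i
        by (rule dep_measurable[OF code_measurable dep_kid]) simp
      show "prob ({\<omega> \<in> space M. i \<in> kids ty t A (\<lambda>i. Xs i \<omega>)} \<inter> {\<omega> \<in> space M. j \<in> kids ty t A (\<lambda>i. Xs i \<omega>)})
        = prob {\<omega> \<in> space M. i \<in> kids ty t A (\<lambda>i. Xs i \<omega>)} * prob {\<omega> \<in> space M. j \<in> kids ty t A (\<lambda>i. Xs i \<omega>)}"
        if "i \<noteq> j" for i j
      proof -
        have "Pr (\<lambda>x. i \<in> kids ty t A x \<and> j \<in> kids ty t A x) = Pr (\<lambda>x. i \<in> kids ty t A x) * Pr (\<lambda>x. j \<in> kids ty t A x)"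
          by (rule Pr_indep[OF code_measurable dep_kid dep_kid]) (use that in auto)
        moreover have "{\<omega> \<in> space M. i \<in> kids ty t A (\<lambda>i. Xs i \<omega>)} \<inter> {\<omega> \<in> space M. j \<in> kids ty t A (\<lambda>i. Xs i \<omega>)}
          = {\<omega> \<in> space M. i \<in> kids ty t A (\<lambda>i. Xs i \<omega>) \<and> j \<in> kids ty t A (\<lambda>i. Xs i \<omega>)}" by blast
        ultimately show ?thesis by (simp only: Pr_def)
      qed
      have "\<beta> * w t * card A + d = (1 + \<beta>) / 2 * w t * card A"
        by (simp add: d_def field_simps)
      then show "\<beta> * w t * card A + d \<le> (\<Sum>i\<le>n. prob {\<omega> \<in> space M. i \<in> kids ty t A (\<lambda>i. Xs i \<omega>)})"
        using S1 by (simp only: S_def Pr_def)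
    qed (use d in auto)
    also have "(\<Sum>i\<le>n. prob {\<omega> \<in> space M. i \<in> kids ty t A (\<lambda>i. Xs i \<omega>)}) = S"
      by (simp only: S_def Pr_def)
    \<comment> \<open>Mean at most \<open>2 * w t * card A\<close>, deviation
      \<open>(1 - \<beta>) / 2 * w t * card A\<close>: the quotient has the factor
      \<open>2 * 4 = 8\<close>.\<close>
    also have "S / d\<^sup>2 \<le> 2 * w t * card A / d\<^sup>2"
      using S2 by (intro divide_right_mono) auto
    also have "\<dots> = 8 / ((1 - \<beta>)\<^sup>2 * w t) / card A"
    proof -
      have "2 * u * c / (v / 2 * u * c)\<^sup>2 = 8 / (v\<^sup>2 * u) / c" if "u > 0" "c > 0" "v > 0" for u c v :: real
        using that by (simp add: power2_eq_square field_simps)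
      then show ?thesis using \<beta> wt cA by (simp add: d_def)
    qed
    finally show "Pr (\<lambda>x. real (card (kids ty t A x)) < \<beta> * w t * card A) \<le> 8 / ((1 - \<beta>)\<^sup>2 * w t) / card A" .
  qed
qed

end

section \<open>Descendants along a sequence of types\<close>

text \<open>Half-open, so that windows with a common end point are disjoint: coordinates read by
  successive generations then do not overlap.\<close>

definition window :: "real \<Rightarrow> real \<Rightarrow> nat set" where
  "window a a' = {i. a < real i \<and> real i \<le> a'}"

lemma finite_window [simp]: "finite (window a a')"
proof (rule finite_subset)
  show "window a a' \<subseteq> {..nat \<lfloor>a'\<rfloor>}"
    by (auto simp: window_def le_nat_floor)
qed simp

lemma window_mono: "c \<le> a \<Longrightarrow> a' \<le> c' \<Longrightarrow> window a a' \<subseteq> window c c'"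
  by (auto simp: window_def)

lemma window_disjoint: "a' \<le> c \<Longrightarrow> window a a' \<inter> window c c' = {}"
  by (auto simp: window_def)

primrec desc :: "(real \<Rightarrow> nat) \<Rightarrow> nat list \<Rightarrow> nat set \<Rightarrow> (nat \<Rightarrow> real) \<Rightarrow> nat set" where
  "desc ty [] A x = A"
| "desc ty (t # \<tau>) A x = desc ty \<tau> (kids ty t A x) x"

lemma desc_snoc: "desc ty (\<tau> @ [t]) A x = kids ty t (desc ty \<tau> A x) x"
  by (induction \<tau> arbitrary: A) auto

text \<open>A node determines its ancestral line and the types along it. Hence different type
  sequences of equal length have disjoint descendants, whose numbers add up.\<close>

lemma desc_types_unique:
  "i \<in> desc ty \<tau> A x \<Longrightarrow> i \<in> desc ty \<tau>' A x \<Longrightarrow> length \<tau> = length \<tau>' \<Longrightarrow> \<tau> = \<tau>'"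
proof (induction \<tau> arbitrary: \<tau>' i rule: rev_induct)
  case (snoc t \<tau>)
  from snoc.prems(3) obtain \<sigma> t' where \<tau>': "\<tau>' = \<sigma> @ [t']" "length \<sigma> = length \<tau>"
    by (cases \<tau>' rule: rev_cases) auto
  then show ?case
    using snoc.prems snoc.IH[of "parent x i" \<sigma>] by (auto simp: desc_snoc kids_def)
qed simp

lemma desc_ancestor: "i \<in> desc ty \<tau> A x \<Longrightarrow> ancestor x i (length \<tau>) \<in> A"
proof (induction \<tau> arbitrary: i rule: rev_induct)
  case (snoc t \<tau>)
  then show ?case
    by (auto simp: desc_snoc kids_def ancestor_Suc_parent simp del: ancestor.simps(2))
qed simp

context typed_attachment
begin

text \<open>If \<open>large a\<close> and \<open>j \<ge> a\<close>, then \<open>j + 1 \<le> j * exp \<eta>\<close>, so the rounding in \<open>parent\<close> costs at most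
  another \<open>\<eta>\<close>.\<close>

definition large :: "real \<Rightarrow> bool" where
  "large a \<longleftrightarrow> 1 \<le> a * (exp \<eta> - 1)"

lemma large_pos: "large a \<Longrightarrow> 0 < a"
proof -
  assume "large a"
  then have "0 < a * (exp \<eta> - 1)" unfolding large_def by linarith
  moreover have "0 < exp \<eta> - 1" using \<eta> by simp
  ultimately show "0 < a" by (rule zero_less_mult_pos2[rotated, rotated])
qed

lemma large_mono: "large a \<Longrightarrow> a \<le> a' \<Longrightarrow> large a'"
proof -
  assume "large a" "a \<le> a'"
  moreover have "a * (exp \<eta> - 1) \<le> a' * (exp \<eta> - 1)"
    using \<open>a \<le> a'\<close> \<eta> by (intro mult_right_mono) auto
  ultimately show "large a'" by (simp add: large_def)
qed

lemma large_mult_exp: "large a \<Longrightarrow> v \<ge> 0 \<Longrightarrow> large (a * exp v)"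
  using large_mono[of a "a * exp v"] large_pos[of a] by simp

lemma kids_window:
  assumes t: "t \<in> I" and A: "A \<subseteq> window a a'" and a: "large a"
  shows "kids ty t A x \<subseteq> window (a * exp (s t)) (a' * exp (s t + 2 * \<eta>))"
proof
  fix i assume i: "i \<in> kids ty t A x"
  define j where "j = parent x i"
  have j: "a < real j" "real j \<le> a'" and jpos: "j > 0"
    using i A large_pos[OF a] by (auto simp: kids_def j_def window_def)
  have cb: "real j * exp (s t) \<le> real i" "real i < (real j + 1) * exp (s t + \<eta>)"
    using child_bounds[of "x i" i j] i t jpos by (auto simp: kids_def j_def parent_eq_parent_code)
  have "a * exp (s t) < real j * exp (s t)" using j by simp
  then have 1: "a * exp (s t) < real i" using cb by linarith
  have "1 \<le> a * (exp \<eta> - 1)" using a by (simp add: large_def)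
  also have "\<dots> \<le> a' * (exp \<eta> - 1)" using j \<eta> by (intro mult_right_mono) auto
  finally have "a' + 1 \<le> a' * exp \<eta>" by (simp add: algebra_simps)
  then have "real j + 1 \<le> a' * exp \<eta>" using j by linarith
  then have "(real j + 1) * exp (s t + \<eta>) \<le> a' * exp \<eta> * exp (s t + \<eta>)"
    by (intro mult_right_mono) auto
  also have "\<dots> = a' * exp (s t + 2 * \<eta>)" by (simp add: mult.assoc flip: exp_add)
  finally show "i \<in> window (a * exp (s t)) (a' * exp (s t + 2 * \<eta>))"
    using 1 cb by (auto simp: window_def)
qed

lemma desc_window:
  assumes "set \<tau> \<subseteq> I" "A \<subseteq> window a a'" "large a"
  shows "desc ty \<tau> A x \<subseteq> window (a * exp (sum_list (map s \<tau>)))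
    (a' * exp (sum_list (map s \<tau>) + 2 * \<eta> * length \<tau>))"
  using assms
proof (induction \<tau> arbitrary: A a a')
  case (Cons t \<tau>)
  have st: "0 \<le> s t" using b(2)[of t] b(1) Cons.prems by auto
  have "desc ty \<tau> (kids ty t A x) x \<subseteq> window (a * exp (s t) * exp (sum_list (map s \<tau>)))
    (a' * exp (s t + 2 * \<eta>) * exp (sum_list (map s \<tau>) + 2 * \<eta> * length \<tau>))"
    using Cons.prems st by (intro Cons.IH kids_window large_mult_exp) auto
  then show ?case
    by (simp add: mult.assoc algebra_simps flip: exp_add)
qed simp

text \<open>The separation hypothesis reserves a log-width of \<open>2 * \<eta>\<close> for each
  remaining type. A generation of type \<open>t\<close> shifts both ends by \<open>s t\<close> and
  uses up one share.\<close>

lemma separated_step: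
  assumes "a' * exp (2 * \<eta> * length (t # \<tau>)) \<le> a * exp b" "t \<in> I"
  shows "a' * exp (s t + 2 * \<eta>) * exp (2 * \<eta> * length \<tau>) \<le> a * exp (s t) * exp b"
proof -
  have "a' * exp (2 * \<eta> * length (t # \<tau>)) * exp (s t) \<le> a * exp b * exp (s t)"
    using assms(1) by (intro mult_right_mono) auto
  then show ?thesis by (simp add: mult.assoc algebra_simps flip: exp_add)
qed

text \<open>A type moves labels by at least \<open>b\<close>, which is no less than the log-width of
  the window of the parents; so the children lie above all of them.\<close>

lemma separated:
  assumes "a' * exp (2 * \<eta> * real n) \<le> a * exp b" "large a" "t \<in> I"
  shows "a' \<le> a * exp (s t)"
proof (cases "a' \<ge> 0")
  case True
  have "a' * 1 \<le> a' * exp (2 * \<eta> * real n)"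
    using \<eta> True by (intro mult_left_mono) auto
  also have "\<dots> \<le> a * exp b" by fact
  also have "\<dots> \<le> a * exp (s t)"
    using b(2)[OF assms(3)] large_pos[OF assms(2)] by (intro mult_left_mono) auto
  finally show ?thesis by simp
next
  case False
  moreover have "0 \<le> a * exp (s t)" using large_pos[OF assms(2)] by simp
  ultimately show ?thesis by linarith
qed

text \<open>A child lies above \<open>a'\<close>, where the codes of \<open>x\<close> and
  \<open>x'\<close> agree, and its parent is smaller than itself, so that only the parts of
  \<open>A\<close> and \<open>A'\<close> up to \<open>n\<close> matter.\<close>

lemma kids_cong:
  assumes x: "unit_seq x" "unit_seq x'" and c: "\<And>i. i \<in> window a' (real n) \<Longrightarrow> code i (x i) = code i (x' i)"
    and t: "t \<in> I" and A: "A \<subseteq> window a a'" "large a" "a' \<le> a * exp (s t)"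
    and AA': "A \<inter> {..n} = A' \<inter> {..n}"
    and i: "i \<in> kids ty t A x" "i \<le> n"
  shows "i \<in> kids ty t A' x'"
proof -
  have "i \<in> window (a * exp (s t)) (a' * exp (s t + 2 * \<eta>))"
    using kids_window[OF t A(1,2)] i by blast
  then have i_gt: "a' < real i" using A by (auto simp: window_def)
  have eq: "code i (x i) = code i (x' i)" using c i_gt i by (auto simp: window_def)
  have "a < real (parent x i)" using i A by (auto simp: kids_def window_def)
  then have "parent x i \<noteq> 0" using large_pos[OF A(2)] by auto
  then have "i > 0" using parent_0[of x] by (cases "i = 0") auto
  then have "parent x i < i" by (rule parent_less[OF x(1)])
  then have "parent x i \<in> A \<inter> {..n}" using i by (simp add: kids_def)
  then have "parent x i \<in> A'" unfolding AA' by simp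
  moreover have "parent x' i = parent x i" "ty (x' i) = ty (x i)"
    using eq by (simp_all add: parent_eq_parent_code code_def)
  ultimately show ?thesis using i by (simp add: kids_def)
qed

lemma desc_cong:
  assumes "unit_seq x" "unit_seq x'" "set \<tau> \<subseteq> I" "large a"
    and "A \<subseteq> window a a'" "A' \<subseteq> window a a'" "A \<inter> {..n} = A' \<inter> {..n}"
    and "a' * exp (2 * \<eta> * length \<tau>) \<le> a * exp b"
    and "\<And>i. i \<in> window a' (real n) \<Longrightarrow> code i (x i) = code i (x' i)"
  shows "desc ty \<tau> A x \<inter> {..n} = desc ty \<tau> A' x' \<inter> {..n}"
  using assms
proof (induction \<tau> arbitrary: A A' a a')
  case (Cons t \<tau>)
  have t: "t \<in> I" using Cons.prems by simp
  then have st: "0 \<le> s t" using b(2)[of t] b(1) by auto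
  have sep: "a' \<le> a * exp (s t)"
    using separated[OF Cons.prems(8) Cons.prems(4) t] .
  have K: "kids ty t A x \<inter> {..n} = kids ty t A' x' \<inter> {..n}"
  proof safe
    fix i assume i: "i \<in> kids ty t A x" "i \<le> n"
    show "i \<in> kids ty t A' x'"
      by (rule kids_cong[OF Cons.prems(1,2) _ t Cons.prems(5,4) sep Cons.prems(7) i]) (rule Cons.prems(9))
  next
    fix i assume i: "i \<in> kids ty t A' x'" "i \<le> n"
    show "i \<in> kids ty t A x"
      by (rule kids_cong[OF Cons.prems(2,1) _ t Cons.prems(6,4) sep Cons.prems(7)[symmetric] i])
        (rule Cons.prems(9)[symmetric])
  qed
  have L: "large (a * exp (s t))" using Cons.prems(4) st by (rule large_mult_exp)
  have kw: "kids ty t A x \<subseteq> window (a * exp (s t)) (a' * exp (s t + 2 * \<eta>))"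
    "kids ty t A' x' \<subseteq> window (a * exp (s t)) (a' * exp (s t + 2 * \<eta>))"
    using kids_window[OF t Cons.prems(5,4)] kids_window[OF t Cons.prems(6,4)] by auto
  have sep1: "a' * exp (s t + 2 * \<eta>) * exp (2 * \<eta> * length \<tau>) \<le> a * exp (s t) * exp b"
    by (rule separated_step[OF Cons.prems(8) t])
  have c: "code i (x i) = code i (x' i)" if i: "i \<in> window (a' * exp (s t + 2 * \<eta>)) (real n)" for i
  proof -
    have "a' \<le> a' * exp (s t + 2 * \<eta>) \<or> a' < 0"
      using st \<eta> by (simp add: mult_le_cancel_left1)
    then have "i \<in> window a' (real n)" using i by (auto simp: window_def)
    then show ?thesis by (rule Cons.prems(9))
  qed
  have \<tau>: "set \<tau> \<subseteq> I" using Cons.prems(3) by simp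
  have "desc ty \<tau> (kids ty t A x) x \<inter> {..n} = desc ty \<tau> (kids ty t A' x') x' \<inter> {..n}"
    by (rule Cons.IH[OF Cons.prems(1,2) \<tau> L kw K sep1]) (rule c)
  then show ?case by simp
qed simp

text \<open>This is the Markov property of the construction: the descendants of a fixed set read
  only coordinates above its window, whereas a random set in that window is found from coordinates
  up to its upper end.\<close>

lemma dep_desc:
  assumes "set \<tau> \<subseteq> I" "large a" "A \<subseteq> window a a'" "a' * exp (2 * \<eta> * length \<tau>) \<le> a * exp b"
  shows "dep code (window a' c) (\<lambda>x. desc ty \<tau> A x \<inter> window c' c)"
proof (rule depI)
  fix x x' assume x: "unit_seq x" "unit_seq x'" and c: "\<And>i. i \<in> window a' c \<Longrightarrow> code i (x i) = code i (x' i)"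
  show "desc ty \<tau> A x \<inter> window c' c = desc ty \<tau> A x' \<inter> window c' c"
  proof (cases "c \<ge> 0")
    case True
    have "desc ty \<tau> A x \<inter> {..nat \<lfloor>c\<rfloor>} = desc ty \<tau> A x' \<inter> {..nat \<lfloor>c\<rfloor>}"
    proof (rule desc_cong[OF x assms(1,2,3,3) refl assms(4)])
      fix i assume "i \<in> window a' (real (nat \<lfloor>c\<rfloor>))"
      then show "code i (x i) = code i (x' i)"
        using True of_int_floor_le[of c] by (intro c) (auto simp: window_def simp del: of_int_floor_le)
    qed
    moreover have "window c' c \<subseteq> {..nat \<lfloor>c\<rfloor>}" by (auto simp: window_def le_nat_floor)
    ultimately show ?thesis by blast
  next
    case False
    then have "window c' c = {}" by (auto simp: window_def)
    then show ?thesis by simp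
  qed
qed

lemma dep_desc':
  assumes "set \<tau> \<subseteq> I" "large a" "A \<subseteq> window a a'" "a' * exp (2 * \<eta> * length \<tau>) \<le> a * exp b"
    and c: "a' * exp (sum_list (map s \<tau>) + 2 * \<eta> * length \<tau>) \<le> c"
  shows "dep code (window a' c) (desc ty \<tau> A)"
proof -
  have "desc ty \<tau> A x \<inter> window 0 c = desc ty \<tau> A x" for x
  proof -
    have "0 \<le> a * exp (sum_list (map s \<tau>))" using large_pos[OF assms(2)] by simp
    then have "window (a * exp (sum_list (map s \<tau>))) (a' * exp (sum_list (map s \<tau>) + 2 * \<eta> * length \<tau>)) \<subseteq> window 0 c"
      using c by (intro window_mono)
    then show ?thesis using desc_window[OF assms(1,3,2), of x] by blast
  qed
  then show ?thesis using dep_desc[OF assms(1-4), of c 0] by simp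
qed

lemma sum_list_s_nonneg: "set \<tau> \<subseteq> I \<Longrightarrow> real (length \<tau>) * b \<le> sum_list (map s \<tau>)"
proof (induction \<tau>)
  case (Cons t \<tau>)
  then show ?case using b(2)[of t] by (simp add: algebra_simps)
qed simp

lemma Pr_False: "Pr (\<lambda>_. False) = 0"
  by (simp add: Pr_def)

text \<open>Induction along the sequence. The first generation fails with probability at most
  \<open>\<kappa> / card A\<close>; otherwise it has at least \<open>v * card A\<close> members, and
  the remaining generations fail with probability at most \<open>C / (v * card A)\<close>. So the
  constant grows to \<open>\<kappa> + C / v\<close>, whatever the size of \<open>A\<close>.\<close>

lemma Pr_few_desc:
  assumes \<beta>: "0 < \<beta>" "\<beta> < 1" and \<tau>: "set \<tau> \<subseteq> {t \<in> I. w t > 0}"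
  shows "\<exists>C\<ge>0. \<exists>a0. large a0 \<and> (\<forall>A a a'. A \<subseteq> window a a' \<longrightarrow> A \<noteq> {} \<longrightarrow> a0 \<le> a \<longrightarrow>
    a' * exp (2 * \<eta> * length \<tau>) \<le> a * exp b \<longrightarrow>
    Pr (\<lambda>x. real (card (desc ty \<tau> A x)) < card A * prod_list (map (\<lambda>t. \<beta> * w t) \<tau>)) \<le> C / card A)"
  using \<tau>
proof (induction \<tau>)
  case Nil
  have "large (1 / (exp \<eta> - 1))" using \<eta> by (simp add: large_def)
  then show ?case
    by (rule_tac exI[of _ "0::real"], intro conjI order_refl, rule_tac exI[of _ "1 / (exp \<eta> - 1)"]) (auto simp: Pr_False)
next
  case (Cons t \<tau>)
  have t: "t \<in> I" "w t > 0" and \<tau>: "set \<tau> \<subseteq> I" using Cons.prems by auto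
  define v where "v = \<beta> * w t"
  define q where "q = prod_list (map (\<lambda>t. \<beta> * w t) \<tau>)"
  have v: "v > 0" using \<beta> t by (simp add: v_def)
  have q: "q \<ge> 0" unfolding q_def using \<beta> Cons.prems by (intro prod_list_nonneg) (auto intro: less_imp_le)
  from Cons obtain C a0 where C: "C \<ge> 0" "large a0" and IH: "\<And>A a a'. A \<subseteq> window a a' \<Longrightarrow> A \<noteq> {} \<Longrightarrow> a0 \<le> a \<Longrightarrow>
    a' * exp (2 * \<eta> * length \<tau>) \<le> a * exp b \<Longrightarrow>
    Pr (\<lambda>x. real (card (desc ty \<tau> A x)) < card A * q) \<le> C / card A"
    unfolding q_def by auto
  define \<kappa> where "\<kappa> = 8 / ((1 - \<beta>)\<^sup>2 * w t)"
  obtain a1 where a1: "\<And>A. finite A \<Longrightarrow> A \<noteq> {} \<Longrightarrow> 0 \<notin> A \<Longrightarrow> (\<forall>j\<in>A. a1 \<le> j) \<Longrightarrow>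
    Pr (\<lambda>x. real (card (kids ty t A x)) < v * card A) \<le> \<kappa> / card A"
    using Pr_few_kids[OF \<beta> t] unfolding v_def \<kappa>_def by blast
  have C': "0 \<le> \<kappa> + C / v" using C v t by (simp add: \<kappa>_def)
  have large': "large (max a0 (real a1))" by (rule large_mono[OF C(2)]) simp
  show ?case
  proof (rule exI, rule conjI[OF C'], rule exI, rule conjI[OF large'], intro allI impI)
    fix A :: "nat set" and a a' :: real
    assume A: "A \<subseteq> window a a'" "A \<noteq> {}" and a: "max a0 (real a1) \<le> a"
      and sep: "a' * exp (2 * \<eta> * length (t # \<tau>)) \<le> a * exp b"
    have La: "large a" using large_mono[OF C(2)] a by simp
    have st: "0 \<le> s t" using b(2)[OF t(1)] b(1) by linarith
    have fin: "finite A" by (rule finite_subset[OF A(1)]) simp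
    then have cA: "real (card A) > 0" using A by (simp add: card_gt_0_iff)
    define a2 where "a2 = a * exp (s t)"
    define n1 where "n1 = a' * exp (s t + 2 * \<eta>)"
    define top where "top = a' * exp (sum_list (map s (t # \<tau>)) + 2 * \<eta> * length (t # \<tau>))"
    have La2: "large a2" unfolding a2_def by (rule large_mult_exp[OF La st])
    have a2: "a \<le> a2" unfolding a2_def using st large_pos[OF La] by simp
    have sum0: "0 \<le> sum_list (map s \<tau>)"
      using sum_list_s_nonneg[OF \<tau>] b(1) by (meson mult_nonneg_nonneg of_nat_0_le_iff less_imp_le order_trans)
    have a'pos: "a' > 0"
    proof -
      from A obtain j where "j \<in> window a a'" by blast
      then show ?thesis using large_pos[OF La] by (auto simp: window_def)
    qed
    have a'n1: "a' \<le> n1" unfolding n1_def using st \<eta> a'pos by simp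
    have top_eq: "top = n1 * exp (sum_list (map s \<tau>) + 2 * \<eta> * length \<tau>)"
      unfolding top_def n1_def by (simp add: mult.assoc algebra_simps flip: exp_add)
    have n1top: "n1 \<le> top"
      unfolding top_eq using sum0 \<eta> a'pos a'n1 by (simp add: mult_le_cancel_left1)
    have kw: "kids ty t A x \<subseteq> window a2 n1" for x
      unfolding a2_def n1_def by (rule kids_window[OF t(1) A(1) La])
    have sep1: "n1 * exp (2 * \<eta> * length \<tau>) \<le> a2 * exp b"
      unfolding n1_def a2_def by (rule separated_step[OF sep t(1)])
    have depK: "dep code (window a' n1) (kids ty t A)"
    proof -
      have "dep code (window a' n1) (desc ty [t] A)"
      proof (rule dep_desc'[OF _ La A(1)])
        have "a' * exp (2 * \<eta> * real (length [t])) \<le> a' * exp (2 * \<eta> * length (t # \<tau>))"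
          using \<eta> a'pos by (intro mult_left_mono) auto
        then show "a' * exp (2 * \<eta> * real (length [t])) \<le> a * exp b" using sep by linarith
      qed (use t in \<open>auto simp: n1_def\<close>)
      moreover have "desc ty [t] A = kids ty t A" by (rule ext) simp
      ultimately show ?thesis by simp
    qed
    have depD: "dep code (window a' top) (desc ty (t # \<tau>) A)"
      by (rule dep_desc'[OF _ La A(1) sep]) (use t \<tau> in \<open>auto simp: top_def\<close>)
    have depK': "dep code (window a' top) (kids ty t A)"
      by (rule dep_mono[OF depK window_mono]) (use n1top in auto)
    let ?F = "\<lambda>x. real (card (kids ty t A x)) < v * card A"
    let ?F' = "\<lambda>x. v * card A \<le> real (card (kids ty t A x)) \<and> real (card (desc ty (t # \<tau>) A x)) < real (card (kids ty t A x)) * q"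
    have "Pr (\<lambda>x. real (card (desc ty (t # \<tau>) A x)) < card A * prod_list (map (\<lambda>t. \<beta> * w t) (t # \<tau>))) \<le> Pr ?F + Pr ?F'"
    proof (rule Pr_Un[OF code_measurable, where J="window a' top"])
      show "dep code (window a' top) ?F"
        by (rule dep_comp[OF depK', where g="\<lambda>K. real (card K) < v * card A"])
      show "dep code (window a' top) ?F'"
        by (rule dep_comp2[OF depK' depD, where g="\<lambda>K L. v * card A \<le> real (card K) \<and> real (card L) < real (card K) * q"])
      fix x assume less: "real (card (desc ty (t # \<tau>) A x)) < card A * prod_list (map (\<lambda>t. \<beta> * w t) (t # \<tau>))"
      show "?F x \<or> ?F' x"
      proof (cases "?F x")
        case False
        have "card A * prod_list (map (\<lambda>t. \<beta> * w t) (t # \<tau>)) = v * card A * q"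
          by (simp add: v_def q_def)
        also have "\<dots> \<le> real (card (kids ty t A x)) * q"
          using False q by (intro mult_right_mono) auto
        finally show ?thesis using less False by auto
      qed simp
    qed simp
    also have "Pr ?F \<le> \<kappa> / card A"
    proof (rule a1)
      show "0 \<notin> A" using A(1) large_pos[OF La] by (auto simp: window_def)
      show "\<forall>j\<in>A. a1 \<le> j" using A(1) a by (auto simp: window_def)
    qed (use fin A in auto)
    \<comment> \<open>Freeze the first generation at a value \<open>S\<close>: it is decided by
      coordinates up to \<open>n1\<close>, its further descendants by those above
      \<open>n1\<close>.\<close>
    also have "Pr ?F' \<le> C / (v * card A)"
    proof (rule Pr_cond[OF code_measurable, where G="kids ty t A" and Ja="window a' n1" and Jb="window n1 top"
        and S="{S. S \<subseteq> window a2 n1 \<and> v * card A \<le> real (card S)}"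
        and Q="\<lambda>S x. real (card (desc ty \<tau> S x)) < real (card S) * q"])
      show "dep code (window a' n1) (kids ty t A)" by (rule depK)
      show "window a' n1 \<inter> window n1 top = {}" by (rule window_disjoint) simp
      show "finite {S. S \<subseteq> window a2 n1 \<and> v * card A \<le> real (card S)}"
        by (rule finite_subset[of _ "Pow (window a2 n1)"]) auto
      show "0 \<le> C / (v * card A)" using C v by simp
      fix S assume S: "S \<in> {S. S \<subseteq> window a2 n1 \<and> v * card A \<le> real (card S)}"
      have "dep code (window n1 top) (desc ty \<tau> S)"
        by (rule dep_desc'[OF \<tau> La2 _ sep1]) (use S in \<open>auto simp: top_eq\<close>)
      then show "dep code (window n1 top) (\<lambda>x. real (card (desc ty \<tau> S x)) < real (card S) * q)"
        by (rule dep_comp[where g="\<lambda>L. real (card L) < real (card S) * q"])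
      have vc: "0 < v * card A" using v cA by simp
      have "S \<noteq> {}" using S vc by auto
      then have "Pr (\<lambda>x. real (card (desc ty \<tau> S x)) < real (card S) * q) \<le> C / card S"
        using S sep1 a a2 by (intro IH) auto
      also have "\<dots> \<le> C / (v * card A)"
        using S C vc by (intro divide_left_mono) auto
      finally show "Pr (\<lambda>x. real (card (desc ty \<tau> S x)) < real (card S) * q) \<le> C / (v * card A)" .
    next
      fix x assume "?F' x"
      then show "kids ty t A x \<in> {S. S \<subseteq> window a2 n1 \<and> v * card A \<le> real (card S)} \<and>
        real (card (desc ty \<tau> (kids ty t A x) x)) < real (card (kids ty t A x)) * q"
        using kw[of x] by auto
    qed simp_all
    finally show "Pr (\<lambda>x. real (card (desc ty (t # \<tau>) A x)) < card A * prod_list (map (\<lambda>t. \<beta> * w t) (t # \<tau>)))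
      \<le> (\<kappa> + C / v) / card A"
      by (simp add: add_divide_distrib)
  qed
qed

end

section \<open>Blocks of generations\<close>

lemma window_pigeonhole:
  fixes U :: "nat set" and c R :: nat
  assumes R: "R > 0" and U: "U \<subseteq> window r (r * exp (\<delta> * real R))" and r: "r > 0" and \<delta>: "\<delta> > 0"
    and card: "R * c \<le> card U"
  shows "\<exists>l<R. c \<le> card (U \<inter> window (r * exp (\<delta> * real l)) (r * exp (\<delta> * real (Suc l))))"
proof (rule ccontr)
  let ?W = "\<lambda>l. window (r * exp (\<delta> * real l)) (r * exp (\<delta> * real (Suc l)))"
  assume "\<not> ?thesis"
  then have less: "card (U \<inter> ?W l) < c" if "l < R" for l using that by (auto simp: not_le)
  have "U \<subseteq> (\<Union>l<R. U \<inter> ?W l)"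
  proof
    fix i assume i: "i \<in> U"
    then have i1: "r < real i" "real i \<le> r * exp (\<delta> * real R)" using U by (auto simp: window_def)
    \<comment> \<open>The first slot boundary at or above \<open>i\<close>. It is not boundary 0
      because \<open>i\<close> exceeds \<open>r\<close>, so \<open>i\<close> lies in the slot just
      below it, with index \<open>l - 1\<close>.\<close>
    define l where "l = (LEAST l. real i \<le> r * exp (\<delta> * real l))"
    have l: "real i \<le> r * exp (\<delta> * real l)" unfolding l_def by (rule LeastI[of _ R]) (rule i1)
    have "l \<le> R" unfolding l_def by (rule Least_le) (rule i1)
    have "l \<noteq> 0" using l i1 by (cases "l = 0") auto
    then obtain k where k: "l = Suc k" by (cases l) auto
    have "\<not> real i \<le> r * exp (\<delta> * real k)" using not_less_Least[of k "\<lambda>l. real i \<le> r * exp (\<delta> * real l)"] k unfolding l_def by simp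
    then have "i \<in> ?W k" using l k by (auto simp: window_def)
    then show "i \<in> (\<Union>l<R. U \<inter> ?W l)" using i k \<open>l \<le> R\<close> by auto
  qed
  then have "card U \<le> card (\<Union>l<R. U \<inter> ?W l)" by (intro card_mono) auto
  also have "\<dots> \<le> (\<Sum>l<R. card (U \<inter> ?W l))" by (intro card_UN_le) simp
  also have "\<dots> < (\<Sum>l<R. c)" using less R by (intro sum_strict_mono) auto
  also have "\<dots> = R * c" by simp
  finally show False using card by simp
qed

text \<open>A block consists of \<open>k\<close> generations. The condition
  \<open>2 * \<eta> * k + \<delta> \<le> b\<close> keeps the generations of a set of log-width
  \<open>\<delta>\<close> apart throughout the block; \<open>T_sum\<close> confines the outcome to
  \<open>R\<close> slots of width \<open>\<delta>\<close>; and of the growth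
  \<open>2 * R\<^sup>2\<close> one factor \<open>R\<close> is lost to the pigeonhole principle,
  leaving \<open>2 * R\<close>.\<close>

locale block_attachment = typed_attachment +
  fixes T :: "nat list set" and k R :: nat and \<delta> \<beta> :: real
  assumes T: "finite T" "\<And>\<tau>. \<tau> \<in> T \<Longrightarrow> length \<tau> = k \<and> set \<tau> \<subseteq> {t \<in> I. w t > 0}"
    and k: "k > 0" and R: "R > 0" and \<delta>: "\<delta> > 0" "2 * \<eta> * real k + \<delta> \<le> b"
    and \<beta>: "0 < \<beta>" "\<beta> < 1"
    and T_sum: "\<And>\<tau>. \<tau> \<in> T \<Longrightarrow> sum_list (map s \<tau>) + 2 * \<eta> * real k \<le> \<delta> * real R"
    and growth: "2 * (real R)\<^sup>2 \<le> (\<Sum>\<tau>\<in>T. prod_list (map (\<lambda>t. \<beta> * w t) \<tau>))"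
begin

definition offspring :: "nat set \<Rightarrow> (nat \<Rightarrow> real) \<Rightarrow> nat set" where
  "offspring A x = (\<Union>\<tau>\<in>T. desc ty \<tau> A x)"

definition slot :: "real \<Rightarrow> nat \<Rightarrow> nat set" where
  "slot r l = window (r * exp (\<delta> * real l)) (r * exp (\<delta> * real (Suc l)))"

text \<open>The growth factor \<open>2 * R\<close> pays for a union bound over the \<open>R\<close> slots: the chance to fail after
  the first block is at most half the bound for \<open>A\<close>.\<close>

primrec thrive :: "nat \<Rightarrow> nat set \<Rightarrow> real \<Rightarrow> (nat \<Rightarrow> real) \<Rightarrow> bool" where
  "thrive 0 A r x \<longleftrightarrow> True"
| "thrive (Suc m) A r x \<longleftrightarrow> (\<exists>l<R. 2 * R * card A \<le> card (offspring A x \<inter> slot r l) \<and>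
    thrive m (offspring A x \<inter> slot r l) (r * exp (\<delta> * real (Suc l))) x)"

text \<open>The state in which every block starts: a set in one slot of log-width
  \<open>\<delta>\<close>, far enough out for the rounding estimates. \<open>slot_fits\<close>
  reproduces it for the next block.\<close>

definition fits :: "nat set \<Rightarrow> real \<Rightarrow> bool" where
  "fits A r \<longleftrightarrow> A \<subseteq> window (r * exp (- \<delta>)) r \<and> large (r * exp (- \<delta>))"

lemma fits_pos: "fits A r \<Longrightarrow> 0 < r"
  using large_pos[of "r * exp (- \<delta>)"] by (simp add: fits_def zero_less_mult_iff)

lemma fits_finite: "fits A r \<Longrightarrow> finite A"
  unfolding fits_def by (rule finite_subset[OF _ finite_window]) (rule conjunct1)

lemma fits_separated: "fits A r \<Longrightarrow> r * exp (2 * \<eta> * real k) \<le> r * exp (- \<delta>) * exp b"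
proof -
  assume "fits A r"
  then have "r * exp (2 * \<eta> * real k) \<le> r * exp (- \<delta> + b)"
    using fits_pos[of A r] \<delta> by simp
  then show ?thesis by (simp only: mult.assoc exp_add)
qed

lemma slot_fits:
  assumes "fits A r" "S \<subseteq> slot r l"
  shows "fits S (r * exp (\<delta> * real (Suc l)))"
proof -
  have "\<delta> * real (Suc l) + - \<delta> = \<delta> * real l" by (simp add: distrib_left)
  then have eq: "r * exp (\<delta> * real (Suc l)) * exp (- \<delta>) = r * exp (\<delta> * real l)"
    by (simp only: mult.assoc exp_add[symmetric])
  have "0 \<le> \<delta> * real l" using \<delta>(1) by simp
  then have "- \<delta> \<le> \<delta> * real l" using \<delta>(1) by linarith
  then have "r * exp (- \<delta>) \<le> r * exp (\<delta> * real l)"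
    using fits_pos[OF assms(1)] by simp
  with assms(1) have "large (r * exp (\<delta> * real l))"
    unfolding fits_def by (elim conjE) (rule large_mono)
  then show ?thesis using assms(2) unfolding fits_def eq slot_def by (intro conjI)
qed

lemma desc_T_window:
  assumes "\<tau> \<in> T" "fits A r"
  shows "desc ty \<tau> A x \<subseteq> window r (r * exp (\<delta> * real R))"
proof -
  have len: "length \<tau> = k" and sub: "set \<tau> \<subseteq> I" using T(2)[OF assms(1)] by auto
  have "desc ty \<tau> A x \<subseteq> window (r * exp (- \<delta>) * exp (sum_list (map s \<tau>)))
    (r * exp (sum_list (map s \<tau>) + 2 * \<eta> * length \<tau>))"
    using assms(2) by (intro desc_window[OF sub]) (auto simp: fits_def)
  also have "\<dots> \<subseteq> window r (r * exp (\<delta> * real R))"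
  proof (rule window_mono)
    \<comment> \<open>The lower edge rises by at least \<open>b * k \<ge> \<delta>\<close> and so
      clears \<open>r\<close>.\<close>
    have "b * 1 \<le> b * real k" using k b(1) by (intro mult_left_mono) auto
    moreover have "0 \<le> 2 * \<eta> * real k" using \<eta> by simp
    moreover have "b * real k \<le> sum_list (map s \<tau>)"
      using sum_list_s_nonneg[OF sub] len by (simp add: mult.commute)
    ultimately have "\<delta> \<le> sum_list (map s \<tau>)"
      using \<delta>(2) by linarith
    then have "r * exp 0 \<le> r * exp (- \<delta> + sum_list (map s \<tau>))"
      using fits_pos[OF assms(2)] by simp
    then show "r \<le> r * exp (- \<delta>) * exp (sum_list (map s \<tau>))"
      by (simp only: exp_add mult.assoc exp_zero mult_1_right)
    show "r * exp (sum_list (map s \<tau>) + 2 * \<eta> * length \<tau>) \<le> r * exp (\<delta> * real R)"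
      using T_sum[OF assms(1)] fits_pos[OF assms(2)] len by simp
  qed
  finally show ?thesis .
qed

lemma slot_le: "r > 0 \<Longrightarrow> l < R \<Longrightarrow> r * exp (\<delta> * real (Suc l)) \<le> r * exp (\<delta> * real R)"
proof -
  assume "r > 0" "l < R"
  then have "\<delta> * real (Suc l) \<le> \<delta> * real R" using \<delta>(1) by (intro mult_left_mono) auto
  then show ?thesis using \<open>r > 0\<close> by simp
qed

lemma dep_offspring:
  assumes "fits A r"
  shows "dep code (window r c) (\<lambda>x. offspring A x \<inter> window c' c)"
proof (rule depI)
  fix x x' assume x: "unit_seq x" "unit_seq x'" and c: "\<And>i. i \<in> window r c \<Longrightarrow> code i (x i) = code i (x' i)"
  have "desc ty \<tau> A x \<inter> window c' c = desc ty \<tau> A x' \<inter> window c' c" if "\<tau> \<in> T" for \<tau>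
  proof (rule depD[OF _ x c])
    show "dep code (window r c) (\<lambda>x. desc ty \<tau> A x \<inter> window c' c)"
    proof (rule dep_desc)
      show "set \<tau> \<subseteq> I" using T(2)[OF that] by auto
      show "large (r * exp (- \<delta>))" "A \<subseteq> window (r * exp (- \<delta>)) r" using assms by (auto simp: fits_def)
      show "r * exp (2 * \<eta> * real (length \<tau>)) \<le> r * exp (- \<delta>) * exp b"
        using fits_separated[OF assms] T(2)[OF that] by simp
    qed
  qed
  then show "offspring A x \<inter> window c' c = offspring A x' \<inter> window c' c"
    unfolding offspring_def by blast
qed

lemma horizon_step:
  assumes "r > 0" "l < R"
  shows "r * exp (\<delta> * real (Suc l)) * exp (\<delta> * real R * real m) \<le> r * exp (\<delta> * real R * real (Suc m))"
proof -
  have "r * exp (\<delta> * real (Suc l)) * exp (\<delta> * real R * real m) \<le> r * exp (\<delta> * real R) * exp (\<delta> * real R * real m)"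
    using slot_le[OF assms] by (intro mult_right_mono) auto
  also have "\<dots> = r * exp (\<delta> * real R * real (Suc m))"
    by (simp add: mult.assoc algebra_simps flip: exp_add)
  finally show ?thesis .
qed

lemma slot_gt: "r > 0 \<Longrightarrow> r \<le> r * exp (\<delta> * real n)"
  using \<delta>(1) by simp

text \<open>The slot of the next block is found from coordinates up to its upper end; with that set
  frozen, the later blocks read coordinates above it. One block moves the end by at most
  \<open>exp (\<delta> * R)\<close>, whence the horizon.\<close>

lemma dep_thrive:
  "fits A r \<Longrightarrow> dep code (window r (r * exp (\<delta> * real R * real m))) (thrive m A r)"
proof (induction m arbitrary: A r)
  case (Suc m)
  show ?case
  proof (rule depI)
    fix x x' assume x: "unit_seq x" "unit_seq x'"
      and c: "\<And>i. i \<in> window r (r * exp (\<delta> * real R * real (Suc m))) \<Longrightarrow> code i (x i) = code i (x' i)"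
    have r: "r > 0" using fits_pos[OF Suc.prems] .
    have step: "offspring A x \<inter> slot r l = offspring A x' \<inter> slot r l \<and>
      thrive m (offspring A x \<inter> slot r l) (r * exp (\<delta> * real (Suc l))) x
      = thrive m (offspring A x \<inter> slot r l) (r * exp (\<delta> * real (Suc l))) x'" if l: "l < R" for l
    proof
      let ?r = "r * exp (\<delta> * real (Suc l))"
      have hor: "?r * exp (\<delta> * real R * real m) \<le> r * exp (\<delta> * real R * real (Suc m))"
        by (rule horizon_step[OF r l])
      have "?r > 0" using r by simp
      then have "?r * 1 \<le> ?r * exp (\<delta> * real R * real m)" using \<delta>(1) by (intro mult_left_mono) auto
      then have r_le: "?r \<le> r * exp (\<delta> * real R * real (Suc m))" using hor by linarith
      show "offspring A x \<inter> slot r l = offspring A x' \<inter> slot r l"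
        unfolding slot_def
      proof (rule depD[OF dep_offspring[OF Suc.prems] x])
        fix i assume "i \<in> window r ?r"
        then show "code i (x i) = code i (x' i)" using r_le by (intro c) (auto simp: window_def)
      qed
      have "fits (offspring A x \<inter> slot r l) ?r" by (rule slot_fits[OF Suc.prems]) simp
      then show "thrive m (offspring A x \<inter> slot r l) ?r x = thrive m (offspring A x \<inter> slot r l) ?r x'"
      proof (rule depD[OF Suc.IH x])
        fix i assume "i \<in> window ?r (?r * exp (\<delta> * real R * real m))"
        then show "code i (x i) = code i (x' i)"
          using hor slot_gt[OF r, of "Suc l"] by (intro c) (auto simp: window_def)
      qed
    qed
    show "thrive (Suc m) A r x = thrive (Suc m) A r x'"
    proof -
      have "(l < R \<and> 2 * R * card A \<le> card (offspring A x \<inter> slot r l) \<and>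
          thrive m (offspring A x \<inter> slot r l) (r * exp (\<delta> * real (Suc l))) x)
        = (l < R \<and> 2 * R * card A \<le> card (offspring A x' \<inter> slot r l) \<and>
          thrive m (offspring A x' \<inter> slot r l) (r * exp (\<delta> * real (Suc l))) x')" for l
      proof (cases "l < R")
        case True
        note e = conjunct1[OF step[OF True]] conjunct2[OF step[OF True]]
        show ?thesis unfolding e(2) unfolding e(1) by (rule refl)
      qed simp
      then show ?thesis by (simp only: thrive.simps)
    qed
  qed
qed (simp add: dep_def)

lemma thrive_mono: "thrive (Suc m) A r x \<Longrightarrow> thrive m A r x"
proof (induction m arbitrary: A r)
  case (Suc m)
  from Suc.prems obtain l where l: "l < R" "2 * R * card A \<le> card (offspring A x \<inter> slot r l)"
    "thrive (Suc m) (offspring A x \<inter> slot r l) (r * exp (\<delta> * real (Suc l))) x"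
    by (subst (asm) thrive.simps(2)) blast
  show ?case
    by (subst thrive.simps(2)) (use l Suc.IH[OF l(3)] in blast)
qed simp

text \<open>All chosen slots are nonempty, so a node of the last one can be traced back block by
  block. Each block buys \<open>k\<close> generations for a log-distance of at most
  \<open>\<delta> * R\<close>, which makes \<open>k / (\<delta> * R)\<close> the rate of the
  height.\<close>

lemma thrive_ancestor:
  assumes "fits A r" "A \<noteq> {}" "thrive m A r x"
  shows "\<exists>i. real i \<le> r * exp (\<delta> * real R * real m) \<and> ancestor x i (k * m) \<in> A"
  using assms
proof (induction m arbitrary: A r)
  case 0
  then obtain i where "i \<in> A" by blast
  moreover have "real i \<le> r" using 0 \<open>i \<in> A\<close> by (auto simp: fits_def window_def)
  ultimately show ?case by (intro exI[of _ i]) simp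
next
  case (Suc m)
  from Suc.prems(3) obtain l where l: "l < R" "2 * R * card A \<le> card (offspring A x \<inter> slot r l)"
    "thrive m (offspring A x \<inter> slot r l) (r * exp (\<delta> * real (Suc l))) x"
    by (subst (asm) thrive.simps(2)) blast
  have "finite A" by (rule fits_finite[OF Suc.prems(1)])
  then have "card A > 0" using Suc.prems(2) by (simp add: card_gt_0_iff)
  then have "0 < 2 * R * card A" using R by simp
  then have ne: "offspring A x \<inter> slot r l \<noteq> {}" using l(2) by auto
  have "fits (offspring A x \<inter> slot r l) (r * exp (\<delta> * real (Suc l)))"
    by (rule slot_fits[OF Suc.prems(1)]) simp
  from Suc.IH[OF this ne l(3)] obtain i where i: "real i \<le> r * exp (\<delta> * real (Suc l)) * exp (\<delta> * real R * real m)"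
    "ancestor x i (k * m) \<in> offspring A x \<inter> slot r l" by (elim exE conjE)
  from i(2) obtain \<tau> where "\<tau> \<in> T" "ancestor x i (k * m) \<in> desc ty \<tau> A x" by (auto simp: offspring_def)
  then have "ancestor x (ancestor x i (k * m)) k \<in> A"
    using desc_ancestor[of "ancestor x i (k * m)" ty \<tau> A x] T(2)[of \<tau>] by simp
  then have "ancestor x i (k * Suc m) \<in> A"
    by (simp add: ancestor_add[symmetric] add.commute)
  moreover have "real i \<le> r * exp (\<delta> * real R * real (Suc m))"
    using i(1) horizon_step[OF fits_pos[OF Suc.prems(1)] l(1), of m] by linarith
  ultimately show ?case by blast
qed

text \<open>The descendants along different sequences are disjoint, so their numbers add up to at
  least \<open>2 * R\<^sup>2 * card A\<close>; some slot among \<open>R\<close> holds an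
  \<open>R\<close>-th part.\<close>

lemma offspring_large:
  assumes "fits A r"
    and good: "\<And>\<tau>. \<tau> \<in> T \<Longrightarrow> card A * prod_list (map (\<lambda>t. \<beta> * w t) \<tau>) \<le> real (card (desc ty \<tau> A x))"
  shows "\<exists>l<R. 2 * R * card A \<le> card (offspring A x \<inter> slot r l)"
proof -
  have fin: "finite (desc ty \<tau> A x)" if "\<tau> \<in> T" for \<tau>
    by (rule finite_subset[OF desc_T_window[OF that assms(1)]]) simp
  have "card (offspring A x) = (\<Sum>\<tau>\<in>T. card (desc ty \<tau> A x))"
    unfolding offspring_def
  proof (rule card_UN_disjoint[OF T(1)])
    show "\<forall>\<tau>\<in>T. finite (desc ty \<tau> A x)" using fin by blast
    show "\<forall>\<tau>\<in>T. \<forall>\<tau>'\<in>T. \<tau> \<noteq> \<tau>' \<longrightarrow> desc ty \<tau> A x \<inter> desc ty \<tau>' A x = {}"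
    proof (intro ballI impI)
      fix \<tau> \<tau>' assume t: "\<tau> \<in> T" "\<tau>' \<in> T" "\<tau> \<noteq> \<tau>'"
      then have "length \<tau> = length \<tau>'" using T(2) by simp
      then show "desc ty \<tau> A x \<inter> desc ty \<tau>' A x = {}"
        using desc_types_unique[of _ ty \<tau> A x \<tau>'] t(3) by blast
    qed
  qed
  then have "real (card (offspring A x)) = (\<Sum>\<tau>\<in>T. real (card (desc ty \<tau> A x)))" by simp
  also have "\<dots> \<ge> (\<Sum>\<tau>\<in>T. card A * prod_list (map (\<lambda>t. \<beta> * w t) \<tau>))"
    by (intro sum_mono good)
  finally have "real (card A) * (\<Sum>\<tau>\<in>T. prod_list (map (\<lambda>t. \<beta> * w t) \<tau>)) \<le> real (card (offspring A x))"
    by (simp add: sum_distrib_left)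
  moreover have "real (card A) * (2 * (real R)\<^sup>2) \<le> real (card A) * (\<Sum>\<tau>\<in>T. prod_list (map (\<lambda>t. \<beta> * w t) \<tau>))"
    using growth by (intro mult_left_mono) auto
  ultimately have "real (R * (2 * R * card A)) \<le> real (card (offspring A x))"
    by (simp add: power2_eq_square mult_ac)
  then have "R * (2 * R * card A) \<le> card (offspring A x)" by (simp only: of_nat_le_iff)
  moreover have "offspring A x \<subseteq> window r (r * exp (\<delta> * real R))"
    unfolding offspring_def using desc_T_window assms(1) by blast
  ultimately show ?thesis
    unfolding slot_def by (intro window_pigeonhole[OF R _ fits_pos[OF assms(1)] \<delta>(1)])
qed

lemma Pr_few_desc_T:
  "\<exists>C\<ge>0. \<exists>a0. large a0 \<and> (\<forall>A r \<tau>. \<tau> \<in> T \<longrightarrow> fits A r \<longrightarrow> A \<noteq> {} \<longrightarrow> a0 \<le> r * exp (- \<delta>) \<longrightarrow>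
    Pr (\<lambda>x. real (card (desc ty \<tau> A x)) < card A * prod_list (map (\<lambda>t. \<beta> * w t) \<tau>)) \<le> C / card A)"
proof -
  define \<Phi> where "\<Phi> \<tau> C a0 \<longleftrightarrow> C \<ge> 0 \<and> large a0 \<and> (\<forall>A a a'. A \<subseteq> window a a' \<longrightarrow> A \<noteq> {} \<longrightarrow> a0 \<le> a \<longrightarrow>
    a' * exp (2 * \<eta> * length \<tau>) \<le> a * exp b \<longrightarrow>
    Pr (\<lambda>x. real (card (desc ty \<tau> A x)) < card A * prod_list (map (\<lambda>t. \<beta> * w t) \<tau>)) \<le> C / card A)" for \<tau> C a0
  have "\<forall>\<tau>\<in>T. \<exists>C a0. \<Phi> \<tau> C a0"
  proof
    fix \<tau> assume "\<tau> \<in> T"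
    then have "set \<tau> \<subseteq> {t \<in> I. w t > 0}" using T(2) by blast
    from Pr_few_desc[OF \<beta> this] show "\<exists>C a0. \<Phi> \<tau> C a0"
      unfolding \<Phi>_def by (elim exE conjE) (intro exI conjI; assumption)
  qed
  then have "\<exists>C a0. \<forall>\<tau>\<in>T. \<Phi> \<tau> (C \<tau>) (a0 \<tau>)" unfolding bchoice_iff .
  then obtain C a0 where \<Phi>T: "\<forall>\<tau>\<in>T. \<Phi> \<tau> (C \<tau>) (a0 \<tau>)" by blast
  note \<Phi> = bspec[OF \<Phi>T]
  have C: "C \<tau> \<ge> 0" if "\<tau> \<in> T" for \<tau>
    using \<Phi>[OF that] unfolding \<Phi>_def by (rule conjunct1)
  have a0: "large (a0 \<tau>)" if "\<tau> \<in> T" for \<tau>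
    using \<Phi>[OF that] unfolding \<Phi>_def by (rule conjunct1[OF conjunct2])
  have P: "Pr (\<lambda>x. real (card (desc ty \<tau> A x)) < card A * prod_list (map (\<lambda>t. \<beta> * w t) \<tau>)) \<le> C \<tau> / card A"
    if "\<tau> \<in> T" "A \<subseteq> window a a'" "A \<noteq> {}" "a0 \<tau> \<le> a" "a' * exp (2 * \<eta> * length \<tau>) \<le> a * exp b" for \<tau> A a a'
    by (rule \<Phi>[OF that(1), unfolded \<Phi>_def, THEN conjunct2, THEN conjunct2, rule_format, OF that(2-5)])
  \<comment> \<open>Over the finite set \<open>T\<close> a sum of positive thresholds exceeds each
    of them; the last term alone is already \<open>large\<close>.\<close>
  define a1 where "a1 = (\<Sum>\<tau>\<in>T. a0 \<tau>) + 1 / (exp \<eta> - 1)"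
  have pos: "0 < a0 \<tau>" if "\<tau> \<in> T" for \<tau> using large_pos[OF a0[OF that]] .
  have e: "0 < exp \<eta> - 1" using \<eta> by simp
  have le: "a0 \<tau> \<le> a1" if "\<tau> \<in> T" for \<tau>
  proof -
    have "a0 \<tau> \<le> (\<Sum>\<tau>\<in>T. a0 \<tau>)" using that T(1) pos by (intro member_le_sum) (auto intro: less_imp_le)
    then show ?thesis using e by (simp add: a1_def add_increasing2)
  qed
  have "large (1 / (exp \<eta> - 1))" using e by (simp add: large_def)
  then have "large a1"
  proof (rule large_mono)
    have "0 \<le> sum a0 T" using pos by (intro sum_nonneg) (auto intro: less_imp_le)
    then show "1 / (exp \<eta> - 1) \<le> a1" by (simp add: a1_def)
  qed
  note large_a1 = this
  have few: "Pr (\<lambda>x. real (card (desc ty \<tau> A x)) < card A * prod_list (map (\<lambda>t. \<beta> * w t) \<tau>)) \<le> (\<Sum>\<tau>\<in>T. C \<tau>) / card A"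
    if \<tau>: "\<tau> \<in> T" and A: "fits A r" "A \<noteq> {}" and r: "a1 \<le> r * exp (- \<delta>)" for \<tau> A r
  proof -
    have "Pr (\<lambda>x. real (card (desc ty \<tau> A x)) < card A * prod_list (map (\<lambda>t. \<beta> * w t) \<tau>)) \<le> C \<tau> / card A"
    proof (rule P[OF \<tau>])
      show "A \<subseteq> window (r * exp (- \<delta>)) r" using A by (simp add: fits_def)
      show "a0 \<tau> \<le> r * exp (- \<delta>)" using le[OF \<tau>] r by linarith
      show "r * exp (2 * \<eta> * real (length \<tau>)) \<le> r * exp (- \<delta>) * exp b"
        using fits_separated[OF A(1)] T(2)[OF \<tau>] by simp
    qed (rule A(2))
    also have "\<dots> \<le> (\<Sum>\<tau>\<in>T. C \<tau>) / card A"
      using \<tau> T(1) C by (intro divide_right_mono member_le_sum) auto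
    finally show ?thesis .
  qed
  have "(\<Sum>\<tau>\<in>T. C \<tau>) \<ge> 0" using C by (intro sum_nonneg)
  then show ?thesis
    by (rule_tac x="\<Sum>\<tau>\<in>T. C \<tau>" in exI, rule_tac conjI, assumption, rule_tac x=a1 in exI,
        rule_tac conjI[OF large_a1], intro allI impI, rule_tac few)
qed

text \<open>The constant \<open>C' = 2 * card T * C\<close> reproduces itself. Failure in the first
  block costs at most \<open>card T * C / card A\<close>, half of the bound. A populated slot has at
  least \<open>2 * R * card A\<close> members and is lost later with probability at most
  \<open>C' / (2 * R * card A)\<close>; the \<open>R\<close> slots together give the other half. So
  the bound is uniform in \<open>m\<close>.\<close>

lemma Pr_not_thrive:
  "\<exists>C\<ge>0. \<exists>a0. large a0 \<and> (\<forall>m A r. fits A r \<longrightarrow> A \<noteq> {} \<longrightarrow> a0 \<le> r * exp (- \<delta>) \<longrightarrow>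
    Pr (\<lambda>x. \<not> thrive m A r x) \<le> C / card A)"
proof -
  obtain C a0 where C: "C \<ge> 0" and a0: "large a0" and P: "\<And>A r \<tau>. \<tau> \<in> T \<Longrightarrow> fits A r \<Longrightarrow> A \<noteq> {} \<Longrightarrow> a0 \<le> r * exp (- \<delta>) \<Longrightarrow>
    Pr (\<lambda>x. real (card (desc ty \<tau> A x)) < card A * prod_list (map (\<lambda>t. \<beta> * w t) \<tau>)) \<le> C / card A"
    using Pr_few_desc_T by (elim exE conjE) simp
  define C' where "C' = 2 * (real (card T) * C)"
  have C': "C' \<ge> 0" using C by (simp add: C'_def)
  have main: "Pr (\<lambda>x. \<not> thrive m A r x) \<le> C' / card A"
    if "fits A r" "A \<noteq> {}" "a0 \<le> r * exp (- \<delta>)" for m A r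
    using that
  proof (induction m arbitrary: A r)
    case 0
    then show ?case using C' by (simp add: Pr_False)
  next
    case (Suc m)
    note A = Suc.prems
    have r: "r > 0" by (rule fits_pos[OF A(1)])
    have "finite A" by (rule fits_finite[OF A(1)])
    then have cA: "real (card A) > 0" using A(2) by (simp add: card_gt_0_iff)
    let ?bad = "\<lambda>\<tau> x. real (card (desc ty \<tau> A x)) < card A * prod_list (map (\<lambda>t. \<beta> * w t) \<tau>)"
    let ?S = "\<lambda>l x. offspring A x \<inter> slot r l" and ?r = "\<lambda>l. r * exp (\<delta> * real (Suc l))"
    \<comment> \<open>Slot \<open>l\<close> is populated but its lineage fails later. Which slot is
      populated is random, hence a union over all of them.\<close>
    let ?lose = "\<lambda>l x. 2 * R * card A \<le> card (?S l x) \<and> \<not> thrive m (?S l x) (?r l) x"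
    define top where "top = r * exp (\<delta> * real R * real (Suc m))"
    have topR: "r * exp (\<delta> * real R) \<le> top"
    proof -
      have "\<delta> * real R * 1 \<le> \<delta> * real R * real (Suc m)" using \<delta>(1) by (intro mult_left_mono) auto
      then show ?thesis unfolding top_def using r by simp
    qed
    have dep_bad: "dep code (window r top) (?bad \<tau>)" if \<tau>: "\<tau> \<in> T" for \<tau>
    proof -
      have "dep code (window r top) (desc ty \<tau> A)"
      proof (rule dep_desc')
        show "set \<tau> \<subseteq> I" using T(2)[OF \<tau>] by auto
        show "large (r * exp (- \<delta>))" "A \<subseteq> window (r * exp (- \<delta>)) r" using A(1) by (auto simp: fits_def)
        show "r * exp (2 * \<eta> * real (length \<tau>)) \<le> r * exp (- \<delta>) * exp b"
          using fits_separated[OF A(1)] T(2)[OF \<tau>] by simp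
        have "r * exp (sum_list (map s \<tau>) + 2 * \<eta> * real (length \<tau>)) \<le> r * exp (\<delta> * real R)"
          using T_sum[OF \<tau>] r T(2)[OF \<tau>] by simp
        then show "r * exp (sum_list (map s \<tau>) + 2 * \<eta> * real (length \<tau>)) \<le> top" using topR by linarith
      qed
      then show ?thesis
        by (rule dep_comp[where g="\<lambda>K. real (card K) < card A * prod_list (map (\<lambda>t. \<beta> * w t) \<tau>)"])
    qed
    have depS: "dep code (window r (?r l)) (?S l)" for l
      using dep_offspring[OF A(1), of "?r l" "r * exp (\<delta> * real l)"] by (simp only: slot_def)
    have hor: "?r l * exp (\<delta> * real R * real m) \<le> top" if "l < R" for l
      unfolding top_def by (rule horizon_step[OF r that])
    have r_top: "?r l \<le> top" if "l < R" for l
      using slot_le[OF r that] topR by linarith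
    have fitS: "fits S (?r l)" if "S \<subseteq> slot r l" for S l
      by (rule slot_fits[OF A(1) that])
    have dep_thr: "dep code (window (?r l) top) (thrive m S (?r l))" if "S \<subseteq> slot r l" "l < R" for S l
      by (rule dep_mono[OF dep_thrive[OF fitS[OF that(1)]] window_mono[OF order_refl hor[OF that(2)]]])
    have dep_lose: "dep code (window r top) (?lose l)" if l: "l < R" for l
    proof (rule depI)
      fix x x' assume x: "unit_seq x" "unit_seq x'" and c: "\<And>i. i \<in> window r top \<Longrightarrow> code i (x i) = code i (x' i)"
      have 1: "?S l x = ?S l x'"
      proof (rule depD[OF depS x])
        fix i assume "i \<in> window r (?r l)"
        then show "code i (x i) = code i (x' i)" using r_top[OF l] by (intro c) (auto simp: window_def)
      qed
      have 2: "thrive m (?S l x') (?r l) x = thrive m (?S l x') (?r l) x'"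
      proof (rule depD[OF dep_thr[OF _ l] x])
        fix i assume "i \<in> window (?r l) top"
        then show "code i (x i) = code i (x' i)"
          using slot_gt[OF r, of "Suc l"] by (intro c) (auto simp: window_def)
      qed simp
      show "?lose l x = ?lose l x'" unfolding 1 2 by (rule refl)
    qed
    have Pr_lose: "Pr (?lose l) \<le> C' / (2 * real R * card A)" if l: "l < R" for l
    proof (rule Pr_cond[OF code_measurable, where G="?S l" and Ja="window r (?r l)" and Jb="window (?r l) top"
        and S="{S. S \<subseteq> slot r l \<and> 2 * R * card A \<le> card S}" and Q="\<lambda>S x. \<not> thrive m S (?r l) x"])
      show "dep code (window r (?r l)) (?S l)" by (rule depS)
      show "window r (?r l) \<inter> window (?r l) top = {}" by (rule window_disjoint) simp
      show "finite {S. S \<subseteq> slot r l \<and> 2 * R * card A \<le> card S}"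
        by (rule finite_subset[of _ "Pow (slot r l)"]) (auto simp: slot_def)
      show "0 \<le> C' / (2 * real R * card A)" using C' by simp
      fix S assume S: "S \<in> {S. S \<subseteq> slot r l \<and> 2 * R * card A \<le> card S}"
      then show "dep code (window (?r l) top) (\<lambda>x. \<not> thrive m S (?r l) x)"
        by (intro dep_comp[where g="\<lambda>P. \<not> P", OF dep_thr[OF _ l]]) auto
      have pos: "0 < 2 * R * card A" using R cA by simp
      then have "S \<noteq> {}" using S by auto
      have "a0 \<le> ?r l * exp (- \<delta>)"
      proof -
        have "r * exp (- \<delta>) \<le> ?r l * exp (- \<delta>)"
          using slot_gt[OF r, of "Suc l"] by (intro mult_right_mono) auto
        then show ?thesis using A(3) by linarith
      qed
      then have "Pr (\<lambda>x. \<not> thrive m S (?r l) x) \<le> C' / card S"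
        using S \<open>S \<noteq> {}\<close> fitS[of S l] by (intro Suc.IH) auto
      also have "\<dots> \<le> C' / (2 * real R * card A)"
      proof (rule divide_left_mono[OF _ C'])
        have "real (2 * R * card A) \<le> real (card S)" using S by (simp only: of_nat_le_iff mem_Collect_eq)
        then show "2 * real R * real (card A) \<le> real (card S)" by simp
        have "0 < card S" by (rule less_le_trans[OF pos]) (use S in blast)
        then show "0 < real (card S) * (2 * real R * real (card A))"
          using R cA by simp
      qed
      finally show "Pr (\<lambda>x. \<not> thrive m S (?r l) x) \<le> C' / (2 * real R * card A)" .
    next
      fix x assume "?lose l x"
      then show "?S l x \<in> {S. S \<subseteq> slot r l \<and> 2 * R * card A \<le> card S} \<and> \<not> thrive m (?S l x) (?r l) x"
        by blast
    qed simp_all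
    have "Pr (\<lambda>x. \<not> thrive (Suc m) A r x) \<le> Pr (\<lambda>x. \<exists>\<tau>\<in>T. ?bad \<tau> x) + Pr (\<lambda>x. \<exists>l<R. ?lose l x)"
    proof (rule Pr_Un[OF code_measurable, where J="window r top"])
      show "dep code (window r top) (\<lambda>x. \<exists>\<tau>\<in>T. ?bad \<tau> x)"
        using dep_bad unfolding dep_def by blast
      show "dep code (window r top) (\<lambda>x. \<exists>l<R. ?lose l x)"
        using dep_lose unfolding dep_def by blast
      fix x assume nt: "\<not> thrive (Suc m) A r x"
      show "(\<exists>\<tau>\<in>T. ?bad \<tau> x) \<or> (\<exists>l<R. ?lose l x)"
      proof (rule disjCI)
        assume nl: "\<not> (\<exists>l<R. ?lose l x)"
        show "\<exists>\<tau>\<in>T. ?bad \<tau> x"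
        proof (rule ccontr)
          assume "\<not> (\<exists>\<tau>\<in>T. ?bad \<tau> x)"
          then have "\<exists>l<R. 2 * R * card A \<le> card (?S l x)"
            by (intro offspring_large[OF A(1)]) (auto simp: not_less)
          then have "thrive (Suc m) A r x" using nl by (subst thrive.simps(2)) blast
          with nt show False by blast
        qed
      qed
    qed simp
    also have "Pr (\<lambda>x. \<exists>\<tau>\<in>T. ?bad \<tau> x) \<le> (\<Sum>\<tau>\<in>T. Pr (?bad \<tau>))"
      by (rule Pr_UN[OF code_measurable, where J="window r top"]) (use dep_bad T(1) in auto)
    also have "\<dots> \<le> (\<Sum>\<tau>\<in>T. C / card A)"
      by (rule sum_mono, rule P[OF _ A])
    also have "\<dots> = C' / card A / 2" by (simp add: C'_def)
    also have "Pr (\<lambda>x. \<exists>l<R. ?lose l x) \<le> (\<Sum>l\<in>{..<R}. Pr (?lose l))"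
    proof (rule Pr_UN[OF code_measurable, where J="window r top"])
      show "dep code (window r top) (?lose l)" if "l \<in> {..<R}" for l
        using dep_lose that by simp
      show "\<exists>l\<in>{..<R}. ?lose l x" if "\<exists>l<R. ?lose l x" for x using that by blast
    qed simp_all
    also have "\<dots> \<le> (\<Sum>l\<in>{..<R}. C' / (2 * real R * card A))"
      by (rule sum_mono, rule Pr_lose) simp
    also have "\<dots> = C' / card A / 2" using R by simp
    finally show ?case by simp
  qed
  show ?thesis
    by (rule_tac x=C' in exI, rule_tac conjI[OF C'], rule_tac x=a0 in exI,
        rule_tac conjI[OF a0], intro allI impI, rule_tac main)
qed

end

section \<open>Bounds for the height\<close>

text \<open>For given \<open>n\<close> take the largest \<open>m\<close> with
  \<open>r * exp (h * m) \<le> n\<close>: some node up to \<open>n\<close> has a nonzero ancestor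
  \<open>k * m\<close> generations back, so the height exceeds \<open>k * m\<close>. The margin
  \<open>d = k / h - c\<close> absorbs the constants coming from \<open>r\<close> and from the
  rounding of \<open>m\<close>.\<close>

lemma height_lower_of_ancestors:
  assumes x: "unit_seq x" and r: "r > 0" and h: "h > 0"
    and anc: "\<And>m. \<exists>i. real i \<le> r * exp (h * real m) \<and> ancestor x i (k * m) \<noteq> 0"
    and c: "c < real k / h"
  shows "eventually (\<lambda>n. c * ln (real n) \<le> real (height x n)) sequentially"
proof -
  define d where "d = real k / h - c"
  have d: "d > 0" using c by (simp add: d_def)
  have "filterlim (\<lambda>n. d * ln (real n)) at_top sequentially"
    by (intro filterlim_tendsto_pos_mult_at_top[OF tendsto_const d]
        filterlim_compose[OF ln_at_top filterlim_real_sequentially])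
  then have ev: "eventually (\<lambda>n. real k / h * ln r + real k \<le> d * ln (real n)) sequentially"
    by (simp add: filterlim_at_top)
  have "eventually (\<lambda>n. r \<le> real n) sequentially"
    using filterlim_real_sequentially by (simp add: filterlim_at_top)
  with ev eventually_gt_at_top[of 0] show ?thesis
  proof eventually_elim
    case (elim n)
    define m where "m = nat \<lfloor>ln (real n / r) / h\<rfloor>"
    have ln0: "0 \<le> ln (real n / r)" using elim r by simp
    have m: "real m \<le> ln (real n / r) / h" "ln (real n / r) / h < real m + 1"
      unfolding m_def using ln0 h by (auto simp: of_nat_floor divide_nonneg_pos)
    have "h * real m \<le> ln (real n / r)" using m h by (simp add: field_simps)
    then have "r * exp (h * real m) \<le> r * exp (ln (real n / r))" using r by simp
    also have "\<dots> = real n" using r elim by simp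
    finally have rn: "r * exp (h * real m) \<le> real n" .
    obtain i where i: "real i \<le> r * exp (h * real m)" "ancestor x i (k * m) \<noteq> 0"
      using anc by blast
    have "i \<in> {1..n}" using i rn by (cases "i = 0") auto
    then have "\<not> height x n \<le> k * m"
      using height_le_iff[OF x, of n "k * m"] i(2) elim by auto
    then have "real k * real m \<le> real (height x n)" by (simp flip: of_nat_mult)
    moreover have "real k * (ln (real n / r) / h - 1) \<le> real k * real m"
      using m by (intro mult_left_mono) auto
    moreover have "real k * (ln (real n / r) / h - 1) = real k / h * ln (real n) - (real k / h * ln r + real k)"
      using elim r by (simp add: ln_div algebra_simps diff_divide_distrib)
    moreover have "c * ln (real n) = real k / h * ln (real n) - d * ln (real n)"
      by (simp add: d_def algebra_simps)
    ultimately show ?case using elim by linarith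
  qed
qed

lemma card_window:
  assumes "0 \<le> a" "a \<le> a'"
  shows "a' - a - 1 \<le> real (card (window a a'))"
proof -
  have "{nat \<lfloor>a\<rfloor> + 1..nat \<lfloor>a'\<rfloor>} \<subseteq> window a a'"
  proof
    fix i assume "i \<in> {nat \<lfloor>a\<rfloor> + 1..nat \<lfloor>a'\<rfloor>}"
    then have "\<lfloor>a\<rfloor> < int i" "int i \<le> \<lfloor>a'\<rfloor>" using assms by auto
    then show "i \<in> window a a'" by (auto simp: window_def floor_less_iff le_floor_iff)
  qed
  then have "card {nat \<lfloor>a\<rfloor> + 1..nat \<lfloor>a'\<rfloor>} \<le> card (window a a')" by (intro card_mono) auto
  then have "nat \<lfloor>a'\<rfloor> - nat \<lfloor>a\<rfloor> \<le> card (window a a')" by simp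
  then have "real (nat \<lfloor>a'\<rfloor>) - real (nat \<lfloor>a\<rfloor>) \<le> real (card (window a a'))" by linarith
  moreover have "real (nat \<lfloor>a\<rfloor>) \<le> a" "a' - 1 \<le> real (nat \<lfloor>a'\<rfloor>)" using assms by linarith+
  ultimately show ?thesis by linarith
qed

context block_attachment
begin

text \<open>Start from all labels in a slot ending at \<open>n\<close>, about \<open>u * n\<close>
  of them. They thrive forever with probability at least \<open>1 - C / (n * u - 1)\<close>, and a
  single thriving \<open>n\<close> suffices for the claim; the union over \<open>n\<close> therefore
  has probability 1.\<close>

lemma AE_height_lower:
  assumes c: "c < real k / (\<delta> * real R)"
  shows "AE \<omega> in M. eventually (\<lambda>n. c * ln (real n) \<le> real (height (\<lambda>i. Xs i \<omega>) n)) sequentially"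
proof -
  obtain C a0 where C: "C \<ge> 0" and a0: "large a0"
    and thr: "\<forall>m A r. fits A r \<longrightarrow> A \<noteq> {} \<longrightarrow> a0 \<le> r * exp (- \<delta>) \<longrightarrow> Pr (\<lambda>x. \<not> thrive m A r x) \<le> C / card A"
    using Pr_not_thrive by (elim exE conjE)
  define A where "A n = window (real n * exp (- \<delta>)) (real n)" for n
  define E where "E n m = {\<omega> \<in> space M. thrive m (A n) (real n) (\<lambda>i. Xs i \<omega>)}" for n m
  define u where "u = 1 - exp (- \<delta>)"
  have u: "u > 0" using \<delta>(1) by (simp add: u_def)
  have ex: "0 < exp (- \<delta>)" by simp
  have cardA: "real n * u - 1 \<le> real (card (A n))" for n
  proof -
    have "real n * exp (- \<delta>) \<le> real n * 1" using \<delta>(1) by (intro mult_left_mono) auto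
    then have "real n - real n * exp (- \<delta>) - 1 \<le> real (card (A n))"
      unfolding A_def by (intro card_window) auto
    then show ?thesis by (simp add: u_def algebra_simps)
  qed
  have lim_card: "filterlim (\<lambda>n. real n * u - 1) at_top sequentially"
  proof -
    have "filterlim (\<lambda>n. u * real n) at_top sequentially"
      by (rule filterlim_tendsto_pos_mult_at_top[OF tendsto_const u filterlim_real_sequentially])
    then have "filterlim (\<lambda>n. - 1 + u * real n) at_top sequentially"
      by (rule filterlim_tendsto_add_at_top[OF tendsto_const])
    then show ?thesis by (simp add: mult.commute)
  qed
  have ev1: "eventually (\<lambda>n. 1 \<le> real n * u - 1) sequentially"
    using lim_card unfolding filterlim_at_top by blast
  have "filterlim (\<lambda>n. exp (- \<delta>) * real n) at_top sequentially"
    by (rule filterlim_tendsto_pos_mult_at_top[OF tendsto_const ex filterlim_real_sequentially])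
  then have ev2: "eventually (\<lambda>n. a0 \<le> exp (- \<delta>) * real n) sequentially"
    by (simp add: filterlim_at_top)
  define good where "good n \<longleftrightarrow> 1 \<le> real n * u - 1 \<and> a0 \<le> exp (- \<delta>) * real n" for n
  have ev: "eventually good sequentially"
    unfolding good_def using ev1 ev2 by (rule eventually_conj)
  have fitsA: "fits (A n) (real n)" and ne: "A n \<noteq> {}" if "good n" for n
  proof -
    have "large (real n * exp (- \<delta>))"
      using that by (intro large_mono[OF a0]) (simp add: good_def mult.commute)
    then show "fits (A n) (real n)" by (simp add: fits_def A_def)
    have "0 < real (card (A n))" using cardA[of n] that unfolding good_def by linarith
    then show "A n \<noteq> {}" by auto
  qed
  have E_events: "E n m \<in> events" if "good n" for n m
    unfolding E_def by (rule dep_measurable[OF code_measurable dep_thrive[OF fitsA[OF that]]]) simp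
  have E_prob: "1 - C / (real n * u - 1) \<le> prob (E n m)" if g: "good n" for n m
  proof -
    have "Pr (\<lambda>x. \<not> thrive m (A n) (real n) x) = prob (space M - E n m)"
      unfolding Pr_def E_def by (intro arg_cong[where f=prob]) auto
    also have "\<dots> = 1 - prob (E n m)" by (rule prob_compl[OF E_events[OF g]])
    finally have eq: "Pr (\<lambda>x. \<not> thrive m (A n) (real n) x) = 1 - prob (E n m)" .
    have "a0 \<le> real n * exp (- \<delta>)" using g by (simp add: good_def mult.commute)
    then have "Pr (\<lambda>x. \<not> thrive m (A n) (real n) x) \<le> C / card (A n)"
      by (rule thr[rule_format, OF fitsA[OF g] ne[OF g]])
    then have "1 - prob (E n m) \<le> C / card (A n)" unfolding eq .
    also have "\<dots> \<le> C / (real n * u - 1)"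
    proof -
      have "0 < real n * u - 1" using g unfolding good_def by linarith
      then show ?thesis using cardA[of n] C by (intro divide_left_mono mult_pos_pos) linarith+
    qed
    finally show ?thesis by linarith
  qed
  \<comment> \<open>Thriving for all \<open>m\<close>. The events decrease in \<open>m\<close> and
    their bound does not depend on \<open>m\<close>, so it passes to the intersection.\<close>
  define F where "F n = (\<Inter>m. E n m)" for n
  have F_events: "F n \<in> events" if "good n" for n
    unfolding F_def using E_events[OF that] by (intro sets.countable_INT) auto
  have F_prob: "1 - C / (real n * u - 1) \<le> prob (F n)" if g: "good n" for n
  proof (rule LIMSEQ_le_const)
    show "(\<lambda>m. prob (E n m)) \<longlonglongrightarrow> prob (F n)"
      unfolding F_def
    proof (rule finite_Lim_measure_decseq)
      show "range (E n) \<subseteq> events" using E_events[OF g] by blast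
      show "decseq (E n)"
      proof (rule decseq_SucI)
        show "E n (Suc m) \<subseteq> E n m" for m
          unfolding E_def using thrive_mono by (intro Collect_mono) blast
      qed
    qed
    show "\<exists>N. \<forall>m\<ge>N. 1 - C / (real n * u - 1) \<le> prob (E n m)" using E_prob[OF g] by blast
  qed
  have F_height: "eventually (\<lambda>n. c * ln (real n) \<le> real (height (\<lambda>i. Xs i \<omega>) n)) sequentially"
    if g: "good n" and \<omega>: "\<omega> \<in> F n" for n \<omega>
  proof -
    let ?x = "\<lambda>i. Xs i \<omega>"
    have sp: "\<omega> \<in> space M" and th: "thrive m (A n) (real n) ?x" for m
      using \<omega> by (auto simp: F_def E_def)
    have us: "unit_seq ?x" using Xs_range[OF sp] by simp
    have n0: "real n > 0" by (rule fits_pos[OF fitsA[OF g]])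
    show ?thesis
    proof (rule height_lower_of_ancestors[OF us n0 _ _ c])
      show "0 < \<delta> * real R" using \<delta>(1) R by simp
      show "\<exists>i. real i \<le> real n * exp (\<delta> * real R * real m) \<and> ancestor ?x i (k * m) \<noteq> 0" for m
      proof -
        obtain i where i: "real i \<le> real n * exp (\<delta> * real R * real m)" "ancestor ?x i (k * m) \<in> A n"
          using thrive_ancestor[OF fitsA[OF g] ne[OF g] th[of m]] by (elim exE conjE)
        have "0 \<notin> A n" using n0 by (simp add: A_def window_def zero_less_mult_iff not_less)
        then have "ancestor ?x i (k * m) \<noteq> 0" using i(2) by (intro notI) simp
        then show ?thesis using i(1) by blast
      qed
    qed
  qed
  define G where "G = (\<Union>n\<in>{n. good n}. F n)"
  have G_events: "G \<in> events"
    unfolding G_def by (intro sets.countable_UN') (auto intro: F_events)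
  have "prob G = 1"
  proof (rule antisym)
    show "1 \<le> prob G"
    proof (rule LIMSEQ_le_const2)
      have "(\<lambda>n. C / (real n * u - 1)) \<longlonglongrightarrow> 0"
        by (rule real_tendsto_divide_at_top[OF tendsto_const lim_card])
      then have "(\<lambda>n. 1 - C / (real n * u - 1)) \<longlonglongrightarrow> 1 - 0"
        by (intro tendsto_diff tendsto_const)
      then show "(\<lambda>n. 1 - C / (real n * u - 1)) \<longlonglongrightarrow> 1" by simp
      obtain N where N: "\<And>n. n \<ge> N \<Longrightarrow> good n" using ev unfolding eventually_sequentially by blast
      have "1 - C / (real n * u - 1) \<le> prob G" if "n \<ge> N" for n
      proof -
        have "prob (F n) \<le> prob G"
          using N[OF that] G_events unfolding G_def by (intro finite_measure_mono) auto
        then show ?thesis using F_prob[OF N[OF that]] by linarith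
      qed
      then show "\<exists>N. \<forall>n\<ge>N. 1 - C / (real n * u - 1) \<le> prob G" by blast
    qed
  qed simp
  then have "AE \<omega> in M. \<omega> \<in> G" using G_events by (simp add: prob_eq_1)
  then show ?thesis
  proof eventually_elim
    case (elim \<omega>)
    then obtain n where "good n" "\<omega> \<in> F n" unfolding G_def by blast
    then show ?case by (rule F_height)
  qed
qed

end

section \<open>Upper bounds for the height, almost surely and in the mean\<close>

context iid_attachment
begin

lemma height_measurable [measurable]: "(\<lambda>\<omega>. height (\<lambda>i. Xs i \<omega>) n) \<in> M \<rightarrow>\<^sub>M count_space UNIV"
proof (rule measurable_count_space_eq_countable[THEN iffD2])
  show "(\<lambda>\<omega>. height (\<lambda>i. Xs i \<omega>) n) \<in> space M \<rightarrow> UNIV \<and>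
    (\<forall>a\<in>UNIV. (\<lambda>\<omega>. height (\<lambda>i. Xs i \<omega>) n) -` {a} \<inter> space M \<in> events)"
  proof (intro conjI ballI)
    fix a
    have "{\<omega> \<in> space M. height (\<lambda>i. Xs i \<omega>) n = a} \<in> events"
      by (rule dep_measurable[OF parent_code_measurable dep_comp[OF dep_height, where g="\<lambda>h. h = a"]]) simp
    also have "{\<omega> \<in> space M. height (\<lambda>i. Xs i \<omega>) n = a} = (\<lambda>\<omega>. height (\<lambda>i. Xs i \<omega>) n) -` {a} \<inter> space M"
      by auto
    finally show "(\<lambda>\<omega>. height (\<lambda>i. Xs i \<omega>) n) -` {a} \<inter> space M \<in> events" .
  qed simp
qed simp

lemma Pr_height_log:
  assumes \<lambda>: "l > 0" and m: "0 < m" "m < 1" "m = (LINT r|D. r powr l)" and n: "n \<ge> 1"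
    and k: "c * ln (real n) \<le> real k"
  shows "Pr (\<lambda>x. height x n > k) \<le> exp (ln (real n) * (1 + l + c * ln m))"
proof -
  have "Pr (\<lambda>x. height x n > k) \<le> real n powr (1 + l) * m ^ k"
    using Pr_height[OF \<lambda> n, of k] m(3) by simp
  also have "\<dots> = exp (ln (real n) * (1 + l)) * exp (ln m * real k)"
    using n m by (simp add: powr_def mult.commute exp_of_nat_mult)
  also have "\<dots> \<le> exp (ln (real n) * (1 + l)) * exp (ln m * (c * ln (real n)))"
    using k m by (intro mult_left_mono) (auto intro: mult_left_mono_neg)
  also have "\<dots> = exp (ln (real n) * (1 + l + c * ln m))"
    by (simp add: algebra_simps flip: exp_add)
  finally show ?thesis .
qed

text \<open>The tail bound is a negative power of \<open>n\<close>, perhaps not summable over all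
  \<open>n\<close>, but geometric along powers of 2. Rounding \<open>n\<close> up to a power of 2
  costs \<open>c * ln 2\<close>, and rounding the level up to an integer costs 1.\<close>

lemma AE_height_upper:
  assumes \<lambda>: "l > 0" and m: "0 < m" "m < 1" "m = (LINT r|D. r powr l)" and c: "c > 0" "1 + l + c * ln m < 0"
  shows "AE \<omega> in M. eventually (\<lambda>n. real (height (\<lambda>i. Xs i \<omega>) n) \<le> c * ln (real n) + (c * ln 2 + 1)) sequentially"
proof -
  define K where "K j = nat \<lceil>c * ln (2 ^ j :: real)\<rceil>" for j
  define B where "B j = {\<omega> \<in> space M. height (\<lambda>i. Xs i \<omega>) (2 ^ j) > K j}" for j
  have K: "c * ln (2 ^ j) \<le> real (K j)" "real (K j) \<le> c * ln (2 ^ j) + 1" for j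
  proof -
    have "0 \<le> c * ln (2 ^ j :: real)" using c by simp
    then show "c * ln (2 ^ j) \<le> real (K j)" "real (K j) \<le> c * ln (2 ^ j) + 1"
      unfolding K_def by linarith+
  qed
  have B_events: "B j \<in> events" for j unfolding B_def by measurable
  define q where "q = exp (ln 2 * (1 + l + c * ln m))"
  have q: "0 < q" "q < 1" using c(2) by (auto simp: q_def mult_less_0_iff)
  have B_le: "prob (B j) \<le> q ^ j" for j
  proof -
    have "prob (B j) = Pr (\<lambda>x. height x (2 ^ j) > K j)" by (simp add: B_def Pr_def)
    also have "\<dots> \<le> exp (ln (real (2 ^ j)) * (1 + l + c * ln m))"
      using K by (intro Pr_height_log[OF \<lambda> m]) auto
    also have "\<dots> = q ^ j"
      by (simp add: q_def ln_realpow mult.assoc flip: exp_of_nat_mult)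
    finally show ?thesis .
  qed
  have "AE \<omega> in M. eventually (\<lambda>j. \<omega> \<in> space M - B j) sequentially"
  proof (rule borel_cantelli_AE1[OF B_events])
    show "emeasure M (B j) < \<infinity>" for j by (simp add: emeasure_eq_measure)
    show "summable (\<lambda>j. prob (B j))"
      using q B_le by (intro summable_comparison_test'[OF summable_geometric[of q], of 0]) auto
  qed
  then show ?thesis
  proof eventually_elim
    case (elim \<omega>)
    let ?x = "\<lambda>i. Xs i \<omega>"
    obtain J where J: "\<And>j. j \<ge> J \<Longrightarrow> \<omega> \<in> space M - B j"
      using elim unfolding eventually_sequentially by blast
    then have sp: "\<omega> \<in> space M" by blast
    have us: "unit_seq ?x" using Xs_range[OF sp] by simp
    have "real (height ?x n) \<le> c * ln (real n) + (c * ln 2 + 1)" if n: "n \<ge> 2 ^ J" for n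
    proof -
      have n1: "n \<ge> 1" using n one_le_power[of "2::nat" J] by linarith
      define j where "j = (LEAST j. n \<le> 2 ^ j)"
      have j: "n \<le> 2 ^ j" unfolding j_def
        by (rule LeastI[of _ n]) (simp add: less_imp_le)
      have jJ: "2 ^ J \<le> (2::nat) ^ j" using j n by linarith
      then have "J \<le> j" by simp
      then have "height ?x (2 ^ j) \<le> K j" using J[of j] sp by (auto simp: B_def)
      then have h: "real (height ?x n) \<le> c * ln (2 ^ j) + 1"
        using height_mono[OF us n1 j] K(2)[of j] by linarith
      have "(2::real) ^ j \<le> 2 * real n"
      proof (cases j)
        case 0
        then show ?thesis using n1 by simp
      next
        case (Suc i)
        have "\<not> n \<le> 2 ^ i" using not_less_Least[of i "\<lambda>j. n \<le> 2 ^ j"] Suc unfolding j_def by simp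
        then have "real (2 ^ i) \<le> real n" by (simp only: of_nat_le_iff)
        then show ?thesis using Suc by simp
      qed
      then have "ln (2 ^ j :: real) \<le> ln (2 * real n)" using n1 by (subst ln_le_cancel_iff) auto
      also have "\<dots> = ln 2 + ln (real n)" using n1 by (simp add: ln_mult)
      finally have "c * ln (2 ^ j) \<le> c * (ln 2 + ln (real n))" using c by (intro mult_left_mono) auto
      then show ?thesis using h by (simp add: algebra_simps)
    qed
    then show ?case unfolding eventually_sequentially by blast
  qed
qed

lemma height_integrable: "n \<ge> 1 \<Longrightarrow> integrable M (\<lambda>\<omega>. real (height (\<lambda>i. Xs i \<omega>) n))"
proof -
  assume n: "n \<ge> 1"
  show ?thesis
  proof (rule integrable_const_bound[where B="real n"])
    show "AE \<omega> in M. norm (real (height (\<lambda>i. Xs i \<omega>) n)) \<le> real n"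
      using Xs_range n by (intro AE_I2) (auto intro!: height_le)
  qed measurable
qed

text \<open>The mean is at most \<open>K\<close> plus the sum of the tails from \<open>K\<close> on.
  At \<open>K\<close> the tail bound has dropped to 1, and every further level multiplies it by
  \<open>m\<close>: a geometric series.\<close>

lemma expectation_height_upper:
  assumes \<lambda>: "l > 0" and m: "0 < m" "m < 1" "m = (LINT r|D. r powr l)" and c: "c > 0" "1 + l + c * ln m < 0" and n: "n \<ge> 1"
  shows "expectation (\<lambda>\<omega>. real (height (\<lambda>i. Xs i \<omega>) n)) \<le> c * ln (real n) + (1 + 1 / (1 - m))"
proof -
  define K where "K = nat \<lceil>c * ln (real n)\<rceil>"
  have "0 \<le> c * ln (real n)" using c n by simp
  then have K: "c * ln (real n) \<le> real K" "real K \<le> c * ln (real n) + 1" unfolding K_def by linarith+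
  have ev: "{\<omega> \<in> space M. height (\<lambda>i. Xs i \<omega>) n > k} \<in> events" for k by measurable
  have ie: "integrable M (indicator {\<omega> \<in> space M. height (\<lambda>i. Xs i \<omega>) n > k} :: 'a \<Rightarrow> real)" for k
    using ev by (intro integrable_real_indicator) (auto simp: emeasure_eq_measure)
  have pw: "real (height (\<lambda>i. Xs i \<omega>) n) \<le> real K + (\<Sum>k\<in>{K..<n}. indicator {\<omega> \<in> space M. height (\<lambda>i. Xs i \<omega>) n > k} \<omega>)"
    if \<omega>: "\<omega> \<in> space M" for \<omega>
  proof -
    let ?h = "height (\<lambda>i. Xs i \<omega>) n"
    have hn: "?h \<le> n" using Xs_range[OF \<omega>] n by (intro height_le) auto
    have "(\<Sum>k\<in>{K..<n}. indicator {\<omega> \<in> space M. height (\<lambda>i. Xs i \<omega>) n > k} \<omega>) = (\<Sum>k\<in>{K..<n}. if k < ?h then 1 else 0 :: real)"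
      using \<omega> by (intro sum.cong) (auto simp: indicator_def)
    also have "\<dots> = real (card ({K..<n} \<inter> {k. k < ?h}))" by (simp add: sum.If_cases)
    also have "{K..<n} \<inter> {k. k < ?h} = {K..<?h}" using hn by auto
    finally show ?thesis by simp
  qed
  have "expectation (\<lambda>\<omega>. real (height (\<lambda>i. Xs i \<omega>) n))
    \<le> expectation (\<lambda>\<omega>. real K + (\<Sum>k\<in>{K..<n}. indicator {\<omega> \<in> space M. height (\<lambda>i. Xs i \<omega>) n > k} \<omega>))"
    by (rule integral_mono[OF height_integrable[OF n]])
      (auto intro!: Bochner_Integration.integrable_add Bochner_Integration.integrable_sum ie pw)
  also have "\<dots> = real K + (\<Sum>k\<in>{K..<n}. Pr (\<lambda>x. height x n > k))"
  proof -
    have "expectation (\<lambda>\<omega>. real K + (\<Sum>k\<in>{K..<n}. indicator {\<omega> \<in> space M. height (\<lambda>i. Xs i \<omega>) n > k} \<omega>))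
      = expectation (\<lambda>\<omega>. real K) + (\<Sum>k\<in>{K..<n}. expectation (indicator {\<omega> \<in> space M. height (\<lambda>i. Xs i \<omega>) n > k}))"
      by (subst Bochner_Integration.integral_add, (rule integrable_const Bochner_Integration.integrable_sum ie)+,
          subst Bochner_Integration.integral_sum, rule ie, rule refl)
    then show ?thesis using ev by (simp add: Pr_def prob_space)
  qed
  also have "(\<Sum>k\<in>{K..<n}. Pr (\<lambda>x. height x n > k)) \<le> (\<Sum>k\<in>{K..<n}. m ^ (k - K))"
  proof (rule sum_mono)
    fix k assume k: "k \<in> {K..<n}"
    have "Pr (\<lambda>x. height x n > k) \<le> real n powr (1 + l) * m ^ k"
      using Pr_height[OF \<lambda> n, of k] m(3) by simp
    also have "\<dots> = (real n powr (1 + l) * m ^ K) * m ^ (k - K)"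
      using k by (simp add: mult.assoc flip: power_add)
    also have "\<dots> \<le> 1 * m ^ (k - K)"
    proof (rule mult_right_mono)
      have "real n powr (1 + l) * m ^ K = exp (ln (real n) * (1 + l)) * exp (ln m * real K)"
        using n m by (simp add: powr_def mult.commute exp_of_nat_mult)
      also have "\<dots> \<le> exp (ln (real n) * (1 + l)) * exp (ln m * (c * ln (real n)))"
        using K m by (intro mult_left_mono) (auto intro: mult_left_mono_neg)
      also have "\<dots> = exp (ln (real n) * (1 + l + c * ln m))"
        by (simp add: algebra_simps flip: exp_add)
      also have "\<dots> \<le> 1" using n c(2) by (simp add: mult_nonneg_nonpos)
      finally show "real n powr (1 + l) * m ^ K \<le> 1" .
    qed (use m in simp)
    finally show "Pr (\<lambda>x. height x n > k) \<le> m ^ (k - K)" by simp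
  qed
  also have "\<dots> \<le> 1 / (1 - m)"
  proof (cases "K \<le> n")
    case True
    have "(\<Sum>k\<in>{K..<n}. m ^ (k - K)) = (\<Sum>k<n - K. m ^ k)"
      by (rule sum.reindex_bij_witness[of _ "\<lambda>k. k + K" "\<lambda>k. k - K"]) auto
    also have "\<dots> = (1 - m ^ (n - K)) / (1 - m)" using m by (subst sum_gp_strict) auto
    also have "\<dots> \<le> 1 / (1 - m)" using m by (intro divide_right_mono) auto
    finally show ?thesis .
  qed (use m in simp)
  finally show ?thesis using K by simp
qed

end

section \<open>The constant \<open>alpha_max\<close>\<close>

locale attachment_law = prob_space D for D :: "real measure" +
  assumes sets_D [measurable_cong]: "sets D = sets borel"
    and D01: "AE r in D. 0 < r \<and> r < 1"
begin

definition moment :: "real \<Rightarrow> real" where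
  "moment t = (LINT r|D. r powr t)"

lemma moment_integrable: "t \<ge> 0 \<Longrightarrow> integrable D (\<lambda>r. r powr t)"
proof -
  assume t: "t \<ge> 0"
  show ?thesis
  proof (rule integrable_const_bound[where B=1])
    show "AE r in D. norm (r powr t) \<le> 1"
      using D01 by eventually_elim (use t in \<open>auto intro: powr_le1\<close>)
  qed measurable
qed

lemma nn_moment: "t \<ge> 0 \<Longrightarrow> (\<integral>\<^sup>+r. ennreal (r powr t) \<partial>D) = ennreal (moment t)"
  unfolding moment_def by (intro nn_integral_eq_integral moment_integrable) auto

lemma moment_pos: "t \<ge> 0 \<Longrightarrow> 0 < moment t"
proof -
  assume t: "t \<ge> 0"
  have "0 \<le> moment t" unfolding moment_def by (intro Bochner_Integration.integral_nonneg) auto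
  moreover have "moment t \<noteq> 0"
  proof
    assume "moment t = 0"
    then have "AE r in D. r powr t = 0"
      using integral_nonneg_eq_0_iff_AE[OF moment_integrable[OF t]] by (simp add: moment_def)
    with D01 have "AE r in D. False" by eventually_elim auto
    then show False by simp
  qed
  ultimately show ?thesis by simp
qed

lemma moment_1: "moment 1 < 1"
proof -
  have int: "integrable D (\<lambda>r. 1 - r powr 1)"
    by (intro Bochner_Integration.integrable_diff moment_integrable) auto
  have eq: "(LINT r|D. 1 - r powr 1) = 1 - moment 1"
    unfolding moment_def using moment_integrable[of 1] by (subst Bochner_Integration.integral_diff) (auto simp: prob_space)
  have nn: "AE r in D. 0 \<le> 1 - r powr 1"
    using D01 by eventually_elim auto
  have "0 \<le> 1 - moment 1" unfolding eq[symmetric] by (rule integral_nonneg_AE[OF nn])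
  moreover have "1 - moment 1 \<noteq> 0"
  proof
    assume "1 - moment 1 = 0"
    then have "AE r in D. 1 - r powr 1 = 0"
      using integral_nonneg_eq_0_iff_AE[OF int nn] eq by simp
    with D01 have "AE r in D. False" by eventually_elim auto
    then show False by simp
  qed
  ultimately show ?thesis by simp
qed

text \<open>The library has \<open>0 powr 0 = 0\<close>, so this rests on almost sure
  positivity.\<close>

lemma moment_0: "moment 0 = 1"
proof -
  have "moment 0 = (LINT r|D. 1)"
    unfolding moment_def using D01 by (intro integral_cong_AE) (auto elim: eventually_mono)
  then show ?thesis by (simp add: prob_space)
qed

abbreviation mu :: ennreal where "mu \<equiv> neg_log_mean D (\<lambda>r. r)"
abbreviation LamD :: "real \<Rightarrow> ereal" where "LamD \<equiv> Lam D (\<lambda>r. r)"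

lemma LamD_nonneg: "t \<ge> 0 \<Longrightarrow> LamD t = ereal (ln (moment t))"
  unfolding Lam_def ext_ln_def using nn_moment[of t] moment_pos[of t] by simp

text \<open>The tangent of \<open>exp\<close> at \<open>- (t * \<mu>)\<close> lies below
  \<open>exp (t * ln r)\<close>, and its mean is its value at the point of contact. The sign of
  \<open>t\<close> is free: an infinite integral on the right is harmless.\<close>

lemma Jensen:
  assumes mu: "mu = ennreal \<mu>" "\<mu> \<ge> 0"
  shows "ennreal (exp (- (t * \<mu>))) \<le> (\<integral>\<^sup>+r. ennreal (r powr t) \<partial>D)"
proof (cases "(\<integral>\<^sup>+r. ennreal (r powr t) \<partial>D) = \<infinity>")
  case False
  have int: "integrable D (\<lambda>r. r powr t)"
    by (rule integrableI_nonneg) (use False in \<open>auto simp: top.not_eq_extremum\<close>)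
  have nn: "AE r in D. 0 \<le> - ln r"
    using D01 by eventually_elim auto
  have "(\<integral>\<^sup>+r. ennreal (- ln r) \<partial>D) = ennreal \<mu>" using mu by (simp add: neg_log_mean_def)
  note nni = this
  have lint1: "integrable D (\<lambda>r. - ln r)"
    by (rule integrableI_nonneg[OF _ nn]) (simp_all only: nni ennreal_less_top infinity_ennreal_def, measurable)
  have "ennreal (LINT r|D. - ln r) = ennreal \<mu>"
    unfolding nni[symmetric] by (rule nn_integral_eq_integral[symmetric, OF lint1 nn])
  then have "(LINT r|D. - ln r) = \<mu>"
    using integral_nonneg_AE[OF nn] mu(2) by (simp only: ennreal_inj)
  note lint = lint1 this
  have "exp (- (t * \<mu>)) = (LINT r|D. exp (- (t * \<mu>)) * (1 + t * \<mu>) - exp (- (t * \<mu>)) * t * (- ln r))"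
    using lint by (subst Bochner_Integration.integral_diff) (auto simp: prob_space algebra_simps)
  also have "\<dots> \<le> (LINT r|D. r powr t)"
  proof (rule integral_mono_AE)
    show "integrable D (\<lambda>r. exp (- (t * \<mu>)) * (1 + t * \<mu>) - exp (- (t * \<mu>)) * t * (- ln r))"
      by (intro Bochner_Integration.integrable_diff integrable_mult_right integrable_const lint)
    show "AE r in D. exp (- (t * \<mu>)) * (1 + t * \<mu>) - exp (- (t * \<mu>)) * t * (- ln r) \<le> r powr t"
      using D01
    proof eventually_elim
      case (elim r)
      have "1 + (t * ln r + t * \<mu>) \<le> exp (t * ln r + t * \<mu>)" by (rule exp_ge_add_one_self)
      then have "exp (- (t * \<mu>)) * (1 + (t * ln r + t * \<mu>)) \<le> exp (- (t * \<mu>)) * exp (t * ln r + t * \<mu>)"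
        by (intro mult_left_mono) auto
      also have "\<dots> = r powr t" using elim by (simp add: powr_def flip: exp_add)
      finally show ?case by (simp add: algebra_simps)
    qed
  qed (rule int)
  finally have "ennreal (exp (- (t * \<mu>))) \<le> ennreal (LINT r|D. r powr t)" by (rule ennreal_leI)
  also have "\<dots> = (\<integral>\<^sup>+r. ennreal (r powr t) \<partial>D)"
    by (rule nn_integral_eq_integral[symmetric, OF int]) auto
  finally show ?thesis .
qed simp

text \<open>Excludes negative exponents as witnesses for \<open>Psi > 1\<close>. If
  \<open>mu\<close> is finite, this is Jensen's inequality; if it is infinite,
  \<open>r powr t \<ge> t * ln r\<close> makes the moment infinite.\<close>

lemma LamD_neg_ge:
  assumes t: "t < 0" and z: "ennreal z < mu" "z > 0"
  shows "ereal (- t * z) \<le> LamD t"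
proof (cases "mu = \<infinity>")
  case True
  have "ennreal (- t) * mu = (\<integral>\<^sup>+r. ennreal (- t) * ennreal (- ln r) \<partial>D)"
    unfolding neg_log_mean_def by (rule nn_integral_cmult[symmetric]) measurable
  also have "\<dots> \<le> (\<integral>\<^sup>+r. ennreal (r powr t) \<partial>D)"
  proof (rule nn_integral_mono_AE)
    show "AE r in D. ennreal (- t) * ennreal (- ln r) \<le> ennreal (r powr t)"
      using D01
    proof eventually_elim
      case (elim r)
      have "t * ln r \<le> exp (t * ln r)" using exp_ge_add_one_self[of "t * ln r"] by linarith
      then have "(- t) * (- ln r) \<le> r powr t" using elim by (simp add: powr_def)
      then show ?case using t by (subst ennreal_mult'[symmetric]) (auto intro: ennreal_leI)
    qed
  qed
  finally have "(\<integral>\<^sup>+r. ennreal (r powr t) \<partial>D) = \<infinity>"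
    using True t by (simp add: ennreal_mult_top top_unique)
  then show ?thesis by (simp add: Lam_def ext_ln_def)
next
  case False
  then obtain \<mu> where \<mu>: "mu = ennreal \<mu>" "\<mu> \<ge> 0" by (cases mu) auto
  have z\<mu>: "z < \<mu>" using z \<mu> by (simp add: ennreal_less_iff)
  note J = Jensen[OF \<mu>, of t]
  show ?thesis
  proof (cases "(\<integral>\<^sup>+r. ennreal (r powr t) \<partial>D)")
    case (real v)
    then have v: "exp (- (t * \<mu>)) \<le> v" using J by (simp add: ennreal_le_iff)
    then have "v > 0" using exp_gt_zero[of "- (t * \<mu>)"] by linarith
    then have "- (t * \<mu>) \<le> ln v" using v by (simp add: ln_ge_iff)
    moreover have "- t * z \<le> - t * \<mu>" using t z\<mu> by (intro mult_left_mono) auto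
    ultimately show ?thesis using real \<open>v > 0\<close> by (simp add: Lam_def ext_ln_def)
  next
    case top
    then show ?thesis by (simp add: Lam_def ext_ln_def)
  qed
qed

lemma mu_pos: "0 < mu"
proof (rule ccontr)
  assume "\<not> 0 < mu"
  then have "(\<integral>\<^sup>+r. ennreal (- ln r) \<partial>D) = 0" by (simp add: neg_log_mean_def)
  then have "AE r in D. ennreal (- ln r) = 0" by (subst (asm) nn_integral_0_iff_AE) auto
  with D01 have "AE r in D. False"
    by eventually_elim (auto simp: ennreal_eq_0_iff)
  then show False by simp
qed

lemma inverse_mu_less:
  assumes "ennreal c > 1 / mu"
  shows "c > 0" "ennreal (1 / c) < mu"
proof -
  show c: "c > 0" using assms by (cases "c > 0") (auto simp: ennreal_neg not_less)
  show "ennreal (1 / c) < mu"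
  proof (cases mu)
    case (real \<mu>)
    then have "\<mu> > 0" using mu_pos by simp
    have "1 / mu = ennreal (1 / \<mu>)" using real \<open>\<mu> > 0\<close> by (simp add: divide_ennreal[symmetric])
    then have "1 / \<mu> < c" using assms c \<open>\<mu> > 0\<close> by (simp add: ennreal_less_iff)
    then have "1 / c < \<mu>" using c \<open>\<mu> > 0\<close> by (simp add: field_simps)
    then show ?thesis using real c by (simp add: ennreal_less_iff)
  qed simp
qed

abbreviation "rates \<equiv> {c::real. ennreal c > 1 / mu \<and> Psi D (\<lambda>r. r) c > 1}"

text \<open>Where the moment is finite, the right-hand condition says
  \<open>q + t + c * ln (moment t) < 0\<close>; for \<open>q = 1\<close> this is the exponent of the
  union bound.\<close>

lemma Psi_gt_iff:
  assumes "c > 0"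
  shows "Psi D (\<lambda>r. r) c > ereal q \<longleftrightarrow> (\<exists>t. LamD t < ereal (- (t + q) / c))"
proof -
  have "Psi D (\<lambda>r. r) c > ereal q \<longleftrightarrow> ereal (q / c) < Lam_star D (\<lambda>r. r) (- 1 / c)"
    unfolding Psi_def using assms
    by (cases "Lam_star D (\<lambda>r. r) (- 1 / c)") (auto simp: field_simps)
  also have "\<dots> \<longleftrightarrow> (\<exists>t. ereal (q / c) < ereal (t * (- 1 / c)) - LamD t)"
    unfolding Lam_star_def by (simp add: less_SUP_iff)
  also have "\<dots> \<longleftrightarrow> (\<exists>t. LamD t < ereal (- (t + q) / c))"
  proof (rule ex_cong1)
    fix t
    show "ereal (q / c) < ereal (t * (- 1 / c)) - LamD t \<longleftrightarrow> LamD t < ereal (- (t + q) / c)"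
      using assms by (cases "LamD t") (auto simp: field_simps)
  qed
  finally show ?thesis .
qed

text \<open>Here \<open>c > 1 / mu\<close> does its work: \<open>LamD 0 = 0\<close> rules out
  \<open>t = 0\<close>, and for \<open>t < 0\<close> Jensen's inequality gives
  \<open>LamD t \<ge> - t / c\<close>, above the required \<open>- (t + 1) / c\<close>.\<close>

lemma rate_witness:
  assumes "c \<in> rates"
  shows "\<exists>t>0. 1 + t + c * ln (moment t) < 0"
proof -
  have c: "c > 0" "ennreal (1 / c) < mu" using inverse_mu_less[of c] assms by auto
  have "Psi D (\<lambda>r. r) c > ereal 1" using assms by (simp add: one_ereal_def)
  then obtain t where t: "LamD t < ereal (- (t + 1) / c)"
    using Psi_gt_iff[OF c(1), of 1] by blast
  have "t > 0"
  proof (rule ccontr)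
    assume "\<not> t > 0"
    then consider "t = 0" | "t < 0" by linarith
    then show False
    proof cases
      case 1
      then show False using t c LamD_nonneg[of 0] moment_0 by (simp add: zero_ereal_def[symmetric])
    next
      case 2
      have "ereal (- t * (1 / c)) \<le> LamD t" by (rule LamD_neg_ge[OF 2 c(2)]) (use c in simp)
      with t have "ereal (- t * (1 / c)) < ereal (- (t + 1) / c)" by (rule le_less_trans[rotated])
      then show False using c by (simp add: field_simps)
    qed
  qed
  moreover have "ln (moment t) < - (t + 1) / c" using t LamD_nonneg[of t] \<open>t > 0\<close> by simp
  then have "1 + t + c * ln (moment t) < 0" using c by (simp add: field_simps)
  ultimately show ?thesis by blast
qed

lemma rates_nonempty: "rates \<noteq> {}"
proof -
  obtain v where v: "1 / mu = ennreal v" "v \<ge> 0"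
  proof (cases mu)
    case (real \<mu>)
    then show ?thesis using mu_pos that[of "1 / \<mu>"] by (simp add: divide_ennreal[symmetric])
  next
    case top
    then show ?thesis using that[of 0] by simp
  qed
  have L: "ln (moment 1) < 0" using moment_pos[of 1] moment_1 by simp
  \<comment> \<open>Large enough to exceed \<open>1 / mu\<close> and for \<open>t = 1\<close> to be
    a witness: \<open>c * ln (moment 1) \<le> - 3\<close> is below the required
    \<open>- 2\<close>.\<close>
  define c where "c = max (v + 1) (3 / (- ln (moment 1)))"
  have c: "c > 0" "v < c" using v by (auto simp: c_def)
  have "3 / (- ln (moment 1)) \<le> c" unfolding c_def by (rule max.cobounded2)
  then have "3 \<le> c * (- ln (moment 1))" using L by (subst (asm) pos_divide_le_eq) simp_all
  then have "ln (moment 1) < - (1 + 1) / c" using c by (simp add: field_simps)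
  then have "Psi D (\<lambda>r. r) c > ereal 1"
    unfolding Psi_gt_iff[OF c(1), of 1] by (intro exI[of _ 1]) (simp add: LamD_nonneg)
  moreover have "ennreal c > 1 / mu" using v c by (simp add: ennreal_less_iff)
  ultimately show ?thesis by (auto simp: one_ereal_def)
qed

lemma rates_bdd: "bdd_below rates"
  using inverse_mu_less(1) by (intro bdd_belowI[of _ 0]) (auto intro: less_imp_le)

lemma alpha_max_nonneg: "0 \<le> alpha_max D (\<lambda>r. r)"
  unfolding alpha_max_def using rates_nonempty inverse_mu_less(1)
  by (intro cInf_greatest) (auto intro: less_imp_le)

text \<open>The infimum is approached by some rate \<open>c1 < c\<close>, and the witness of
  \<open>c1\<close> serves \<open>c\<close> as well because its \<open>ln (moment t)\<close> is
  negative.\<close>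

lemma above_alpha_max:
  assumes "c > alpha_max D (\<lambda>r. r)"
  shows "\<exists>t>0. 1 + t + c * ln (moment t) < 0 \<and> moment t < 1"
proof -
  obtain c1 where c1: "c1 \<in> rates" "c1 < c"
    using cInf_less_iff[OF rates_nonempty rates_bdd, of c] assms unfolding alpha_max_def by blast
  obtain t where t: "t > 0" "1 + t + c1 * ln (moment t) < 0" using rate_witness[OF c1(1)] by blast
  have "c1 > 0" using c1 inverse_mu_less(1) by blast
  have "c1 * ln (moment t) < 0" using t by linarith
  then have L: "ln (moment t) < 0" using \<open>c1 > 0\<close> by (simp add: mult_less_0_iff)
  then have "c * ln (moment t) \<le> c1 * ln (moment t)" using c1 by (intro mult_right_mono_neg) auto
  moreover have "moment t < 1" using L moment_pos[of t] t by simp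
  ultimately show ?thesis using t by (intro exI[of _ t]) simp
qed

text \<open>If \<open>c > 1 / mu\<close>, take \<open>c1\<close> between \<open>c\<close> and
  \<open>alpha_max\<close>: it can fail to be a rate only because \<open>Psi \<le> 1\<close> there,
  and descending from \<open>c1\<close> to \<open>c\<close> gains \<open>q = c / c1\<close>. If
  \<open>c \<le> 1 / mu\<close>, Jensen's inequality gives even \<open>q = 0\<close>.\<close>

lemma below_alpha_max:
  assumes "0 < c" "c < alpha_max D (\<lambda>r. r)"
  shows "\<exists>q<1. \<forall>t\<ge>0. exp (- (t + q) / c) \<le> moment t"
proof (cases "ennreal c > 1 / mu")
  case True
  define c1 where "c1 = (c + alpha_max D (\<lambda>r. r)) / 2"
  have c1: "c < c1" "c1 < alpha_max D (\<lambda>r. r)" using assms by (auto simp: c1_def)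
  have "c1 \<notin> rates"
    using c1(2) cInf_lower[OF _ rates_bdd, of c1] unfolding alpha_max_def by auto
  moreover have "ennreal c1 > 1 / mu"
    by (rule less_le_trans[OF True ennreal_leI]) (use c1 in simp)
  ultimately have "\<not> Psi D (\<lambda>r. r) c1 > ereal 1" by (simp add: one_ereal_def)
  then have no: "\<not> LamD t < ereal (- (t + 1) / c1)" for t
    using Psi_gt_iff[of c1 1] assms c1 by auto
  have "exp (- (t + c / c1) / c) \<le> moment t" if t: "t \<ge> 0" for t
  proof -
    have "- (t + 1) / c1 \<le> ln (moment t)" using no[of t] LamD_nonneg[OF t] by simp
    moreover have "- (t + c / c1) / c \<le> - (t + 1) / c1"
    proof -
      have "t / c1 \<le> t / c" using assms c1 t by (intro divide_left_mono) auto
      moreover have "(t + c / c1) / c = t / c + 1 / c1" using assms c1 by (simp add: field_simps)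
      ultimately have "(t + 1) / c1 \<le> (t + c / c1) / c" by (simp add: add_divide_distrib)
      then show ?thesis by (simp only: minus_divide_left[symmetric] neg_le_iff_le)
    qed
    ultimately have "- (t + c / c1) / c \<le> ln (moment t)" by linarith
    then show ?thesis using moment_pos[OF t] by (simp add: ln_ge_iff)
  qed
  moreover have "c / c1 < 1" using assms c1 by simp
  ultimately show ?thesis by blast
next
  case False
  have "mu \<noteq> \<infinity>"
  proof
    assume "mu = \<infinity>"
    then have "1 / mu = 0" by simp
    then show False using False assms by (simp add: not_less ennreal_eq_0_iff)
  qed
  then obtain \<mu> where \<mu>: "mu = ennreal \<mu>" "\<mu> \<ge> 0" by (cases mu) auto
  have "\<mu> > 0" using mu_pos \<mu> by simp
  then have "1 / mu = ennreal (1 / \<mu>)" using \<mu> by (simp add: divide_ennreal[symmetric])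
  then have "c \<le> 1 / \<mu>" using False \<open>\<mu> > 0\<close> by (simp add: not_less ennreal_le_iff)
  then have c\<mu>: "\<mu> \<le> 1 / c" using assms \<open>\<mu> > 0\<close> by (simp add: field_simps)
  have "exp (- (t + 0) / c) \<le> moment t" if t: "t \<ge> 0" for t
  proof -
    have "t * \<mu> \<le> t * (1 / c)" using t c\<mu> by (rule mult_left_mono[rotated])
    then have "exp (- (t + 0) / c) \<le> exp (- (t * \<mu>))" by simp
    also have "\<dots> \<le> moment t"
      using Jensen[OF \<mu>, of t] nn_moment[OF t] moment_pos[OF t] by (simp add: ennreal_le_iff)
    finally show ?thesis .
  qed
  then show ?thesis by (intro exI[of _ 0]) simp
qed

end

section \<open>Growth of the truncated mean offspring measure\<close>

context attachment_law
begin

text \<open>The Laplace transform at \<open>\<theta>\<close> of the mean offspring measure, restricted to \<open>b \<le> - ln X < B\<close>.\<close>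

definition cut_moment :: "real \<Rightarrow> real \<Rightarrow> real \<Rightarrow> real" where
  "cut_moment b B \<theta> = (LINT r|D. indicator {exp (- B)<..exp (- b)} r * r powr (\<theta> - 1))"

lemma cut_integrable: "integrable D (\<lambda>r. indicator {exp (- B)<..exp (- b)} r * r powr u)"
proof (rule integrable_const_bound[where B="max (exp (- B) powr u) (exp (- b) powr u)"])
  show "AE r in D. norm (indicator {exp (- B)<..exp (- b)} r * r powr u) \<le> max (exp (- B) powr u) (exp (- b) powr u)"
  proof (rule AE_I2)
    fix r
    show "norm (indicator {exp (- B)<..exp (- b)} r * r powr u) \<le> max (exp (- B) powr u) (exp (- b) powr u)"
    proof (cases "r \<in> {exp (- B)<..exp (- b)}")
      case True
      then have r: "r > 0" "exp (- B) \<le> r" "r \<le> exp (- b)"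
        using exp_gt_zero[of "- B"] by (auto simp del: exp_gt_zero)
      have "r powr u \<le> max (exp (- B) powr u) (exp (- b) powr u)"
      proof (cases "u \<ge> 0")
        case True
        then have "r powr u \<le> exp (- b) powr u" using r by (intro powr_mono2) auto
        then show ?thesis by simp
      next
        case False
        then have "r powr u \<le> exp (- B) powr u" using r by (intro powr_mono2') auto
        then show ?thesis by simp
      qed
      then show ?thesis using True by simp
    qed (simp add: le_max_iff_disj)
  qed
qed measurable

lemma nn_cut_moment:
  "(\<integral>\<^sup>+r. ennreal (indicator {exp (- B)<..exp (- b)} r * r powr (\<theta> - 1)) \<partial>D) = ennreal (cut_moment b B \<theta>)"
  unfolding cut_moment_def by (rule nn_integral_eq_integral[OF cut_integrable]) auto

lemma cut_moment_antimono:
  assumes "\<theta> \<le> \<theta>'" "b > 0"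
  shows "cut_moment b B \<theta>' \<le> cut_moment b B \<theta>"
  unfolding cut_moment_def
proof (rule integral_mono[OF cut_integrable cut_integrable])
  fix r
  show "indicator {exp (- B)<..exp (- b)} r * r powr (\<theta>' - 1) \<le> indicator {exp (- B)<..exp (- b)} r * r powr (\<theta> - 1)"
  proof (cases "r \<in> {exp (- B)<..exp (- b)}")
    case True
    then have "0 < r" "r \<le> 1"
      using exp_gt_zero[of "- B"] assms by (auto simp del: exp_gt_zero intro: order_trans)
    then show ?thesis using True assms by (auto intro: powr_mono')
  qed simp
qed

lemma cut_moment_nonneg: "0 \<le> cut_moment b B \<theta>"
  unfolding cut_moment_def by (intro Bochner_Integration.integral_nonneg) auto

text \<open>Monotone convergence along \<open>b = 1 / (n + 1)\<close> and \<open>B = n + 1\<close>,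
  which exhaust the unit interval. For \<open>\<theta> < 1\<close> the full integral may be
  infinite, hence the formulation by lower bounds \<open>y\<close>.\<close>

lemma cut_moment_tendsto:
  assumes "ennreal y < (\<integral>\<^sup>+r. ennreal (r powr (\<theta> - 1)) \<partial>D)" "y \<ge> 0"
  shows "eventually (\<lambda>n. y < cut_moment (1 / real (Suc n)) (real (Suc n)) \<theta>) sequentially"
proof -
  define F where "F n r = ennreal (indicator {exp (- real (Suc n))<..exp (- (1 / real (Suc n)))} r * r powr (\<theta> - 1))" for n and r :: real
  have F_mono: "F n r \<le> F n' r" if "n \<le> n'" for n n' r
  proof -
    have "1 / real (Suc n') \<le> 1 / real (Suc n)" using that by (intro divide_left_mono) auto
    then have "exp (- real (Suc n')) \<le> exp (- real (Suc n))" "exp (- (1 / real (Suc n))) \<le> exp (- (1 / real (Suc n')))"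
      using that by auto
    then have "indicator {exp (- real (Suc n))<..exp (- (1 / real (Suc n)))} r
      \<le> (indicator {exp (- real (Suc n'))<..exp (- (1 / real (Suc n')))} r :: real)"
      by (auto simp: indicator_def simp del: exp_le_cancel_iff of_nat_Suc)
    then show ?thesis unfolding F_def by (intro ennreal_leI mult_right_mono) auto
  qed
  have F_sup: "AE r in D. ennreal (r powr (\<theta> - 1)) \<le> (SUP n. F n r)"
    using D01
  proof eventually_elim
    case (elim r)
    have L: "- ln r > 0" using elim by simp
    obtain n1 where n1: "1 / real (Suc n1) < - ln r" using reals_Archimedean[OF L] by (auto simp: inverse_eq_divide)
    obtain n2 :: nat where n2: "- ln r < real n2" using reals_Archimedean2 by blast
    define n where "n = max n1 n2"
    have "1 / real (Suc n) \<le> 1 / real (Suc n1)" by (intro divide_left_mono) (auto simp: n_def)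
    then have a: "1 / real (Suc n) < - ln r" using n1 by linarith
    have b: "- ln r < real (Suc n)" using n2 by (simp add: n_def)
    have "- real (Suc n) < ln r" "ln r \<le> - (1 / real (Suc n))" using a b by linarith+
    then have "exp (- real (Suc n)) < exp (ln r)" "exp (ln r) \<le> exp (- (1 / real (Suc n)))"
      by (simp_all only: exp_less_cancel_iff exp_le_cancel_iff)
    then have "r \<in> {exp (- real (Suc n))<..exp (- (1 / real (Suc n)))}" using elim by simp
    then have "ennreal (r powr (\<theta> - 1)) = F n r" by (simp add: F_def)
    also have "\<dots> \<le> (SUP n. F n r)" by (rule SUP_upper) simp
    finally show ?case .
  qed
  have "(\<integral>\<^sup>+r. ennreal (r powr (\<theta> - 1)) \<partial>D) \<le> (\<integral>\<^sup>+r. (SUP n. F n r) \<partial>D)"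
    by (rule nn_integral_mono_AE[OF F_sup])
  also have "\<dots> = (SUP n. (\<integral>\<^sup>+r. F n r \<partial>D))"
  proof (rule nn_integral_monotone_convergence_SUP)
    show "incseq F" unfolding incseq_def le_fun_def using F_mono by blast
    show "F n \<in> borel_measurable D" for n unfolding F_def by measurable
  qed
  also have "\<dots> = (SUP n. ennreal (cut_moment (1 / real (Suc n)) (real (Suc n)) \<theta>))"
    unfolding F_def nn_cut_moment ..
  finally have "ennreal y < (SUP n. ennreal (cut_moment (1 / real (Suc n)) (real (Suc n)) \<theta>))"
    using assms(1) by (rule less_le_trans[rotated])
  then obtain n0 where n0: "ennreal y < ennreal (cut_moment (1 / real (Suc n0)) (real (Suc n0)) \<theta>)"
    by (auto simp: less_SUP_iff)
  have "y < cut_moment (1 / real (Suc n)) (real (Suc n)) \<theta>" if "n \<ge> n0" for n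
  proof -
    have "(\<integral>\<^sup>+r. F n0 r \<partial>D) \<le> (\<integral>\<^sup>+r. F n r \<partial>D)"
      by (intro nn_integral_mono F_mono that)
    then have "ennreal (cut_moment (1 / real (Suc n0)) (real (Suc n0)) \<theta>) \<le> ennreal (cut_moment (1 / real (Suc n)) (real (Suc n)) \<theta>)"
      unfolding F_def nn_cut_moment .
    with n0 have "ennreal y < ennreal (cut_moment (1 / real (Suc n)) (real (Suc n)) \<theta>)" by (rule less_le_trans)
    then show ?thesis using assms(2) by (simp add: ennreal_less_iff)
  qed
  then show ?thesis unfolding eventually_sequentially by blast
qed

text \<open>\<open>r powr (- 1 / 2) \<ge> 1 - ln r / 2 \<ge> 1 + (1 - r) / 2\<close>. This explicit
  excess over 1 persists for all smaller \<open>\<theta>\<close>, where the integrand is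
  larger.\<close>

lemma half_moment: "ennreal (1 + (1 - moment 1) / 2) \<le> (\<integral>\<^sup>+r. ennreal (r powr (1 / 2 - 1)) \<partial>D)"
proof -
  have int: "integrable D (\<lambda>r. 1 + (1 - r powr 1) / 2)"
    by (intro Bochner_Integration.integrable_add integrable_const integrable_divide
        Bochner_Integration.integrable_diff moment_integrable) auto
  have "1 + (1 - moment 1) / 2 = (LINT r|D. 1 + (1 - r powr 1) / 2)"
    unfolding moment_def using moment_integrable[of 1]
    by (subst Bochner_Integration.integral_add) (auto simp: prob_space)
  then have "ennreal (1 + (1 - moment 1) / 2) = (\<integral>\<^sup>+r. ennreal (1 + (1 - r powr 1) / 2) \<partial>D)"
  proof (simp only:, intro nn_integral_eq_integral[symmetric, OF int])
    show "AE r in D. 0 \<le> 1 + (1 - r powr 1) / 2" using D01 by eventually_elim auto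
  qed
  also have "\<dots> \<le> (\<integral>\<^sup>+r. ennreal (r powr (1 / 2 - 1)) \<partial>D)"
  proof (rule nn_integral_mono_AE)
    show "AE r in D. ennreal (1 + (1 - r powr 1) / 2) \<le> ennreal (r powr (1 / 2 - 1))"
      using D01
    proof eventually_elim
      case (elim r)
      have "1 + (- (1 / 2)) * ln r \<le> exp ((- (1 / 2)) * ln r)" by (rule exp_ge_add_one_self)
      moreover have "ln r \<le> r - 1" using elim by (intro ln_le_minus_one) auto
      then have "1 + (1 - r) / 2 \<le> 1 + (- (1 / 2)) * ln r" by simp
      ultimately have "1 + (1 - r) / 2 \<le> exp ((- (1 / 2)) * ln r)" by linarith
      then show ?case using elim by (intro ennreal_leI) (simp add: powr_def)
    qed
  qed
  finally show ?thesis .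
qed

text \<open>The exponents \<open>\<theta> = 1 + t \<ge> 1\<close> are covered by the hypothesis on the moments; for
  \<open>\<theta> < 1\<close> the integral itself exceeds \<open>1\<close>.\<close>

lemma full_moment_growth:
  assumes c: "c > 0" and q: "q < 1" "\<And>t. t \<ge> 0 \<Longrightarrow> exp (- (t + q) / c) \<le> moment t" and z: "z > 1 / c"
  shows "\<exists>\<rho>>1. \<forall>\<theta>\<ge>0. ennreal (\<rho> * exp (- \<theta> * z)) \<le> (\<integral>\<^sup>+r. ennreal (r powr (\<theta> - 1)) \<partial>D)"
proof -
  \<comment> \<open>One term per range of \<open>\<theta>\<close>: the gain \<open>1 - q\<close> in
    the moment bound for \<open>\<theta> \<ge> 1\<close>, the factor
    \<open>exp (\<theta> * z)\<close> for \<open>\<theta>\<close> from \<open>1 / 2\<close> to 1,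
    and the excess in \<open>half_moment\<close> below \<open>1 / 2\<close>.\<close>
  define \<rho> where "\<rho> = min (exp ((1 - q) / c)) (min (exp (z / 2)) (1 + (1 - moment 1) / 2))"
  have zpos: "z > 0" using c z by (meson divide_pos_pos less_trans zero_less_one)
  have "\<rho> > 1" using c q zpos moment_1 by (simp add: \<rho>_def)
  have \<rho>: "\<rho> \<le> exp ((1 - q) / c)" "\<rho> \<le> exp (z / 2)" "\<rho> \<le> 1 + (1 - moment 1) / 2"
    by (auto simp: \<rho>_def)
  have "ennreal (\<rho> * exp (- \<theta> * z)) \<le> (\<integral>\<^sup>+r. ennreal (r powr (\<theta> - 1)) \<partial>D)" if \<theta>: "\<theta> \<ge> 0" for \<theta>
  proof -
    consider "\<theta> \<ge> 1" | "1 / 2 \<le> \<theta>" "\<theta> < 1" | "\<theta> < 1 / 2" by linarith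
    then show ?thesis
    proof cases
      case 1
      have "\<rho> * exp (- \<theta> * z) \<le> exp ((1 - q) / c) * exp (- \<theta> * (1 / c))"
      proof -
        have "\<theta> * (1 / c) \<le> \<theta> * z" using z \<theta> by (intro mult_left_mono) auto
        then show ?thesis using \<rho> by (intro mult_mono) auto
      qed
      also have "\<dots> = exp (- ((\<theta> - 1) + q) / c)"
        by (simp add: diff_divide_distrib add_divide_distrib flip: exp_add)
      also have "\<dots> \<le> moment (\<theta> - 1)" using 1 by (intro q) auto
      finally show ?thesis using nn_moment[of "\<theta> - 1"] 1 by (simp add: ennreal_leI)
    next
      case 2
      have "\<rho> * exp (- \<theta> * z) \<le> exp (z / 2) * exp (- \<theta> * z)"
        using \<rho> by (intro mult_right_mono) auto
      also have "\<dots> = exp ((1 / 2 - \<theta>) * z)" by (simp add: algebra_simps flip: exp_add)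
      also have "\<dots> \<le> 1" using 2 zpos by (simp add: mult_le_0_iff)
      finally have "ennreal (\<rho> * exp (- \<theta> * z)) \<le> (\<integral>\<^sup>+r. 1 \<partial>D)"
        by (simp add: emeasure_space_1 ennreal_le_1)
      also have "\<dots> \<le> (\<integral>\<^sup>+r. ennreal (r powr (\<theta> - 1)) \<partial>D)"
      proof (rule nn_integral_mono_AE)
        show "AE r in D. 1 \<le> ennreal (r powr (\<theta> - 1))"
          using D01
        proof eventually_elim
          case (elim r)
          then have "r powr 0 \<le> r powr (\<theta> - 1)" using 2 by (intro powr_mono') auto
          then show ?case using elim by simp
        qed
      qed
      finally show ?thesis .
    next
      case 3
      have "\<rho> * exp (- \<theta> * z) \<le> \<rho> * 1" using zpos \<theta> \<open>\<rho> > 1\<close> by (intro mult_left_mono) auto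
      then have "ennreal (\<rho> * exp (- \<theta> * z)) \<le> ennreal (1 + (1 - moment 1) / 2)"
        using \<rho> by (intro ennreal_leI) linarith
      also note half_moment
      also have "(\<integral>\<^sup>+r. ennreal (r powr (1 / 2 - 1)) \<partial>D) \<le> (\<integral>\<^sup>+r. ennreal (r powr (\<theta> - 1)) \<partial>D)"
      proof (rule nn_integral_mono_AE)
        show "AE r in D. ennreal (r powr (1 / 2 - 1)) \<le> ennreal (r powr (\<theta> - 1))"
          using D01
        proof eventually_elim
          case (elim r)
          then show ?case using 3 by (intro ennreal_leI powr_mono') auto
        qed
      qed
      finally show ?thesis .
    qed
  qed
  then show ?thesis using \<open>\<rho> > 1\<close> by blast
qed

text \<open>If almost surely \<open>X < exp (- z)\<close>, then
  \<open>moment t \<le> exp (- z * t)\<close>; but the assumed lower bound decays only like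
  \<open>exp (- t / c)\<close>, and \<open>1 / c < z\<close>, which is absurd for large
  \<open>t\<close>.\<close>

lemma mass_near_one:
  assumes c: "c > 0" and q: "\<And>t. t \<ge> 0 \<Longrightarrow> exp (- (t + q) / c) \<le> moment t" and z: "z > 1 / c"
  shows "measure D {exp (- z)..} > 0"
proof (rule ccontr)
  assume "\<not> measure D {exp (- z)..} > 0"
  then have "measure D {exp (- z)..} = 0" using measure_nonneg[of D "{exp (- z)..}"] by linarith
  then have "AE r in D. r \<notin> {exp (- z)..}"
    using sets_D by (intro AE_not_in) (auto simp: null_sets_def emeasure_eq_measure)
  then have AE: "AE r in D. r powr t \<le> exp (- z) powr t" if "t \<ge> 0" for t
    using D01 by eventually_elim (use that in \<open>auto intro!: powr_mono2\<close>)
  have le: "moment t \<le> exp (- z * t)" if "t \<ge> 0" for t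
  proof -
    have "moment t \<le> (LINT r|D. exp (- z) powr t)"
      unfolding moment_def by (rule integral_mono_AE[OF moment_integrable[OF that] integrable_const AE[OF that]])
    then show ?thesis by (simp add: prob_space powr_def mult.commute)
  qed
  define t where "t = max 0 (q / (c * (z - 1 / c)) + 1)"
  have d: "c * (z - 1 / c) > 0" using c z by simp
  have t: "t \<ge> 0" "q / (c * (z - 1 / c)) < t" by (auto simp: t_def)
  have "exp (- (t + q) / c) \<le> exp (- z * t)" using q[OF t(1)] le[OF t(1)] by linarith
  then have "- (t + q) / c \<le> - z * t" by simp
  then have "- (t + q) \<le> - z * t * c" using c by (simp add: pos_divide_le_eq)
  then have "t * (c * (z - 1 / c)) \<le> q" using c by (simp add: algebra_simps)
  moreover have "q < t * (c * (z - 1 / c))" using t(2) d by (simp add: pos_divide_less_eq)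
  ultimately show False by linarith
qed

text \<open>Attachments \<open>r \<ge> exp (- z)\<close> contribute
  \<open>r powr (\<theta> - 1) \<ge> exp (- \<theta> * z)\<close> for all
  \<open>\<theta> \<ge> 0\<close> at once. Half of their mass is a safe \<open>p\<close> once the
  cut is fine enough.\<close>

lemma cut_mass:
  assumes "measure D {exp (- z)..} > 0"
  shows "\<exists>p>0. eventually (\<lambda>n. \<forall>\<theta>\<ge>0. p * exp (- \<theta> * z) \<le> cut_moment (1 / real (Suc n)) (real (Suc n)) \<theta>) sequentially"
proof -
  define J where "J n = {exp (- real (Suc n))<..exp (- (1 / real (Suc n)))}" for n
  have "(\<lambda>n. measure D ({exp (- z)..} \<inter> J n)) \<longlonglongrightarrow> measure D (\<Union>n. {exp (- z)..} \<inter> J n)"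
  proof (rule finite_Lim_measure_incseq)
    show "range (\<lambda>n. {exp (- z)..} \<inter> J n) \<subseteq> events"
      by (intro image_subsetI sets.Int) (simp_all only: sets_D J_def, measurable)
    show "incseq (\<lambda>n. {exp (- z)..} \<inter> J n)"
    proof (rule incseq_SucI)
      fix n
      have "1 / real (Suc (Suc n)) \<le> 1 / real (Suc n)" by (intro divide_left_mono) auto
      then have "exp (- real (Suc (Suc n))) \<le> exp (- real (Suc n))" "exp (- (1 / real (Suc n))) \<le> exp (- (1 / real (Suc (Suc n))))"
        by (simp_all only: exp_le_cancel_iff neg_le_iff_le of_nat_le_iff Suc_le_mono le_SucI order_refl)
      then show "{exp (- z)..} \<inter> J n \<subseteq> {exp (- z)..} \<inter> J (Suc n)"
        unfolding J_def greaterThanAtMost_def by (intro Int_mono order_refl) (simp_all only: atMost_subset_iff greaterThan_subset_iff)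
    qed
  qed
  also have "measure D (\<Union>n. {exp (- z)..} \<inter> J n) = measure D {exp (- z)..}"
  proof (rule measure_eq_AE)
    show "AE r in D. r \<in> (\<Union>n. {exp (- z)..} \<inter> J n) \<longleftrightarrow> r \<in> {exp (- z)..}"
      using D01
    proof eventually_elim
      case (elim r)
      have L: "- ln r > 0" using elim by simp
      obtain n1 where n1: "1 / real (Suc n1) < - ln r" using reals_Archimedean[OF L] by (auto simp: inverse_eq_divide)
      obtain n2 :: nat where n2: "- ln r < real n2" using reals_Archimedean2 by blast
      define n where "n = max n1 n2"
      have "1 / real (Suc n) \<le> 1 / real (Suc n1)" by (intro divide_left_mono) (auto simp: n_def)
      then have a: "ln r \<le> - (1 / real (Suc n))" using n1 by linarith
      have b: "- real (Suc n) < ln r" using n2 by (simp add: n_def)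
      have "exp (- real (Suc n)) < exp (ln r)" "exp (ln r) \<le> exp (- (1 / real (Suc n)))" using a b by simp_all
      then have "r \<in> J n" using elim by (simp add: J_def)
      then show ?case by blast
    qed
  qed (use sets_D in \<open>auto simp: J_def\<close>)
  finally have lim: "(\<lambda>n. measure D ({exp (- z)..} \<inter> J n)) \<longlonglongrightarrow> measure D {exp (- z)..}" .
  define p where "p = measure D {exp (- z)..} / 2"
  have p: "p > 0" using assms by (simp add: p_def)
  have "eventually (\<lambda>n. p < measure D ({exp (- z)..} \<inter> J n)) sequentially"
    by (rule order_tendstoD[OF lim]) (use assms in \<open>simp add: p_def\<close>)
  then have "eventually (\<lambda>n. \<forall>\<theta>\<ge>0. p * exp (- \<theta> * z) \<le> cut_moment (1 / real (Suc n)) (real (Suc n)) \<theta>) sequentially"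
  proof eventually_elim
    case (elim n)
    show ?case
    proof (intro allI impI)
      fix \<theta> :: real assume \<theta>: "\<theta> \<ge> 0"
      let ?S = "{exp (- z)..} \<inter> J n"
      have Sm: "?S \<in> sets D" using sets_D by (simp add: J_def)
      have "p * exp (- \<theta> * z) \<le> measure D ?S * exp (- \<theta> * z)"
        using elim by (intro mult_right_mono) auto
      also have "\<dots> = (LINT r|D. indicator ?S r * exp (- \<theta> * z))"
        using Sm sets_eq_imp_space_eq[OF sets_D] by simp
      also have "\<dots> \<le> cut_moment (1 / real (Suc n)) (real (Suc n)) \<theta>"
        unfolding cut_moment_def
      proof (rule integral_mono[OF _ cut_integrable])
        show "integrable D (\<lambda>r. indicator ?S r * exp (- \<theta> * z))"
          using Sm by (intro integrable_mult_left integrable_real_indicator) (auto simp: emeasure_eq_measure)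
        fix r
        show "indicator ?S r * exp (- \<theta> * z) \<le> indicator {exp (- real (Suc n))<..exp (- (1 / real (Suc n)))} r * r powr (\<theta> - 1)"
        proof (cases "r \<in> ?S")
          case True
          then have r: "exp (- z) \<le> r" "exp (- real (Suc n)) < r" "r \<le> exp (- (1 / real (Suc n)))"
            by (auto simp: J_def)
          have "exp (- (1 / real (Suc n))) \<le> 1" by simp
          then have r1: "0 < r" "r \<le> 1" using r exp_gt_zero[of "- z"] by linarith+
          have "exp (- \<theta> * z) = exp (- z) powr \<theta>" by (simp add: powr_def mult.commute)
          also have "\<dots> \<le> r powr \<theta>" using r \<theta> by (intro powr_mono2) auto
          also have "\<dots> \<le> r powr (\<theta> - 1)" using r1 by (intro powr_mono') auto
          finally show ?thesis using True r by simp
        qed simp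
      qed
      finally show "p * exp (- \<theta> * z) \<le> cut_moment (1 / real (Suc n)) (real (Suc n)) \<theta>" .
    qed
  qed
  then show ?thesis using p by blast
qed

text \<open>The cut has to work for all \<open>\<theta> \<ge> 0\<close> simultaneously. For large
  \<open>\<theta>\<close> the mass on \<open>- ln X \<le> z1 < z\<close> gives
  \<open>p * exp (\<theta> * (z - z1))\<close>. The remaining compact range is reduced to a finite
  grid by monotonicity in \<open>\<theta>\<close>. The second conclusion provides the end point at
  which the tilted sum exceeds the total weight, later bounded by \<open>exp B\<close>.\<close>

lemma cut_moment_growth:
  assumes c: "c > 0" and q: "q < 1" "\<forall>t\<ge>0. exp (- (t + q) / c) \<le> moment t" and z: "z > 1 / c"
  shows "\<exists>\<rho>>1. \<exists>b>0. \<exists>B>b. \<exists>\<Theta>\<ge>0. (\<forall>\<theta>\<ge>0. \<rho> \<le> exp (\<theta> * z) * cut_moment b B \<theta>)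
    \<and> exp B < exp (\<Theta> * z) * cut_moment b B \<Theta>"
proof -
  obtain \<rho>0 where \<rho>0: "\<rho>0 > 1" "\<And>\<theta>. \<theta> \<ge> 0 \<Longrightarrow> ennreal (\<rho>0 * exp (- \<theta> * z)) \<le> (\<integral>\<^sup>+r. ennreal (r powr (\<theta> - 1)) \<partial>D)"
    using full_moment_growth[OF c q(1) q(2)[rule_format] z] by blast
  define z1 where "z1 = (z + 1 / c) / 2"
  have z1: "1 / c < z1" "z1 < z" using z by (auto simp: z1_def)
  have zpos: "z > 0" using c z by (meson divide_pos_pos less_trans zero_less_one)
  obtain p where p: "p > 0" and evp: "eventually (\<lambda>n. \<forall>\<theta>\<ge>0. p * exp (- \<theta> * z1) \<le> cut_moment (1 / real (Suc n)) (real (Suc n)) \<theta>) sequentially"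
    using cut_mass[OF mass_near_one[OF c q(2)[rule_format] z1(1)]] by blast
  \<comment> \<open>The cube root leaves room twice: \<open>\<rho>\<^sup>2 < \<rho>0\<close>
    strictly at the grid points, and one more factor \<open>\<rho>\<close> for moving to the grid.
    The cap 2 matches the bound beyond \<open>\<Theta>1\<close>.\<close>
  define \<rho> where "\<rho> = min 2 (\<rho>0 powr (1 / 3))"
  have \<rho>1: "\<rho> > 1" using \<rho>0(1) by (simp add: \<rho>_def)
  have \<rho>3: "\<rho> ^ 3 \<le> \<rho>0"
  proof -
    have "\<rho> ^ 3 \<le> (\<rho>0 powr (1 / 3)) ^ 3" using \<rho>1 by (intro power_mono) (auto simp: \<rho>_def)
    also have "\<dots> = \<rho>0" using \<rho>0(1) by (simp add: powr_power)
    finally show ?thesis .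
  qed
  have "\<rho> ^ 2 < \<rho> ^ 3" using \<rho>1 by (intro power_strict_increasing) auto
  with \<rho>3 have \<rho>2: "\<rho> ^ 2 < \<rho>0" by linarith
  \<comment> \<open>Mesh width such that a step costs exactly the factor
    \<open>exp (h * z) = \<rho>\<close>.\<close>
  define h where "h = ln \<rho> / z"
  have h: "h > 0" using \<rho>1 zpos by (simp add: h_def)
  have exph: "exp (- h * z) = 1 / \<rho>" using \<rho>1 zpos by (simp add: h_def exp_minus inverse_eq_divide)
  define \<Theta>1 where "\<Theta>1 = max 0 (ln (2 / p) / (z - z1))"
  have big: "2 \<le> p * exp (\<theta> * (z - z1))" if "\<theta> \<ge> \<Theta>1" for \<theta>
  proof -
    have "ln (2 / p) / (z - z1) \<le> \<theta>" using that by (simp add: \<Theta>1_def)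
    then have "ln (2 / p) \<le> \<theta> * (z - z1)" using z1 by (simp add: pos_divide_le_eq)
    then have "exp (ln (2 / p)) \<le> exp (\<theta> * (z - z1))" by simp
    then show ?thesis using p by (simp add: field_simps)
  qed
  define K where "K = nat \<lceil>\<Theta>1 / h\<rceil>"
  have grid: "eventually (\<lambda>n. \<rho> ^ 2 < exp (real i * h * z) * cut_moment (1 / real (Suc n)) (real (Suc n)) (real i * h)) sequentially" for i :: nat
  proof -
    have "ennreal (\<rho> ^ 2 * exp (- (real i * h) * z)) < ennreal (\<rho>0 * exp (- (real i * h) * z))"
      using \<rho>0(1) by (intro ennreal_lessI mult_strict_right_mono mult_pos_pos \<rho>2) auto
    also have "\<dots> \<le> (\<integral>\<^sup>+r. ennreal (r powr (real i * h - 1)) \<partial>D)"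
      using h by (intro \<rho>0) auto
    finally have "eventually (\<lambda>n. \<rho> ^ 2 * exp (- (real i * h) * z) < cut_moment (1 / real (Suc n)) (real (Suc n)) (real i * h)) sequentially"
      by (rule cut_moment_tendsto) simp
    then show ?thesis
      by eventually_elim (simp add: exp_minus field_simps)
  qed
  have "eventually (\<lambda>n. \<forall>i\<in>{..K}. \<rho> ^ 2 < exp (real i * h * z) * cut_moment (1 / real (Suc n)) (real (Suc n)) (real i * h)) sequentially"
    by (intro eventually_ball_finite ballI grid) simp
  with evp eventually_ge_at_top[of 1] have "eventually (\<lambda>n. (\<forall>\<theta>\<ge>0. p * exp (- \<theta> * z1) \<le> cut_moment (1 / real (Suc n)) (real (Suc n)) \<theta>) \<and> 1 \<le> n \<and>
    (\<forall>i\<in>{..K}. \<rho> ^ 2 < exp (real i * h * z) * cut_moment (1 / real (Suc n)) (real (Suc n)) (real i * h))) sequentially"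
    by (intro eventually_conj)
  then obtain n where "(\<forall>\<theta>\<ge>0. p * exp (- \<theta> * z1) \<le> cut_moment (1 / real (Suc n)) (real (Suc n)) \<theta>) \<and> 1 \<le> n \<and>
    (\<forall>i\<in>{..K}. \<rho> ^ 2 < exp (real i * h * z) * cut_moment (1 / real (Suc n)) (real (Suc n)) (real i * h))"
    using eventually_happens'[OF sequentially_bot] by blast
  then have n: "\<And>\<theta>. \<theta> \<ge> 0 \<Longrightarrow> p * exp (- \<theta> * z1) \<le> cut_moment (1 / real (Suc n)) (real (Suc n)) \<theta>" "1 \<le> n"
    "\<And>i. i \<le> K \<Longrightarrow> \<rho> ^ 2 < exp (real i * h * z) * cut_moment (1 / real (Suc n)) (real (Suc n)) (real i * h)"
    by simp_all
  define b where "b = 1 / real (Suc n)"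
  define B where "B = real (Suc n)"
  have bB: "b > 0" "b < B"
  proof -
    show "b > 0" by (simp add: b_def)
    have "b \<le> 1" by (simp add: b_def)
    moreover have "1 < B" using n(2) by (simp add: B_def)
    ultimately show "b < B" by linarith
  qed
  have mass: "p * exp (\<theta> * (z - z1)) \<le> exp (\<theta> * z) * cut_moment b B \<theta>" if "\<theta> \<ge> 0" for \<theta>
  proof -
    have "exp (\<theta> * z) * (p * exp (- \<theta> * z1)) \<le> exp (\<theta> * z) * cut_moment b B \<theta>"
      using n(1)[OF that] unfolding b_def B_def by (intro mult_left_mono) auto
    moreover have "exp (\<theta> * z) * (p * exp (- \<theta> * z1)) = p * exp (\<theta> * (z - z1))"
    proof -
      have "exp (\<theta> * z) * exp (- \<theta> * z1) = exp (\<theta> * (z - z1))"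
        by (simp add: algebra_simps flip: exp_add)
      then show ?thesis by (metis mult.left_commute)
    qed
    ultimately show ?thesis by (simp only:)
  qed
  have main: "\<rho> \<le> exp (\<theta> * z) * cut_moment b B \<theta>" if \<theta>: "\<theta> \<ge> 0" for \<theta>
  proof (cases "\<theta> \<ge> \<Theta>1")
    case True
    have "\<rho> \<le> 2" by (simp add: \<rho>_def)
    then show ?thesis using big[OF True] mass[OF \<theta>] by linarith
  next
    case False
    define i where "i = nat \<lceil>\<theta> / h\<rceil>"
    have th0: "0 \<le> \<theta> / h" using \<theta> h by simp
    have "\<theta> / h \<le> \<Theta>1 / h" using False h by (intro divide_right_mono) auto
    then have iK: "i \<le> K" unfolding i_def K_def by (intro nat_mono ceiling_mono)
    have "\<theta> / h \<le> real i" "real i \<le> \<theta> / h + 1" using th0 unfolding i_def by linarith+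
    then have i: "\<theta> \<le> real i * h" "real i * h \<le> \<theta> + h"
      using h by (auto simp: field_simps)
    \<comment> \<open>Go to the next grid point above \<open>\<theta>\<close>:
      \<open>cut_moment\<close> decreases in \<open>\<theta>\<close>, and the exponential changes by
      at most \<open>\<rho>\<close>.\<close>
    have "\<rho> = \<rho> ^ 2 * (1 / \<rho>)" using \<rho>1 by (simp add: power2_eq_square)
    also have "\<dots> \<le> (exp (real i * h * z) * cut_moment b B (real i * h)) * exp (- h * z)"
      using n(3)[OF iK] \<rho>1 unfolding exph b_def B_def by (intro mult_right_mono) auto
    also have "\<dots> = exp ((real i * h - h) * z) * cut_moment b B (real i * h)"
      by (simp add: algebra_simps flip: exp_add)
    also have "\<dots> \<le> exp (\<theta> * z) * cut_moment b B \<theta>"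
      using i zpos bB by (intro mult_mono cut_moment_antimono cut_moment_nonneg) auto
    finally show ?thesis .
  qed
  \<comment> \<open>Solves \<open>p * exp (\<Theta> * (z - z1)) = exp (B + 1)\<close>, unless the
    solution is negative.\<close>
  define \<Theta> where "\<Theta> = max 0 (ln (exp (B + 1) / p) / (z - z1))"
  have \<Theta>0: "\<Theta> \<ge> 0" by (simp add: \<Theta>_def)
  have "exp B < exp (\<Theta> * z) * cut_moment b B \<Theta>"
  proof -
    have "ln (exp (B + 1) / p) / (z - z1) \<le> \<Theta>" by (simp add: \<Theta>_def)
    then have "ln (exp (B + 1) / p) \<le> \<Theta> * (z - z1)" using z1 by (subst (asm) pos_divide_le_eq) auto
    then have "exp (ln (exp (B + 1) / p)) \<le> exp (\<Theta> * (z - z1))" by (simp only: exp_le_cancel_iff)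
    then have "exp (B + 1) \<le> p * exp (\<Theta> * (z - z1))" using p by (simp add: field_simps)
    moreover have "exp B < exp (B + 1)" by simp
    ultimately show ?thesis using mass[OF \<Theta>0] by linarith
  qed
  then show ?thesis
    by (rule_tac exI, rule_tac conjI[OF \<rho>1], rule_tac exI, rule_tac conjI[OF bB(1)], rule_tac exI, rule_tac conjI[OF bB(2)],
        rule_tac exI, rule_tac conjI[OF \<Theta>0], intro conjI allI impI main)
qed

end

section \<open>Choice of the parameters and the limits\<close>

lemma prod_list_map_mult_const:
  "prod_list (map (\<lambda>t. \<beta> * w t) \<tau>) = \<beta> ^ length \<tau> * prod_list (map w \<tau>)" for \<beta> :: real
  by (induction \<tau>) auto

text \<open>In order: the Chebyshev error is at most \<open>1 / 2\<close>; rounding up to a whole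
  number of slots costs at most \<open>\<epsilon>\<close> per generation; exponential growth beats
  \<open>2 * R\<^sup>2\<close> for \<open>R\<close> linear in \<open>k\<close>.\<close>

lemma eventually_block_length:
  fixes a L :: real
  assumes "L > 0" "\<epsilon> > 0" "a > 0"
  shows "eventually (\<lambda>k. 1 \<le> k \<and> V \<le> real k * \<epsilon>\<^sup>2 / 2 \<and> d \<le> real k * \<epsilon> \<and>
    2 * (real k * a + 1)\<^sup>2 \<le> exp (real k * (L / 2)) / 2) sequentially"
proof (intro eventually_conj)
  show "eventually (\<lambda>k::nat. 1 \<le> k) sequentially" by (rule eventually_ge_at_top)
  have "filterlim (\<lambda>k. (\<epsilon>\<^sup>2 / 2) * real k) at_top sequentially"
    using assms by (intro filterlim_tendsto_pos_mult_at_top[OF tendsto_const] filterlim_real_sequentially) auto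
  then have "eventually (\<lambda>k. V \<le> (\<epsilon>\<^sup>2 / 2) * real k) sequentially" unfolding filterlim_at_top by blast
  then show "eventually (\<lambda>k. V \<le> real k * \<epsilon>\<^sup>2 / 2) sequentially" by (simp add: mult.commute)
  have "filterlim (\<lambda>k. \<epsilon> * real k) at_top sequentially"
    using assms by (intro filterlim_tendsto_pos_mult_at_top[OF tendsto_const] filterlim_real_sequentially) auto
  then have "eventually (\<lambda>k. d \<le> \<epsilon> * real k) sequentially" unfolding filterlim_at_top by blast
  then show "eventually (\<lambda>k. d \<le> real k * \<epsilon>) sequentially" by (simp add: mult.commute)
  \<comment> \<open>Chosen so that
    \<open>y * (16 * (a + 1)\<^sup>2 / L\<^sup>2) = 1\<close>.\<close>
  define y where "y = L\<^sup>2 / (16 * (a + 1)\<^sup>2)"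
  have y: "y > 0" using assms by (simp add: y_def)
  have "filterlim (\<lambda>k. L / 2 * real k) at_top sequentially"
    using assms by (intro filterlim_tendsto_pos_mult_at_top[OF tendsto_const] filterlim_real_sequentially) auto
  from filterlim_compose[OF tendsto_power_div_exp_0[of 2] this]
  have "((\<lambda>k. (L / 2 * real k)\<^sup>2 / exp (L / 2 * real k)) \<longlongrightarrow> 0) sequentially" .
  then have "eventually (\<lambda>k. (L / 2 * real k)\<^sup>2 / exp (L / 2 * real k) < y) sequentially"
    by (rule order_tendstoD) (rule y)
  with eventually_ge_at_top[of 1]
  show "eventually (\<lambda>k. 2 * (real k * a + 1)\<^sup>2 \<le> exp (real k * (L / 2)) / 2) sequentially"
  proof eventually_elim
    case (elim k)
    have "(L / 2 * real k)\<^sup>2 < y * exp (L / 2 * real k)" using elim by (simp add: pos_divide_less_eq)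
    then have "(L / 2 * real k)\<^sup>2 * (16 * (a + 1)\<^sup>2 / L\<^sup>2) \<le> (y * exp (L / 2 * real k)) * (16 * (a + 1)\<^sup>2 / L\<^sup>2)"
      by (intro mult_right_mono) auto
    moreover have "(L / 2 * real k)\<^sup>2 * (16 * (a + 1)\<^sup>2 / L\<^sup>2) = 4 * (real k * (a + 1))\<^sup>2"
      using assms by (simp add: power2_eq_square field_simps)
    moreover have "(y * exp (L / 2 * real k)) * (16 * (a + 1)\<^sup>2 / L\<^sup>2) = exp (real k * (L / 2))"
      using assms by (simp add: y_def mult.commute)
    moreover have "(real k * a + 1)\<^sup>2 \<le> (real k * (a + 1))\<^sup>2"
      using elim assms by (intro power_mono) (auto simp: algebra_simps)
    ultimately show ?case by linarith
  qed
qed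

context iid_attachment
begin

lemma AE_height_lower_rate:
  assumes law: "attachment_law D" and ac: "absolutely_continuous lborel D"
    and c: "c > 0" and q: "q < 1" "\<forall>t\<ge>0. exp (- (t + q) / c) \<le> attachment_law.moment D t"
    and c': "c' > 0" "c' < c"
  shows "AE \<omega> in M. eventually (\<lambda>n. c' * ln (real n) \<le> real (height (\<lambda>i. Xs i \<omega>) n)) sequentially"
proof -
  interpret D: attachment_law D by fact
  \<comment> \<open>The log-distance allowed per generation: above \<open>1 / c\<close>, so that the
    population grows, and below \<open>1 / c'\<close>, which leaves room for the errors.\<close>
  define z where "z = (1 / c + 1 / c') / 2"
  have "1 / c < 1 / c'" using c c' by (intro divide_strict_left_mono) auto
  then have z: "1 / c < z" "z < 1 / c'" by (auto simp: z_def)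
  have zpos: "z > 0" using z c by (meson divide_pos_pos less_trans zero_less_one)
  obtain \<rho> b B \<Theta> where \<rho>: "\<rho> > 1" and b: "b > 0" "b < B" and \<Theta>: "\<Theta> \<ge> 0"
    and grow: "\<forall>\<theta>\<ge>0. \<rho> \<le> exp (\<theta> * z) * D.cut_moment b B \<theta>"
    and final: "exp B < exp (\<Theta> * z) * D.cut_moment b B \<Theta>"
    using D.cut_moment_growth[OF c q z(1)] by (elim exE conjE)
  define L where "L = ln \<rho>"
  have L: "L > 0" "exp L = \<rho>" using \<rho> by (auto simp: L_def)
  \<comment> \<open>The first term keeps all distance errors below \<open>1 / c' - z\<close>, the
    second keeps the loss \<open>\<Theta> * \<epsilon>\<close> from the tilt below a quarter of the
    growth rate \<open>L\<close>.\<close>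
  define \<epsilon> where "\<epsilon> = min ((1 / c' - z) / 4) (L / (4 * (\<Theta> + 1)))"
  have \<epsilon>: "\<epsilon> > 0" "z + 4 * \<epsilon> \<le> 1 / c'"
  proof -
    show "\<epsilon> > 0" using z L \<Theta> by (simp add: \<epsilon>_def)
    have "\<epsilon> \<le> (1 / c' - z) / 4" unfolding \<epsilon>_def by (rule min.cobounded1)
    then have "\<epsilon> * 4 \<le> 1 / c' - z" by (subst (asm) pos_le_divide_eq) simp_all
    then show "z + 4 * \<epsilon> \<le> 1 / c'" by (simp add: algebra_simps)
  qed
  have \<Theta>\<epsilon>: "\<Theta> * \<epsilon> \<le> L / 4"
  proof -
    have "\<epsilon> \<le> L / (4 * (\<Theta> + 1))" unfolding \<epsilon>_def by (rule min.cobounded2)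
    then have "(\<Theta> + 1) * \<epsilon> \<le> L / 4" using \<Theta> by (simp add: field_simps)
    moreover have "(\<Theta> + 1) * \<epsilon> = \<Theta> * \<epsilon> + \<epsilon>" by (simp add: algebra_simps)
    ultimately show ?thesis using \<epsilon> by linarith
  qed
  define \<beta> where "\<beta> = exp (- (L / 4))"
  have \<beta>: "0 < \<beta>" "\<beta> < 1" using L by (auto simp: \<beta>_def)
  define \<delta> where "\<delta> = b / 2"
  have \<delta>: "\<delta> > 0" using b by (simp add: \<delta>_def)
  \<comment> \<open>\<open>R\<close> is about \<open>k * a\<close> slots: a path is at most
    \<open>k * (z + \<epsilon>)\<close> long, its widening takes another
    \<open>k * \<epsilon>\<close>, and rounding up \<open>R\<close> a third.\<close>
  define a where "a = (z + 2 * \<epsilon>) / \<delta>"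
  have a: "a > 0" using zpos \<epsilon> \<delta> by (simp add: a_def)
  obtain k where k: "1 \<le> k" "(B + z)\<^sup>2 \<le> real k * \<epsilon>\<^sup>2 / 2" "\<delta> \<le> real k * \<epsilon>"
    "2 * (real k * a + 1)\<^sup>2 \<le> exp (real k * (L / 2)) / 2"
    using eventually_happens'[OF sequentially_bot eventually_block_length[OF L(1) \<epsilon>(1) a, of "(B + z)\<^sup>2" \<delta>]]
    by (elim exE conjE)
  define R where "R = nat \<lceil>real k * a\<rceil>"
  have "0 < real k * a" using k a by simp
  then have R: "R > 0" "real k * a \<le> real R" "real R \<le> real k * a + 1" unfolding R_def by linarith+
  have \<delta>R: "real k * (z + 2 * \<epsilon>) \<le> \<delta> * real R" "\<delta> * real R \<le> real k * (z + 3 * \<epsilon>)"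
  proof -
    have *: "\<delta> * (real k * a) = real k * (z + 2 * \<epsilon>)" using \<delta> by (simp add: a_def)
    have "\<delta> * (real k * a) \<le> \<delta> * real R" "\<delta> * real R \<le> \<delta> * (real k * a + 1)"
      using R \<delta> by (auto intro: mult_left_mono)
    moreover have "\<delta> * (real k * a + 1) = \<delta> * (real k * a) + \<delta>" by (simp add: distrib_left)
    moreover have "real k * (z + 3 * \<epsilon>) = real k * (z + 2 * \<epsilon>) + real k * \<epsilon>" by (simp add: algebra_simps)
    ultimately show "real k * (z + 2 * \<epsilon>) \<le> \<delta> * real R" "\<delta> * real R \<le> real k * (z + 3 * \<epsilon>)"
      using * k(3) by linarith+
  qed
  \<comment> \<open>Bounds the type width once \<open>k\<close> is fixed:
    \<open>2 * \<eta> * k\<close> must stay below \<open>b - \<delta> = b / 2\<close> and below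
    \<open>k * \<epsilon>\<close>.\<close>
  define e where "e = min (b / (4 * real k)) (\<epsilon> / 2)"
  have e: "e > 0" "e \<le> b / (4 * real k)" "e \<le> \<epsilon> / 2" using b k \<epsilon> by (auto simp: e_def)
  obtain nr0 where nr0: "inverse (real (Suc nr0)) < e / (B - b)"
    using reals_Archimedean[of "e / (B - b)"] e b by auto
  define nr where "nr = Suc nr0"
  define \<eta> where "\<eta> = (B - b) / real nr"
  have nr: "real nr > 0" by (simp add: nr_def)
  have \<eta>: "\<eta> > 0" "\<eta> \<le> e" "real nr * \<eta> = B - b"
  proof -
    show "\<eta> > 0" "real nr * \<eta> = B - b" using b nr by (auto simp: \<eta>_def)
    have "(B - b) * inverse (real nr) \<le> (B - b) * (e / (B - b))"
      using nr0 b unfolding nr_def by (intro mult_left_mono) auto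
    also have "\<dots> = e" using b by simp
    finally show "\<eta> \<le> e" by (simp only: \<eta>_def divide_inverse)
  qed
  have \<eta>k: "2 * \<eta> * real k + \<delta> \<le> b" "2 * \<eta> * real k \<le> real k * \<epsilon>"
  proof -
    have kp: "real k > 0" using k by simp
    have "\<eta> * real k \<le> b / (4 * real k) * real k" using \<eta> e by (intro mult_right_mono) linarith+
    also have "\<dots> = b / 4" using kp by simp
    finally show "2 * \<eta> * real k + \<delta> \<le> b" by (simp add: \<delta>_def)
    have "\<eta> * real k \<le> \<epsilon> / 2 * real k" using \<eta> e by (intro mult_right_mono) linarith+
    moreover have "2 * \<eta> * real k = 2 * (\<eta> * real k)" "real k * \<epsilon> = 2 * (\<epsilon> / 2 * real k)" by simp_all
    ultimately show "2 * \<eta> * real k \<le> real k * \<epsilon>" by linarith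
  qed
  define J where "J = {exp (- B)<..exp (- b)}"
  \<comment> \<open>\<open>[b, B)\<close> is cut into \<open>nr\<close> intervals of length
    \<open>\<eta>\<close>; \<open>nr\<close> itself, outside \<open>I\<close>, is the type of
    discarded attachments.\<close>
  define ty where "ty r = (if r \<in> J then nat \<lfloor>(- ln r - b) / \<eta>\<rfloor> else nr)" for r
  define I where "I = {..<nr}"
  define s where "s t = b + real t * \<eta>" for t
  have J_log: "b \<le> - ln r" "- ln r < B" "r > 0" if "r \<in> J" for r
  proof -
    have r: "exp (- B) < r" "r \<le> exp (- b)" using that by (auto simp: J_def)
    then show "r > 0" using exp_gt_zero[of "- B"] by linarith
    then have "r = exp (ln r)" by simp
    then have "exp (- B) < exp (ln r)" "exp (ln r) \<le> exp (- b)" using r by simp_all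
    then show "b \<le> - ln r" "- ln r < B" by (simp_all only: exp_less_cancel_iff exp_le_cancel_iff, (linarith+)?)
  qed
  have ty_J: "ty r < nr \<and> s (ty r) \<le> - ln r \<and> - ln r < s (ty r) + \<eta>" if r: "r \<in> J" for r
  proof -
    define v where "v = (- ln r - b) / \<eta>"
    have v: "0 \<le> v" "v < real nr"
    proof -
      show "0 \<le> v" using J_log[OF r] \<eta> by (simp add: v_def)
      have "- ln r - b < real nr * \<eta>" using J_log[OF r] \<eta> by simp
      then show "v < real nr" using \<eta> by (simp add: v_def pos_divide_less_eq)
    qed
    have t: "ty r = nat \<lfloor>v\<rfloor>" using r by (simp add: ty_def v_def)
    define i where "i = nat \<lfloor>v\<rfloor>"
    have i: "real i \<le> v" "v < real i + 1" unfolding i_def using v by linarith+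
    then have "real i < real nr" using v by linarith
    moreover have "v * \<eta> = - ln r - b" using \<eta> by (simp add: v_def)
    moreover have "real i * \<eta> \<le> v * \<eta>" "v * \<eta> < (real i + 1) * \<eta>"
      using mult_right_mono[OF i(1), of \<eta>] mult_strict_right_mono[OF i(2), of \<eta>] \<eta> by simp_all
    moreover have "(real i + 1) * \<eta> = real i * \<eta> + \<eta>" by (simp add: distrib_right)
    ultimately show ?thesis unfolding t i_def[symmetric] s_def of_nat_less_iff by (intro conjI) linarith+
  qed
  have ty_I: "r \<in> J" if "ty r \<in> I" for r
    using that by (cases "r \<in> J") (auto simp: ty_def I_def)
  interpret TA: typed_attachment M Xs D ty I s \<eta> b
  proof unfold_locales
    show "absolutely_continuous lborel D" by (rule ac)
    have "(\<lambda>r. nat \<lfloor>(- ln r - b) / \<eta>\<rfloor>) \<in> borel \<rightarrow>\<^sub>M count_space UNIV" by measurable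
    then show "ty \<in> borel \<rightarrow>\<^sub>M count_space UNIV"
      unfolding ty_def[abs_def] J_def by (intro measurable_If_set) auto
    show "finite I" by (simp add: I_def)
    show "b \<le> s t" if "t \<in> I" for t using \<eta> by (simp add: s_def)
    show "exp (- (s (ty r) + \<eta>)) < r \<and> r \<le> exp (- s (ty r))" if "ty r \<in> I" for r
    proof -
      have r: "r \<in> J" by (rule ty_I[OF that])
      have "exp (- (s (ty r) + \<eta>)) < exp (ln r)" "exp (ln r) \<le> exp (- s (ty r))"
        using ty_J[OF r] by (simp_all only: exp_less_cancel_iff exp_le_cancel_iff, (linarith+)?)
      then show ?thesis using J_log(3)[OF r] by simp
    qed
  qed (use \<eta> b in auto)
  have sp: "space D = UNIV" using sets_eq_imp_space_eq[OF D_sets] by simp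
  have inv_J: "1 / r \<le> exp B" "0 < 1 / r" if "r \<in> J" for r
  proof -
    have "exp (- B) \<le> r" using that by (simp add: J_def)
    then have "1 / r \<le> 1 / exp (- B)" using J_log(3)[OF that] by (intro divide_left_mono) auto
    also have "1 / exp (- B) = exp B" by (simp add: exp_minus inverse_eq_divide)
    finally show "1 / r \<le> exp B" .
    show "0 < 1 / r" using J_log(3)[OF that] by simp
  qed
  have w_int: "integrable D (\<lambda>r. indicator {r. ty r = t} r * (1 / r))" if t: "t \<in> I" for t
  proof (rule D.integrable_const_bound[where B="exp B"])
    show "AE r in D. norm (indicator {r. ty r = t} r * (1 / r)) \<le> exp B"
    proof (rule AE_I2)
      fix r
      show "norm (indicator {r. ty r = t} r * (1 / r)) \<le> exp B"
        using inv_J[OF ty_I[of r]] t by (auto simp: indicator_def)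
    qed
    show "(\<lambda>r. indicator {r. ty r = t} r * (1 / r)) \<in> borel_measurable D"
      using TA.ty_sets[of t] D_sets by (intro borel_measurable_times borel_measurable_indicator) auto
  qed
  have w0: "0 \<le> TA.w t" if "t \<in> I" for t
    unfolding TA.w_def
  proof (rule Bochner_Integration.integral_nonneg)
    fix r
    show "0 \<le> indicator {r. ty r = t} r * (1 / r)"
      using inv_J(2)[OF ty_I[of r]] that by (auto simp: indicator_def)
  qed
  have split_type: "(\<Sum>t\<in>I. indicator {r. ty r = t} r * u t) = (indicator J r * u (ty r) :: real)" for r u
  proof (cases "r \<in> J")
    case True
    then have "ty r \<in> I" using ty_J by (simp add: I_def)
    have "(\<Sum>t\<in>I. indicator {r. ty r = t} r * u t) = (\<Sum>t\<in>I. if ty r = t then u t else 0)"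
      by (intro sum.cong) (auto simp: indicator_def)
    then show ?thesis using True \<open>ty r \<in> I\<close> by (simp add: I_def)
  next
    case False
    then have "ty r \<notin> I" using ty_I by blast
    then show ?thesis using False by (intro sum.neutral[THEN trans]) (auto simp: indicator_def)
  qed
  have sum_w: "(\<Sum>t\<in>I. TA.w t * u t) = (LINT r|D. indicator J r * (1 / r * u (ty r)))" for u
  proof -
    have "(\<Sum>t\<in>I. TA.w t * u t) = (\<Sum>t\<in>I. LINT r|D. indicator {r. ty r = t} r * (1 / r) * u t)"
      by (simp only: TA.w_def integral_mult_left_zero)
    also have "\<dots> = (LINT r|D. (\<Sum>t\<in>I. indicator {r. ty r = t} r * (1 / r) * u t))"
      by (rule Bochner_Integration.integral_sum[symmetric]) (intro integrable_mult_left w_int)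
    also have "\<dots> = (LINT r|D. indicator J r * (1 / r * u (ty r)))"
    proof (rule Bochner_Integration.integral_cong[OF refl])
      show "(\<Sum>t\<in>I. indicator {r. ty r = t} r * (1 / r) * u t) = indicator J r * (1 / r * u (ty r))" for r
        using split_type[of r "\<lambda>t. 1 / r * u t"] by (simp only: mult.assoc)
    qed
    finally show ?thesis .
  qed
  have int_u: "integrable D (\<lambda>r. indicator J r * (1 / r * u (ty r)))" for u
  proof -
    have "integrable D (\<lambda>r. \<Sum>t\<in>I. indicator {r. ty r = t} r * (1 / r) * u t)"
      by (intro Bochner_Integration.integrable_sum integrable_mult_left w_int)
    moreover have "(\<Sum>t\<in>I. indicator {r. ty r = t} r * (1 / r) * u t) = indicator J r * (1 / r * u (ty r))" for r
      using split_type[of r "\<lambda>t. 1 / r * u t"] by (simp only: mult.assoc)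
    ultimately show ?thesis by (simp only:)
  qed
  \<comment> \<open>Each type is represented by the left end of its interval, which only increases
    the Laplace transform for \<open>\<theta> \<ge> 0\<close>.\<close>
  have W2: "D.cut_moment b B \<theta> \<le> (\<Sum>t\<in>I. TA.w t * exp (- \<theta> * s t))" if \<theta>: "\<theta> \<ge> 0" for \<theta>
    unfolding sum_w D.cut_moment_def J_def[symmetric]
  proof (rule integral_mono[OF D.cut_integrable[of B b, folded J_def] int_u[of "\<lambda>t. exp (- \<theta> * s t)"]])
    fix r
    show "indicator J r * r powr (\<theta> - 1) \<le> indicator J r * (1 / r * exp (- \<theta> * s (ty r)))"
    proof (cases "r \<in> J")
      case True
      have "r powr (\<theta> - 1) = 1 / r * exp (- \<theta> * (- ln r))"
        using J_log(3)[OF True] by (simp add: powr_def left_diff_distrib exp_diff)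
      also have "\<dots> \<le> 1 / r * exp (- \<theta> * s (ty r))"
      proof (rule mult_left_mono)
        have "\<theta> * s (ty r) \<le> \<theta> * (- ln r)" using ty_J[OF True] \<theta> by (intro mult_left_mono) auto
        then show "exp (- \<theta> * (- ln r)) \<le> exp (- \<theta> * s (ty r))" by simp
      qed (use inv_J(2)[OF True] in linarith)
      finally show ?thesis using True by simp
    qed simp
  qed
  have W3: "(\<Sum>t\<in>I. TA.w t) \<le> exp B"
  proof -
    have "(\<Sum>t\<in>I. TA.w t) = (LINT r|D. indicator J r * (1 / r * 1))"
      using sum_w[of "\<lambda>_. 1"] by simp
    also have "\<dots> \<le> (LINT r|D. exp B)"
    proof (rule integral_mono[OF int_u[of "\<lambda>_. 1"]])
      show "indicator J r * (1 / r * 1) \<le> exp B" for r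
        using inv_J(1)[of r] by (cases "r \<in> J") auto
    qed simp
    also have "\<dots> = exp B" by (simp add: D.prob_space)
    finally show ?thesis .
  qed
  \<comment> \<open>The estimates for the number of children divide by \<open>w t\<close>, so types
    of weight 0 are dropped; they contribute nothing to the sums.\<close>
  define Ip where "Ip = {t \<in> I. TA.w t > 0}"
  have Ip: "finite Ip" "Ip \<subseteq> I" by (auto simp: Ip_def I_def)
  have Ip_sum: "(\<Sum>t\<in>Ip. TA.w t * u t) = (\<Sum>t\<in>I. TA.w t * u t)" for u
  proof (rule sum.mono_neutral_left)
    show "\<forall>i\<in>I - Ip. TA.w i * u i = 0"
    proof
      fix i assume "i \<in> I - Ip"
      then have "0 \<le> TA.w i" "\<not> 0 < TA.w i" using w0[of i] by (auto simp: Ip_def)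
      then have "TA.w i = 0" by linarith
      then show "TA.w i * u i = 0" by simp
    qed
  qed (use Ip in \<open>auto simp: I_def\<close>)
  have G: "exp (\<theta> * z) * D.cut_moment b B \<theta> \<le> (\<Sum>t\<in>Ip. TA.w t * exp (\<theta> * (z - s t)))" if "\<theta> \<ge> 0" for \<theta>
  proof -
    have "exp (\<theta> * z) * D.cut_moment b B \<theta> \<le> exp (\<theta> * z) * (\<Sum>t\<in>I. TA.w t * exp (- \<theta> * s t))"
      using W2[OF that] by (intro mult_left_mono) auto
    also have "\<dots> = (\<Sum>t\<in>I. TA.w t * exp (\<theta> * (z - s t)))"
      unfolding sum_distrib_left
    proof (rule sum.cong[OF refl])
      fix t
      have "exp (\<theta> * (z - s t)) = exp (\<theta> * z) * exp (- \<theta> * s t)" by (simp add: algebra_simps flip: exp_add)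
      then show "exp (\<theta> * z) * (TA.w t * exp (- \<theta> * s t)) = TA.w t * exp (\<theta> * (z - s t))" by simp
    qed
    finally show ?thesis unfolding Ip_sum .
  qed
  have Cramer: "\<rho> ^ k * exp (- (\<Theta> * (real k * \<epsilon>))) * (1 - (B + z)\<^sup>2 / (real k * \<epsilon>\<^sup>2))
    \<le> (\<Sum>\<tau> | set \<tau> \<subseteq> Ip \<and> length \<tau> = k \<and> sum_list (map s \<tau>) \<le> real k * (z + \<epsilon>). prod_list (map TA.w \<tau>))"
  proof (rule Cramer_lower_bound[OF Ip(1)])
    show "0 \<le> TA.w t" if "t \<in> Ip" for t using that by (simp add: Ip_def)
    show "\<bar>z - s t\<bar> \<le> B + z" if "t \<in> Ip" for t
    proof -
      have "real t \<le> real nr" using that by (simp add: Ip_def I_def)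
      then have "real t * \<eta> \<le> real nr * \<eta>" using \<eta> by (intro mult_right_mono) auto
      then have "s t \<le> B" "0 \<le> s t" using \<eta> b by (auto simp: s_def)
      then show ?thesis using zpos by linarith
    qed
    show "\<rho> \<le> (\<Sum>t\<in>Ip. TA.w t * exp (\<theta> * (z - s t)))" if "0 \<le> \<theta>" for \<theta>
      using grow[rule_format, OF that] G[OF that] by linarith
    have "(\<Sum>t\<in>Ip. TA.w t) \<le> exp B" using W3 Ip_sum[of "\<lambda>_. 1"] by simp
    then show "(\<Sum>t\<in>Ip. TA.w t) < (\<Sum>t\<in>Ip. TA.w t * exp (\<Theta> * (z - s t)))"
      using final G[OF \<Theta>] by linarith
    have "0 \<le> real k * \<epsilon>\<^sup>2" by simp
    then show "(B + z)\<^sup>2 \<le> real k * \<epsilon>\<^sup>2" using k(2) by linarith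
  qed (use \<rho> \<Theta> k \<epsilon> in auto)
  define T where "T = {\<tau>. set \<tau> \<subseteq> Ip \<and> length \<tau> = k \<and> sum_list (map s \<tau>) \<le> real k * (z + \<epsilon>)}"
  interpret BA: block_attachment M Xs D ty I s \<eta> b T k R \<delta> \<beta>
  proof unfold_locales
    show "finite T"
      by (rule finite_subset[OF _ finite_lists_length_eq[OF Ip(1), of k]]) (auto simp: T_def)
    show "length \<tau> = k \<and> set \<tau> \<subseteq> {t \<in> I. 0 < TA.w t}" if "\<tau> \<in> T" for \<tau>
      using that by (auto simp: T_def Ip_def)
    show "sum_list (map s \<tau>) + 2 * \<eta> * real k \<le> \<delta> * real R" if "\<tau> \<in> T" for \<tau>
    proof -
      have "sum_list (map s \<tau>) \<le> real k * (z + \<epsilon>)" using that by (simp add: T_def)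
      moreover have "real k * (z + \<epsilon>) + real k * \<epsilon> = real k * (z + 2 * \<epsilon>)" by (simp add: algebra_simps)
      ultimately show ?thesis using \<delta>R(1) \<eta>k(2) by linarith
    qed
    have "2 * (real R)\<^sup>2 \<le> 2 * (real k * a + 1)\<^sup>2"
      using R by (intro mult_left_mono power_mono) auto
    also have "\<dots> \<le> exp (real k * (L / 2)) * (1 / 2)" using k(4) by simp
    \<comment> \<open>Exponents per generation: \<open>L\<close> from \<open>\<rho>\<close>, minus
      \<open>L / 4\<close> for \<open>\<beta>\<close>, minus at most \<open>L / 4\<close> for the
      tilt; \<open>L / 2\<close> is left, and the Chebyshev factor is at least
      \<open>1 / 2\<close>.\<close>
    also have "\<dots> \<le> \<beta> ^ k * (\<rho> ^ k * exp (- (\<Theta> * (real k * \<epsilon>)))) * (1 - (B + z)\<^sup>2 / (real k * \<epsilon>\<^sup>2))"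
    proof (rule mult_mono)
      have "\<beta> ^ k * (\<rho> ^ k * exp (- (\<Theta> * (real k * \<epsilon>))))
        = exp (real k * (- (L / 4))) * (exp (real k * L) * exp (- (\<Theta> * (real k * \<epsilon>))))"
        unfolding \<beta>_def L(2)[symmetric] by (simp only: exp_of_nat_mult)
      also have "\<dots> = exp (real k * (- (L / 4)) + (real k * L + - (\<Theta> * (real k * \<epsilon>))))"
        by (simp only: exp_add)
      also have "real k * (- (L / 4)) + (real k * L + - (\<Theta> * (real k * \<epsilon>))) = real k * (3 * L / 4 - \<Theta> * \<epsilon>)"
        by (simp add: field_simps)
      finally have eq: "\<beta> ^ k * (\<rho> ^ k * exp (- (\<Theta> * (real k * \<epsilon>)))) = exp (real k * (3 * L / 4 - \<Theta> * \<epsilon>))" .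
      have "real k * (L / 2) \<le> real k * (3 * L / 4 - \<Theta> * \<epsilon>)"
        using \<Theta>\<epsilon> by (intro mult_left_mono) auto
      then show "exp (real k * (L / 2)) \<le> \<beta> ^ k * (\<rho> ^ k * exp (- (\<Theta> * (real k * \<epsilon>))))"
        unfolding eq by simp
      have "0 < real k * \<epsilon>\<^sup>2" using k \<epsilon> by simp
      then have "(B + z)\<^sup>2 / (real k * \<epsilon>\<^sup>2) \<le> 1 / 2" using k(2) by (simp add: pos_divide_le_eq)
      then show "1 / 2 \<le> 1 - (B + z)\<^sup>2 / (real k * \<epsilon>\<^sup>2)" by linarith
    qed (use \<beta> \<rho> in auto)
    also have "\<dots> = \<beta> ^ k * (\<rho> ^ k * exp (- (\<Theta> * (real k * \<epsilon>))) * (1 - (B + z)\<^sup>2 / (real k * \<epsilon>\<^sup>2)))"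
      by (simp only: mult.assoc)
    also have "\<dots> \<le> \<beta> ^ k * (\<Sum>\<tau>\<in>T. prod_list (map TA.w \<tau>))"
      using Cramer \<beta> unfolding T_def by (intro mult_left_mono) auto
    also have "\<dots> = (\<Sum>\<tau>\<in>T. prod_list (map (\<lambda>t. \<beta> * TA.w t) \<tau>))"
      unfolding sum_distrib_left
      by (rule sum.cong[OF refl]) (simp add: T_def prod_list_map_mult_const)
    finally show "2 * (real R)\<^sup>2 \<le> (\<Sum>\<tau>\<in>T. prod_list (map (\<lambda>t. \<beta> * TA.w t) \<tau>))" .
  qed (use k R \<delta> \<eta>k \<beta> in auto)
  show ?thesis
  proof (rule BA.AE_height_lower)
    have "real k * (z + 3 * \<epsilon>) < real k * (1 / c')" using k \<epsilon> by (intro mult_strict_left_mono) auto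
    then have "\<delta> * real R < real k / c'" using \<delta>R(2) by simp
    then have "c' * (\<delta> * real R) < real k" using c' by (simp add: pos_less_divide_eq mult.commute)
    then show "c' < real k / (\<delta> * real R)" using \<delta> R by (subst pos_less_divide_eq) auto
  qed
qed

end

lemma filterlim_ln_nat: "filterlim (\<lambda>n. ln (real n)) at_top sequentially"
  by (rule filterlim_compose[OF ln_at_top filterlim_real_sequentially])

lemma tendsto_log_rate:
  fixes h :: "nat \<Rightarrow> real"
  assumes lo: "\<And>c. c < \<alpha> \<Longrightarrow> eventually (\<lambda>n. c * ln (real n) \<le> h n) sequentially"
    and up: "\<And>c. c > \<alpha> \<Longrightarrow> \<exists>K. eventually (\<lambda>n. h n \<le> c * ln (real n) + K) sequentially"
  shows "(\<lambda>n. h n / ln (real n)) \<longlonglongrightarrow> \<alpha>"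
proof (rule order_tendstoI)
  have pos: "eventually (\<lambda>n. 0 < ln (real n)) sequentially"
    using filterlim_ln_nat by (simp add: filterlim_at_top_dense)
  fix a assume a: "a < \<alpha>"
  define c where "c = (a + \<alpha>) / 2"
  have c: "a < c" "c < \<alpha>" using a by (auto simp: c_def)
  show "eventually (\<lambda>n. a < h n / ln (real n)) sequentially"
    using lo[OF c(2)] pos
  proof eventually_elim
    case (elim n)
    have "a * ln (real n) < c * ln (real n)" using c elim by (intro mult_strict_right_mono) auto
    then have "a * ln (real n) < h n" using elim by linarith
    then show ?case using elim by (simp add: pos_less_divide_eq)
  qed
next
  have pos: "eventually (\<lambda>n. 0 < ln (real n)) sequentially"
    using filterlim_ln_nat by (simp add: filterlim_at_top_dense)
  fix a assume a: "\<alpha> < a"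
  define c where "c = (a + \<alpha>) / 2"
  have c: "c < a" "\<alpha> < c" using a by (auto simp: c_def)
  obtain K where K: "eventually (\<lambda>n. h n \<le> c * ln (real n) + K) sequentially" using up[OF c(2)] by blast
  have "filterlim (\<lambda>n. (a - c) * ln (real n)) at_top sequentially"
    using c by (intro filterlim_tendsto_pos_mult_at_top[OF tendsto_const] filterlim_ln_nat) auto
  then have "eventually (\<lambda>n. K < (a - c) * ln (real n)) sequentially" by (simp add: filterlim_at_top_dense)
  with K pos show "eventually (\<lambda>n. h n / ln (real n) < a) sequentially"
  proof eventually_elim
    case (elim n)
    have "(a - c) * ln (real n) = a * ln (real n) - c * ln (real n)" by (simp add: algebra_simps)
    then have "h n < a * ln (real n)" using elim by linarith
    then show ?case using elim by (simp add: pos_divide_less_eq)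
  qed
qed

section \<open>The two limits\<close>

context iid_attachment
begin

lemma height_limits:
  assumes law: "attachment_law D" and ac: "absolutely_continuous lborel D"
  defines "\<alpha> \<equiv> alpha_max D (\<lambda>r. r)"
  shows "AE \<omega> in M. (\<lambda>n. real (height (\<lambda>i. Xs i \<omega>) n) / ln (real n)) \<longlonglongrightarrow> \<alpha>"
    and "(\<lambda>n. expectation (\<lambda>\<omega>. real (height (\<lambda>i. Xs i \<omega>) n)) / ln (real n)) \<longlonglongrightarrow> \<alpha>"
proof -
  interpret D: attachment_law D by fact
  let ?H = "\<lambda>\<omega> n. real (height (\<lambda>i. Xs i \<omega>) n)"
  have \<alpha>0: "\<alpha> \<ge> 0" unfolding \<alpha>_def by (rule D.alpha_max_nonneg)
  have lo: "AE \<omega> in M. eventually (\<lambda>n. c * ln (real n) \<le> ?H \<omega> n) sequentially" if c: "c < \<alpha>" for c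
  proof (cases "c \<le> 0")
    case True
    have "eventually (\<lambda>n. c * ln (real n) \<le> h n) sequentially" if "\<And>n. 0 \<le> h n" for h
      using eventually_ge_at_top[of 1]
    proof eventually_elim
      case (elim n)
      have "c * ln (real n) \<le> 0" using True elim by (intro mult_nonpos_nonneg) auto
      then show ?case using that[of n] by linarith
    qed
    then show ?thesis by (intro AE_I2) simp
  next
    case False
    define c1 where "c1 = (c + \<alpha>) / 2"
    have c1: "c < c1" "c1 < \<alpha>" "0 < c1" using c False by (auto simp: c1_def)
    obtain q where "q < 1" "\<forall>t\<ge>0. exp (- (t + q) / c1) \<le> D.moment t"
      using D.below_alpha_max[OF c1(3)] c1(2) unfolding \<alpha>_def by blast
    then show ?thesis
      by (intro AE_height_lower_rate[OF law ac c1(3)]) (use c1 False in auto)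
  qed
  have up: "(AE \<omega> in M. \<exists>K. eventually (\<lambda>n. ?H \<omega> n \<le> c * ln (real n) + K) sequentially) \<and>
    (\<exists>K. \<forall>n\<ge>1. expectation (\<lambda>\<omega>. ?H \<omega> n) \<le> c * ln (real n) + K)" if c: "c > \<alpha>" for c
  proof -
    have c0: "c > 0" using c \<alpha>0 by linarith
    obtain t where t: "t > 0" "1 + t + c * ln (D.moment t) < 0" "D.moment t < 1"
      using D.above_alpha_max c unfolding \<alpha>_def by blast
    have m: "0 < D.moment t" using t by (intro D.moment_pos) simp
    have "AE \<omega> in M. \<exists>K. eventually (\<lambda>n. ?H \<omega> n \<le> c * ln (real n) + K) sequentially"
      using AE_height_upper[OF t(1) m t(3) D.moment_def c0 t(2)] by eventually_elim (rule exI)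
    moreover have "\<exists>K. \<forall>n\<ge>1. expectation (\<lambda>\<omega>. ?H \<omega> n) \<le> c * ln (real n) + K"
      using expectation_height_upper[OF t(1) m t(3) D.moment_def c0 t(2)] by (intro exI allI impI)
    ultimately show ?thesis by blast
  qed
  \<comment> \<open>Countably many rates suffice to approach \<open>\<alpha>\<close> from either
    side, so that the exceptional null sets can be united.\<close>
  have dn: "\<exists>j. a < \<alpha> - 1 / real (Suc j)" if lt: "a < \<alpha>" for a
  proof -
    obtain j where "inverse (real (Suc j)) < \<alpha> - a" using reals_Archimedean[of "\<alpha> - a"] lt by auto
    then show ?thesis by (intro exI[of _ j]) (simp add: inverse_eq_divide)
  qed
  have un: "\<exists>j. \<alpha> + 1 / real (Suc j) < a" if lt: "\<alpha> < a" for a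
  proof -
    obtain j where "inverse (real (Suc j)) < a - \<alpha>" using reals_Archimedean[of "a - \<alpha>"] lt by auto
    then show ?thesis by (intro exI[of _ j]) (simp add: inverse_eq_divide)
  qed
  have "AE \<omega> in M. \<forall>j. eventually (\<lambda>n. (\<alpha> - 1 / real (Suc j)) * ln (real n) \<le> ?H \<omega> n) sequentially"
    unfolding AE_all_countable by (intro allI lo) simp
  moreover have "AE \<omega> in M. \<forall>j. \<exists>K. eventually (\<lambda>n. ?H \<omega> n \<le> (\<alpha> + 1 / real (Suc j)) * ln (real n) + K) sequentially"
    unfolding AE_all_countable by (intro allI up[THEN conjunct1]) simp
  ultimately show AE_lim: "AE \<omega> in M. (\<lambda>n. ?H \<omega> n / ln (real n)) \<longlonglongrightarrow> \<alpha>"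
  proof eventually_elim
    case (elim \<omega>)
    show ?case
    proof (rule tendsto_log_rate)
      fix c assume "c < \<alpha>"
      then obtain j where j: "c < \<alpha> - 1 / real (Suc j)" using dn by blast
      show "eventually (\<lambda>n. c * ln (real n) \<le> ?H \<omega> n) sequentially"
        using elim(1)[rule_format, of j] eventually_ge_at_top[of 1]
      proof eventually_elim
        case (elim n)
        have "c * ln (real n) \<le> (\<alpha> - 1 / real (Suc j)) * ln (real n)"
          using j elim by (intro mult_right_mono) auto
        then show ?case using elim by linarith
      qed
    next
      fix c assume "\<alpha> < c"
      then obtain j where j: "\<alpha> + 1 / real (Suc j) < c" using un by blast
      obtain K where K: "eventually (\<lambda>n. ?H \<omega> n \<le> (\<alpha> + 1 / real (Suc j)) * ln (real n) + K) sequentially"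
        using elim(2) by blast
      have "eventually (\<lambda>n. ?H \<omega> n \<le> c * ln (real n) + K) sequentially"
        using K eventually_ge_at_top[of 1]
      proof eventually_elim
        case (elim n)
        have "(\<alpha> + 1 / real (Suc j)) * ln (real n) \<le> c * ln (real n)"
          using j elim by (intro mult_right_mono) auto
        then show ?case using elim by linarith
      qed
      then show "\<exists>K. eventually (\<lambda>n. ?H \<omega> n \<le> c * ln (real n) + K) sequentially" by blast
    qed
  qed
  \<comment> \<open>The mean inherits its lower bound from the almost sure limit; truncation at
    \<open>\<alpha>\<close> makes the variables bounded and keeps the limit.\<close>
  have Emin: "(\<lambda>n. expectation (\<lambda>\<omega>. min (?H \<omega> n / ln (real n)) \<alpha>)) \<longlonglongrightarrow> expectation (\<lambda>\<omega>. \<alpha>)"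
  proof (rule integral_dominated_convergence[where w="\<lambda>_. \<alpha>"])
    show "AE \<omega> in M. (\<lambda>n. min (?H \<omega> n / ln (real n)) \<alpha>) \<longlonglongrightarrow> \<alpha>"
      using AE_lim
    proof eventually_elim
      case (elim \<omega>)
      then have "(\<lambda>n. min (?H \<omega> n / ln (real n)) \<alpha>) \<longlonglongrightarrow> min \<alpha> \<alpha>" by (intro tendsto_min tendsto_const)
      then show ?case by simp
    qed
    show "AE \<omega> in M. norm (min (?H \<omega> n / ln (real n)) \<alpha>) \<le> \<alpha>" for n
    proof (rule AE_I2)
      fix \<omega>
      have "0 \<le> ln (real n)" by (cases "n = 0") auto
      then have "0 \<le> ?H \<omega> n / ln (real n)" by simp
      then show "norm (min (?H \<omega> n / ln (real n)) \<alpha>) \<le> \<alpha>" using \<alpha>0 by (simp add: min_def)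
    qed
  qed auto
  have E\<alpha>: "expectation (\<lambda>\<omega>. \<alpha>) = \<alpha>" by (simp add: prob_space)
  show "(\<lambda>n. expectation (\<lambda>\<omega>. ?H \<omega> n) / ln (real n)) \<longlonglongrightarrow> \<alpha>"
  proof (rule tendsto_log_rate)
    fix c assume c: "c < \<alpha>"
    have pos: "eventually (\<lambda>n. 0 < ln (real n)) sequentially"
      using filterlim_ln_nat by (simp add: filterlim_at_top_dense)
    have "eventually (\<lambda>n. c < expectation (\<lambda>\<omega>. min (?H \<omega> n / ln (real n)) \<alpha>)) sequentially"
      by (rule order_tendstoD(1)[OF Emin]) (simp only: E\<alpha> c)
    then show "eventually (\<lambda>n. c * ln (real n) \<le> expectation (\<lambda>\<omega>. ?H \<omega> n)) sequentially"
      using pos eventually_ge_at_top[of 1]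
    proof eventually_elim
      case (elim n)
      have int: "integrable M (\<lambda>\<omega>. ?H \<omega> n / ln (real n))"
        by (rule integrable_divide) (rule height_integrable[OF elim(3)])
      have "expectation (\<lambda>\<omega>. min (?H \<omega> n / ln (real n)) \<alpha>) \<le> expectation (\<lambda>\<omega>. ?H \<omega> n / ln (real n))"
        by (rule integral_mono[OF integrable_min[OF int integrable_const] int]) simp
      also have "\<dots> = expectation (\<lambda>\<omega>. ?H \<omega> n) / ln (real n)" by simp
      finally have "c \<le> expectation (\<lambda>\<omega>. ?H \<omega> n) / ln (real n)" using elim by linarith
      then show ?case using elim by (simp add: pos_le_divide_eq)
    qed
  next
    fix c assume "\<alpha> < c"
    then obtain K where K: "\<forall>n\<ge>1. expectation (\<lambda>\<omega>. ?H \<omega> n) \<le> c * ln (real n) + K"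
      using up[THEN conjunct2, of c] by blast
    then show "\<exists>K. eventually (\<lambda>n. expectation (\<lambda>\<omega>. ?H \<omega> n) \<le> c * ln (real n) + K) sequentially"
      unfolding eventually_sequentially by blast
  qed
qed

end

lemma alpha_max_distr:
  assumes [measurable]: "X \<in> borel_measurable N"
  shows "alpha_max N X = alpha_max (distr N borel X) (\<lambda>r. r)"
  by (simp add: alpha_max_def neg_log_mean_def Psi_def[abs_def] Lam_star_def Lam_def nn_integral_distr)

theorem theorem2:
  fixes N :: "'b measure" and X :: "'b \<Rightarrow> real" and f :: "real \<Rightarrow> ennreal"
    and M :: "'a measure" and Xs :: "nat \<Rightarrow> 'a \<Rightarrow> real"
  assumes "prob_space N"
    and "\<And>\<omega>. \<omega> \<in> space N \<Longrightarrow> X \<omega> \<in> {0..<1}"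
    and "distributed N lborel X f"
    and "prob_space M"
    and "prob_space.indep_vars M (\<lambda>_. borel) Xs UNIV"
    and "\<And>i. distr M borel (Xs i) = distr N borel X"
    and "\<And>i \<omega>. \<omega> \<in> space M \<Longrightarrow> Xs i \<omega> \<in> {0..<1}"
  shows "(AE \<omega> in M. (\<lambda>n. real (height (\<lambda>i. Xs i \<omega>) n) / ln (real n)) \<longlonglongrightarrow> alpha_max N X)
    \<and> (\<lambda>n. prob_space.expectation M (\<lambda>\<omega>. real (height (\<lambda>i. Xs i \<omega>) n)) / ln (real n))
        \<longlonglongrightarrow> alpha_max N X"
proof -
  define D where "D = distr N borel X"
  interpret N: prob_space N by fact
  interpret M: prob_space M by fact
  interpret iid_attachment M Xs D
    by unfold_locales (use assms in \<open>simp_all add: D_def\<close>)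
  have X [measurable]: "X \<in> borel_measurable N"
    using distributed_measurable[OF assms(3)] by simp
  have dens: "D = density lborel f"
  proof -
    have "D = distr N lborel X" unfolding D_def by (rule distr_cong) auto
    then show ?thesis using distributed_distr_eq_density[OF assms(3)] by simp
  qed
  have ac: "absolutely_continuous lborel D"
    unfolding dens by (rule absolutely_continuousI_density) (rule distributed_borel_measurable[OF assms(3)])
  \<comment> \<open>The value 0 is allowed by the range of \<open>X\<close> but has probability 0,
    by absolute continuity; so the law lives on the open unit interval.\<close>
  have "AE r in lborel. r \<noteq> (0::real)" by (rule AE_lborel_singleton)
  from absolutely_continuous_AE[OF _ ac this] have "AE r in D. r \<noteq> 0"
    by (simp add: D_def)
  with D_range have "AE r in D. 0 < r \<and> r < 1" by eventually_elim auto
  then have law: "attachment_law D"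
    using D_prob D_sets by (simp add: attachment_law_def attachment_law_axioms_def)
  have "alpha_max N X = alpha_max D (\<lambda>r. r)"
    unfolding D_def by (rule alpha_max_distr[OF X])
  then show ?thesis using height_limits[OF law ac] by simp
qed

end
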